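(* Consider $$dx_t=\frac1\varepsilon\bigl[(a_0+1-\cos(2\pi t))x_t-x_t^3\bigr]dt+\frac{\sigma}{\sqrt\varepsilon}dW_t,\qquad a_0>0,$$ started at a fixed time $t_0\in(-1,0)$ bounded away from $-1$ and $0$ from a deterministic initial condition $x_0>0$ in the right-hand potential well, and let $P_{\rm trans}=\mathbb P^{t_0,x_0}\{x_{t_1}<0\}$ for a fixed $t_1\in(0,1)$ bounded away from $0$ and $1$. Let $\sigma_c=a_0\vee\varepsilon^{2/3}$. Then, for $\varepsilon$ and $a_0$ sufficiently small, there exist constants $C,\kappa>0$ such that: (1) if $\sigma<\sigma_c$, then $P_{\rm trans}\le\frac C\varepsilon e^{-\kappa\sigma_c^2/\sigma^2}$; (2) if $\sigma>\sigma_c$ (and $\sigma$ small), then $P_{\rm trans}\ge\frac12-C\,e^{-\kappa\sigma^{3/2}/(\varepsilon|\log\sigma|)}$.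
   Context: $W_t$ standard Brownian motion; $a\vee b=\max(a,b)$. The drift derives from the symmetric potential $V(x,t)=\tfrac14x^4-\tfrac12\mu(t)x^2$ with $\mu(t)=a_0+1-\cos(2\pi t)$, whose wells are at $\pm\sqrt{\mu(t)}$ and whose barrier height $\mu(t)^2/4$ is smallest at integer times. *)

theory Defs
  imports "HOL-Probability.Probability"
begin

text \<open>Time-dependent coefficient mu(t) = a0 + 1 - cos(2 pi t) and the drift
  mu(t) x - x^3 = - dV/dx for V(x,t) = x^4/4 - mu(t) x^2/2.\<close>
definition mu :: "real \<Rightarrow> real \<Rightarrow> real" where
  "mu a0 t = a0 + 1 - cos (2 * pi * t)"

definition drift :: "real \<Rightarrow> real \<Rightarrow> real \<Rightarrow> real" where
  "drift a0 t x = mu a0 t * x - x ^ 3"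

definition brownian_motion :: "'a measure \<Rightarrow> (real \<Rightarrow> 'a \<Rightarrow> real) \<Rightarrow> bool" where
  "brownian_motion M W \<longleftrightarrow>
     prob_space M \<and>
     (\<forall>t. W t \<in> borel_measurable M) \<and>
     (\<forall>\<omega>\<in>space M. W 0 \<omega> = 0 \<and> continuous_on UNIV (\<lambda>t. W t \<omega>)) \<and>
     (\<forall>s t. s < t \<longrightarrow>
        distributed M lborel (\<lambda>\<omega>. W t \<omega> - W s \<omega>)
          (\<lambda>y. ennreal (normal_density 0 (sqrt (t - s)) y))) \<and>
     (\<forall>ts :: real list. sorted_wrt (<) ts \<longrightarrow>
        prob_space.indep_vars M (\<lambda>_. borel)
          (\<lambda>i \<omega>. W (ts ! Suc i) \<omega> - W (ts ! i) \<omega>) {..<length ts - 1})"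

text \<open>X solves  dx = (1/eps) drift(t,x) dt + (sigma / sqrt eps) dW  on [t0,t1]
  with X t0 = x0. Since the noise is additive, this is the pathwise integral equation
  (almost surely, with continuous paths).\<close>
definition sde_solution ::
  "'a measure \<Rightarrow> (real \<Rightarrow> 'a \<Rightarrow> real) \<Rightarrow> real \<Rightarrow> real \<Rightarrow> real \<Rightarrow> real \<Rightarrow> real \<Rightarrow> real
     \<Rightarrow> (real \<Rightarrow> 'a \<Rightarrow> real) \<Rightarrow> bool" where
  "sde_solution M W \<epsilon> a0 \<sigma> t0 t1 x0 X \<longleftrightarrow>
     (\<forall>t\<in>{t0..t1}. X t \<in> borel_measurable M) \<and>
     (AE \<omega> in M. continuous_on {t0..t1} (\<lambda>t. X t \<omega>) \<and>
        (\<forall>t\<in>{t0..t1}. X t \<omega> = x0 + integral {t0..t} (\<lambda>s. drift a0 s (X s \<omega>) / \<epsilon>)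
                             + \<sigma> / sqrt \<epsilon> * (W t \<omega> - W t0 \<omega>)))"

end

theory Submission
  imports Defs
begin

text \<open>
  \<^emph>\<open>Upper bound.\<close> Write \<open>\<gamma> = \<sigma>\<^sub>c\<close>. Subtract from the solution a time-discretised
  Ornstein--Uhlenbeck process with step \<open>\<epsilon>\<close> and damping rate \<open>\<gamma> / \<epsilon>\<close>, whose variance is at most
  \<open>\<sigma>\<^sup>2 / \<gamma>\<close>. As long as this process stays below a small multiple of \<open>\<surd>\<gamma>\<close>, the difference obeys a
  random differential equation for which a level of order \<open>\<surd>\<gamma>\<close> is a barrier. Exceeding that
  multiple during one of the \<open>O(1 / \<epsilon>)\<close> steps has probability \<open>O(exp (- \<kappa> \<gamma>\<^sup>2 / \<sigma>\<^sup>2))\<close>.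

  \<^emph>\<open>Lower bound.\<close> The drift is odd, so a path that has reached zero is negative at the final time
  with probability at least one half. This is proved for Euler chains, where the reflection
  principle only needs a sign flip of finitely many Gaussian increments, and transferred to the
  solution by pathwise convergence. For \<open>\<bar>t\<bar> \<le> \<surd>\<sigma>\<close> the well has width of order \<open>\<surd>\<sigma>\<close>, and on each
  of the \<open>\<sigma>\<^bsup>3/2\<^esup> / (2 \<epsilon>)\<close> disjoint blocks of length \<open>2 \<epsilon> / \<sigma>\<close> the path reaches zero, whatever
  its initial value, on an event of the Brownian increments whose probability does not depend on the
  parameters.
\<close>

section \<open>Reflection principle for chains\<close>

text \<open>Reflecting the solution itself would call for the strong Markov property; a chain can be
  split over its first non-positive index using only independent symmetric increments. Steps are
  monotone only for a globally Lipschitz drift, so the state is truncated and the radius sent to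
  infinity. A chain ending in \<open>{- \<eta>..\<eta>}\<close> says nothing about the sign of the
  solution. Hence the grid ends with one step of length \<open>\<nu>\<close> that is not refined
  with the mesh: its drift error is of order \<open>\<nu>\<close> and its Gaussian noise of order
  \<open>sqrt \<nu>\<close>, so a small \<open>\<nu>\<close> makes the error, and the probability of
  a strip just wide enough to absorb it, negligible.

  The two candidates for \<open>\<gamma>\<close> are the two ways to survive the window
  \<open>\<bar>t\<bar> \<le> sqrt \<gamma>\<close>. If \<open>\<gamma> = a0\<close>, the well
  supports a barrier of order \<open>sqrt \<gamma>\<close> even at time zero. If
  \<open>\<gamma> * sqrt \<gamma> = \<epsilon>\<close>, the drift at that height has speed of order
  one and displaces the path by order \<open>sqrt \<gamma>\<close>, comparable with the barrier;
  since the downward drift is cubic in the height, a small factor \<open>B\<close> in the barrier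
  decides the comparison.\<close>

primrec chain :: "(nat \<Rightarrow> real \<Rightarrow> real) \<Rightarrow> real \<Rightarrow> (nat \<Rightarrow> real) \<Rightarrow> nat \<Rightarrow> real" where
  "chain F y z 0 = y"
| "chain F y z (Suc k) = F k (chain F y z k) + z k"

lemma chain_cong:
  "(\<And>i. i < k \<Longrightarrow> z i = z' i) \<Longrightarrow> chain F y z k = chain F y z' k"
  by (induction k) auto

lemma measurable_chain:
  assumes "\<And>i. i < N \<Longrightarrow> Z i \<in> borel_measurable M"
    and "\<And>i. i < N \<Longrightarrow> mono (F i)" and "k \<le> N"
  shows "(\<lambda>\<omega>. chain F y (\<lambda>i. Z i \<omega>) k) \<in> borel_measurable M"
  using assms(3)
proof (induction k)
  case (Suc k)
  then have [measurable]: "Z k \<in> borel_measurable M"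
    "(\<lambda>\<omega>. chain F y (\<lambda>i. Z i \<omega>) k) \<in> borel_measurable M"
    using assms(1)[of k] by simp_all
  have [measurable]: "F k \<in> borel_measurable borel"
    using Suc assms(2)[of k] by (simp add: borel_measurable_mono)
  show ?case by simp
qed simp

text \<open>At index \<open>j\<close> the chain is non-positive, hence at or below its own negative.
  By oddness the negative of the chain is again a chain, driven by \<open>- z\<close>, and monotone
  steps preserve the order of two chains with the same noise. Only an inequality survives because
  the visit may overshoot zero.\<close>

lemma chain_flip_le:
  assumes odd: "\<And>i x. i < N \<Longrightarrow> F i (- x) = - F i x"
    and mono: "\<And>i. i < N \<Longrightarrow> mono (F i)"
    and "chain F y z j \<le> 0" "j \<le> N"
  shows "chain F y (\<lambda>i. if i < j then z i else - z i) N \<le> - chain F y z N"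
proof -
  let ?z = "\<lambda>i. if i < j then z i else - z i"
  have "j + d \<le> N \<Longrightarrow> chain F y ?z (j + d) \<le> - chain F y z (j + d)" for d
  proof (induction d)
    case 0
    have "chain F y ?z j = chain F y z j" by (rule chain_cong) auto
    then show ?case using assms by simp
  next
    case (Suc d)
    then have "F (j + d) (chain F y ?z (j + d)) \<le> F (j + d) (- chain F y z (j + d))"
      using mono[of "j + d"] by (auto simp: mono_def)
    also have "\<dots> = - F (j + d) (chain F y z (j + d))"
      using Suc by (intro odd) auto
    finally show ?case by simp
  qed
  from this[of "N - j"] assms show ?thesis by simp
qed

context prob_space
begin

text \<open>Independence makes the law of the vector a product, and each factor is symmetric. The
  switching index \<open>j\<close> is deterministic; the random first visit is treated later by
  splitting over its values.\<close>

lemma distr_restrict_flip: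
  fixes Z :: "nat \<Rightarrow> 'a \<Rightarrow> real"
  assumes indep: "indep_vars (\<lambda>_. borel) Z {..<N}"
    and sym: "\<And>i. i < N \<Longrightarrow> distr M borel (\<lambda>\<omega>. - Z i \<omega>) = distr M borel (Z i)"
  shows "distr M (\<Pi>\<^sub>M i\<in>{..<N}. borel) (\<lambda>\<omega>. \<lambda>i\<in>{..<N}. if i < j then Z i \<omega> else - Z i \<omega>)
       = distr M (\<Pi>\<^sub>M i\<in>{..<N}. borel) (\<lambda>\<omega>. \<lambda>i\<in>{..<N}. Z i \<omega>)"
proof (cases "N = 0")
  case False
  then have ne: "{..<N} \<noteq> {}" by auto
  let ?f = "\<lambda>i x. if i < j then x else - x :: real"
  have rv: "\<And>i. i \<in> {..<N} \<Longrightarrow> random_variable borel (Z i)"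
    using indep by (auto simp: indep_vars_def)
  have indep': "indep_vars (\<lambda>_. borel) (\<lambda>i \<omega>. ?f i (Z i \<omega>)) {..<N}"
    by (rule indep_vars_compose2[OF indep]) auto
  have rv': "\<And>i. i \<in> {..<N} \<Longrightarrow> random_variable borel (\<lambda>\<omega>. ?f i (Z i \<omega>))"
    using indep' by (auto simp: indep_vars_def)
  have "distr M (\<Pi>\<^sub>M i\<in>{..<N}. borel) (\<lambda>\<omega>. \<lambda>i\<in>{..<N}. ?f i (Z i \<omega>))
      = (\<Pi>\<^sub>M i\<in>{..<N}. distr M borel (\<lambda>\<omega>. ?f i (Z i \<omega>)))"
    by (rule iffD1[OF indep_vars_iff_distr_eq_PiM' indep']) (use ne rv' in auto)
  also have "\<dots> = (\<Pi>\<^sub>M i\<in>{..<N}. distr M borel (Z i))"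
  proof (rule PiM_cong[OF refl])
    fix i assume "i \<in> {..<N}"
    then show "distr M borel (\<lambda>\<omega>. ?f i (Z i \<omega>)) = distr M borel (Z i)"
      by (cases "i < j") (simp_all add: sym)
  qed
  also have "\<dots> = distr M (\<Pi>\<^sub>M i\<in>{..<N}. borel) (\<lambda>\<omega>. \<lambda>i\<in>{..<N}. Z i \<omega>)"
    using indep_vars_iff_distr_eq_PiM'[OF ne rv] indep by simp
  finally show ?thesis .
qed (simp add: restrict_def)

text \<open>Reflection principle for a chain with odd monotone steps: after the first visit \<open>j\<close> to
  \<open>(-\<infinity>, 0]\<close> the noise may be replaced by its negative without changing the law, and the chain
  with the flipped noise stays below the reflected chain.\<close>
lemma reflection_chain:
  fixes Z :: "nat \<Rightarrow> 'a \<Rightarrow> real" and y \<eta> :: real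
    and F :: "nat \<Rightarrow> real \<Rightarrow> real"
  assumes indep: "indep_vars (\<lambda>_. borel) Z {..<N}"
    and sym: "\<And>i. i < N \<Longrightarrow> distr M borel (\<lambda>\<omega>. - Z i \<omega>) = distr M borel (Z i)"
    and odd: "\<And>i x. i < N \<Longrightarrow> F i (- x) = - F i x"
    and mono: "\<And>i. i < N \<Longrightarrow> mono (F i)"
  defines "Y \<equiv> (\<lambda>\<omega>. chain F y (\<lambda>i. Z i \<omega>))"
  shows "prob {\<omega>\<in>space M. \<exists>k\<le>N. Y \<omega> k \<le> 0}
       \<le> prob {\<omega>\<in>space M. \<bar>Y \<omega> N\<bar> \<le> \<eta>} + 2 * prob {\<omega>\<in>space M. Y \<omega> N < - \<eta>}"
proof -
  have rv: "\<And>i. i < N \<Longrightarrow> Z i \<in> borel_measurable M"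
    using indep by (auto simp: indep_vars_def)
  let ?P = "\<Pi>\<^sub>M i\<in>{..<N}. (borel :: real measure)"
  have mP: "(\<lambda>z. chain F y z k) \<in> borel_measurable ?P" if "k \<le> N" for k
    using measurable_chain[of N "\<lambda>i z. z i" ?P F k y] mono that by auto
  have mY [measurable]: "(\<lambda>\<omega>. Y \<omega> k) \<in> borel_measurable M" if "k \<le> N" for k
    unfolding Y_def using that by (intro measurable_chain rv mono) auto
  define first where "first j z \<longleftrightarrow> chain F y z j \<le> 0 \<and> (\<forall>i<j. \<not> chain F y z i \<le> 0)" for j z
  define T where "T j = {\<omega>\<in>space M. first j (\<lambda>i. Z i \<omega>)}" for j
  have mT [measurable]: "T j \<in> events" if "j \<le> N" for j
  proof -
    have *[measurable]: "\<And>i. i < j \<Longrightarrow> (\<lambda>\<omega>. Y \<omega> i) \<in> borel_measurable M"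
      "(\<lambda>\<omega>. Y \<omega> j) \<in> borel_measurable M"
      using that by (auto intro!: mY)
    have eq: "T j = {\<omega>\<in>space M. Y \<omega> j \<le> 0} \<inter> {\<omega>\<in>space M. \<forall>i\<in>{..<j}. \<not> Y \<omega> i \<le> 0}"
      unfolding T_def first_def Y_def by auto
    have "{\<omega>\<in>space M. \<forall>i\<in>{..<j}. \<not> Y \<omega> i \<le> 0} \<in> events"
      by (rule sets.sets_Collect_finite_All) (auto intro!: borel_measurable_le simp: not_le *)
    then show ?thesis unfolding eq by (intro sets.Int) auto
  qed
  have YN: "(\<lambda>\<omega>. Y \<omega> N) \<in> borel_measurable M" by (rule mY) simp
  note [measurable] = YN
  have mA: "{\<omega>\<in>space M. Y \<omega> N < - \<eta>} \<in> events" "{\<omega>\<in>space M. Y \<omega> N > \<eta>} \<in> events"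
     "{\<omega>\<in>space M. \<bar>Y \<omega> N\<bar> \<le> \<eta>} \<in> events"
    by measurable
  \<comment> \<open>Flipping the noise from \<open>j\<close> on maps paths ending above
    \<open>\<eta>\<close> to paths ending below \<open>- \<eta>\<close> without changing the
    law.\<close>
  have step: "prob (T j \<inter> {\<omega>\<in>space M. Y \<omega> N > \<eta>}) \<le> prob (T j \<inter> {\<omega>\<in>space M. Y \<omega> N < - \<eta>})"
    if "j \<le> N" for j
  proof -
    let ?r = "\<lambda>\<omega>. \<lambda>i\<in>{..<N}. Z i \<omega>"
    let ?s = "\<lambda>\<omega>. \<lambda>i\<in>{..<N}. if i < j then Z i \<omega> else - Z i \<omega>"
    let ?A = "{z\<in>space ?P. first j z \<and> chain F y z N < - \<eta>}"
    have *[measurable]: "\<And>i. i < j \<Longrightarrow> (\<lambda>z. chain F y z i) \<in> borel_measurable ?P"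
      "(\<lambda>z. chain F y z j) \<in> borel_measurable ?P" "(\<lambda>z. chain F y z N) \<in> borel_measurable ?P"
      using that by (auto intro!: mP)
    have eq: "?A = {z\<in>space ?P. chain F y z N < - \<eta>} \<inter> {z\<in>space ?P. chain F y z j \<le> 0}
        \<inter> {z\<in>space ?P. \<forall>i\<in>{..<j}. \<not> chain F y z i \<le> 0}"
      unfolding first_def by auto
    have "{z\<in>space ?P. \<forall>i\<in>{..<j}. \<not> chain F y z i \<le> 0} \<in> sets ?P"
      by (rule sets.sets_Collect_finite_All) (auto intro!: borel_measurable_le simp: not_le *)
    then have A: "?A \<in> sets ?P" unfolding eq by (intro sets.Int) auto
    have mr: "?r \<in> measurable M ?P" "?s \<in> measurable M ?P"
      using rv by (auto intro!: measurable_restrict)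
    have ch: "chain F y (?r \<omega>) k = Y \<omega> k" 
      "chain F y (?s \<omega>) k = chain F y (\<lambda>i. if i < j then Z i \<omega> else - Z i \<omega>) k"
      if "k \<le> N" for k \<omega>
      unfolding Y_def using that by (auto intro!: chain_cong)
    have fl: "chain F y (\<lambda>i. if i < j then Z i \<omega> else - Z i \<omega>) k = Y \<omega> k" if "k \<le> j" for k \<omega>
      unfolding Y_def using that by (auto intro!: chain_cong)
    \<comment> \<open>\<open>first j\<close> reads only the noise before index \<open>j\<close>,
      which the flip leaves alone.\<close>
    have firsts: "first j (?s \<omega>) \<longleftrightarrow> first j (\<lambda>i. Z i \<omega>)" for \<omega>
      unfolding first_def using that by (simp add: ch fl) (simp add: Y_def)
    have firstr: "first j (?r \<omega>) \<longleftrightarrow> first j (\<lambda>i. Z i \<omega>)" for \<omega>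
      unfolding first_def using that by (simp add: ch) (simp add: Y_def)
    have "prob (T j \<inter> {\<omega>\<in>space M. Y \<omega> N > \<eta>}) \<le> prob (?s -` ?A \<inter> space M)"
    proof (rule finite_measure_mono)
      show "T j \<inter> {\<omega>\<in>space M. Y \<omega> N > \<eta>} \<subseteq> ?s -` ?A \<inter> space M"
      proof
        fix \<omega> assume "\<omega> \<in> T j \<inter> {\<omega>\<in>space M. Y \<omega> N > \<eta>}"
        then have w: "\<omega> \<in> T j" "\<eta> < Y \<omega> N" "\<omega> \<in> space M" by auto
        have 1: "?s \<omega> \<in> space ?P" using mr(2) w(3) by (rule measurable_space)
        have 2: "first j (?s \<omega>)" unfolding firsts using w by (simp add: T_def)
        have "chain F y (?s \<omega>) N \<le> - Y \<omega> N"
          unfolding ch(2)[OF order_refl] Y_def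
          by (rule chain_flip_le[OF odd mono _ that]) (use w in \<open>auto simp: T_def first_def\<close>)
        then have "chain F y (?s \<omega>) N < - \<eta>" using w by linarith
        with 1 2 w show "\<omega> \<in> ?s -` ?A \<inter> space M" by blast
      qed
    qed (use mr A in \<open>auto intro: measurable_sets\<close>)
    also have "\<dots> = measure (distr M ?P ?s) ?A"
      using mr A by (simp add: measure_distr)
    also have "\<dots> = measure (distr M ?P ?r) ?A"
      by (simp only: distr_restrict_flip[OF indep sym])
    also have "\<dots> = prob (?r -` ?A \<inter> space M)"
      using mr A by (simp add: measure_distr)
    also have "?r -` ?A \<inter> space M = T j \<inter> {\<omega>\<in>space M. Y \<omega> N < - \<eta>}"
      using mr(1) by (auto simp: firstr ch T_def measurable_def)
    finally show ?thesis .
  qed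
  have disj: "disjoint_family_on T {..N}"
    unfolding disjoint_family_on_def T_def first_def by (auto, metis nat_neq_iff)
  have H: "{\<omega>\<in>space M. \<exists>k\<le>N. Y \<omega> k \<le> 0} = (\<Union>j\<le>N. T j)"
  proof safe
    fix \<omega> k assume "\<omega> \<in> space M" "k \<le> N" "Y \<omega> k \<le> 0"
    then have "Y \<omega> (LEAST k. Y \<omega> k \<le> 0) \<le> 0" "(LEAST k. Y \<omega> k \<le> 0) \<le> N"
      "\<forall>i<(LEAST k. Y \<omega> k \<le> 0). \<not> Y \<omega> i \<le> 0"
      using LeastI[of "\<lambda>k. Y \<omega> k \<le> 0" k] Least_le[of "\<lambda>k. Y \<omega> k \<le> 0" k] not_less_Least by auto
    with \<open>\<omega> \<in> space M\<close> show "\<omega> \<in> (\<Union>j\<le>N. T j)" unfolding T_def first_def Y_def by auto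
  qed (auto simp: T_def first_def Y_def)
  have sumT: "prob ((\<Union>j\<le>N. T j) \<inter> A) = (\<Sum>j\<le>N. prob (T j \<inter> A))" if "A \<in> events" for A
  proof -
    have "prob (\<Union>j\<in>{..N}. T j \<inter> A) = (\<Sum>j\<le>N. prob (T j \<inter> A))"
      using that disj
      by (intro finite_measure_finite_Union) (auto simp: disjoint_family_on_def)
    then show ?thesis by (simp add: UN_extend_simps del: UN_simps)
  qed
  let ?U = "\<Union>j\<le>N. T j"
  have mU: "?U \<in> events" by auto
  \<comment> \<open>The strip around zero is kept apart: a later Euler error may reverse the sign of
    such end points.\<close>
  have "prob ?U \<le> prob ((?U \<inter> {\<omega>\<in>space M. Y \<omega> N < - \<eta>}) \<union> (?U \<inter> {\<omega>\<in>space M. Y \<omega> N > \<eta>})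
      \<union> {\<omega>\<in>space M. \<bar>Y \<omega> N\<bar> \<le> \<eta>})"
    using mU mA by (intro finite_measure_mono) (auto simp: T_def)
  also have "\<dots> \<le> prob (?U \<inter> {\<omega>\<in>space M. Y \<omega> N < - \<eta>}) + prob (?U \<inter> {\<omega>\<in>space M. Y \<omega> N > \<eta>})
      + prob {\<omega>\<in>space M. \<bar>Y \<omega> N\<bar> \<le> \<eta>}"
    using mU mA by (intro order_trans[OF measure_Un_le] add_mono) auto
  also have "prob (?U \<inter> {\<omega>\<in>space M. Y \<omega> N > \<eta>}) \<le> prob (?U \<inter> {\<omega>\<in>space M. Y \<omega> N < - \<eta>})"
    unfolding sumT[OF mA(1)] sumT[OF mA(2)] by (rule sum_mono) (use step in auto)
  also have "prob (?U \<inter> {\<omega>\<in>space M. Y \<omega> N < - \<eta>}) \<le> prob {\<omega>\<in>space M. Y \<omega> N < - \<eta>}"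
    using mU mA by (intro finite_measure_mono) auto
  finally show ?thesis unfolding H by simp
qed

end

section \<open>Gaussian estimates and Brownian motion\<close>

context prob_space
begin

text \<open>Continuity from below along the increasing sets of points that lie in every
  \<open>B n\<close> with \<open>n \<ge> m\<close>. It carries bounds from dyadic grids over to
  events in continuous time.\<close>

lemma prob_le_if_eventually_in:
  assumes B: "\<And>n. B n \<in> events" "\<And>n. prob (B n) \<le> c" and A: "A \<in> events"
    and ev: "AE \<omega> in M. \<omega> \<in> A \<longrightarrow> (\<forall>\<^sub>F n in sequentially. \<omega> \<in> B n)"
  shows "prob A \<le> c"
proof -
  define C where "C m = (\<Inter>n\<in>{m..}. B n)" for m :: nat
  have C: "C m \<in> events" for m unfolding C_def by (intro sets.countable_INT') (auto simp: B)
  have "incseq C" unfolding C_def incseq_def by auto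
  have "C m \<subseteq> B m" for m unfolding C_def by auto
  then have "prob (C m) \<le> c" for m
    using B(2)[of m] finite_measure_mono[OF _ B(1), of "C m" m] by auto
  moreover have "(\<lambda>m. prob (C m)) \<longlonglongrightarrow> prob (\<Union>m. C m)"
    using C \<open>incseq C\<close> by (intro finite_Lim_measure_incseq) auto
  ultimately have "prob (\<Union>m. C m) \<le> c" by (intro LIMSEQ_le_const2) auto
  moreover have "prob A \<le> prob (\<Union>m. C m)"
  proof (rule finite_measure_mono_AE)
    show "AE \<omega> in M. \<omega> \<in> A \<longrightarrow> \<omega> \<in> (\<Union>m. C m)"
      using ev by eventually_elim (force simp: C_def eventually_sequentially)
  qed (use C in auto)
  ultimately show ?thesis by simp
qed

lemma prob_tendsto_0_if_eventually_notin:
  assumes B: "\<And>n. B n \<in> events"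
    and ev: "AE \<omega> in M. \<forall>\<^sub>F n in sequentially. \<omega> \<notin> B n"
  shows "(\<lambda>n. prob (B n)) \<longlonglongrightarrow> 0"
proof -
  define C where "C m = space M - (\<Union>n\<in>{m..}. B n)" for m :: nat
  have C: "C m \<in> events" for m
    unfolding C_def using B by (intro sets.Diff sets.top sets.countable_UN') auto
  have "incseq C" unfolding C_def incseq_def by auto
  then have "(\<lambda>m. prob (C m)) \<longlonglongrightarrow> prob (\<Union>m. C m)"
    using C by (intro finite_Lim_measure_incseq) auto
  moreover have "prob (\<Union>m. C m) = 1"
  proof (rule prob_eq_1[THEN iffD2])
    show "AE \<omega> in M. \<omega> \<in> (\<Union>m. C m)"
      using ev AE_space by eventually_elim (force simp: C_def eventually_sequentially)
  qed (use C in auto)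
  ultimately have "(\<lambda>m. prob (C m)) \<longlonglongrightarrow> 1" by simp
  from tendsto_diff[OF tendsto_const[of 1] this]
  have lim: "(\<lambda>m. 1 - prob (C m)) \<longlonglongrightarrow> 0" by simp
  have "prob (B m) \<le> 1 - prob (C m)" for m
  proof -
    have "prob (B m) \<le> prob (space M - C m)"
      using B C sets.sets_into_space[OF B] by (intro finite_measure_mono) (auto simp: C_def)
    then show ?thesis using prob_compl[OF C] by simp
  qed
  then show ?thesis
    by (intro tendsto_sandwich[OF _ _ tendsto_const lim]) auto
qed

text \<open>For \<open>x \<ge> h \<ge> 0\<close> one has
  \<open>x\<^sup>2 \<ge> h\<^sup>2 + (x - h)\<^sup>2\<close>, so on the tail the density is at most
  the exponential factor times the density centred at \<open>h\<close>, which has mass one.\<close>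

lemma normal_upper_tail:
  assumes Z: "distributed M lborel Z (\<lambda>x. ennreal (normal_density 0 s x))" and "0 < s" "0 \<le> h"
  shows "prob {\<omega>\<in>space M. h \<le> Z \<omega>} \<le> exp (- h\<^sup>2 / (2 * s\<^sup>2))"
proof -
  let ?e = "exp (- h\<^sup>2 / (2 * s\<^sup>2))"
  have pt: "normal_density 0 s x * indicator {h..} x \<le> ?e * normal_density h s x" for x
  proof (cases "h \<le> x")
    case True
    have "h * h \<le> x * h" using True \<open>0 \<le> h\<close> by (rule mult_right_mono)
    then have "- (x\<^sup>2) \<le> - h\<^sup>2 - (x - h)\<^sup>2" by (simp add: power2_eq_square algebra_simps)
    then have "- (x\<^sup>2) / (2 * s\<^sup>2) \<le> (- h\<^sup>2 - (x - h)\<^sup>2) / (2 * s\<^sup>2)"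
      by (rule divide_right_mono) simp
    then have "exp (- (x\<^sup>2) / (2 * s\<^sup>2)) \<le> ?e * exp (- (x - h)\<^sup>2 / (2 * s\<^sup>2))"
      by (simp add: exp_add[symmetric] diff_divide_distrib)
    then show ?thesis using True \<open>0 < s\<close>
      by (simp add: normal_density_def divide_simps)
  qed (simp add: normal_density_nonneg)
  have "emeasure M {\<omega>\<in>space M. h \<le> Z \<omega>} = emeasure M (Z -` {h..} \<inter> space M)"
    by (rule arg_cong[where f="emeasure M"]) auto
  also have "\<dots> = (\<integral>\<^sup>+x. ennreal (normal_density 0 s x) * indicator {h..} x \<partial>lborel)"
    using Z by (intro distributed_emeasure) auto
  also have "\<dots> \<le> (\<integral>\<^sup>+x. ennreal ?e * ennreal (normal_density h s x) \<partial>lborel)"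
    using pt by (intro nn_integral_mono)
      (auto simp: ennreal_mult'[symmetric] ennreal_indicator[symmetric] normal_density_nonneg
        intro!: ennreal_leI simp del: ennreal_indicator)
  also have "\<dots> = ennreal ?e * (\<integral>\<^sup>+x. ennreal (normal_density h s x) \<partial>lborel)"
    by (intro nn_integral_cmult) auto
  also have "(\<integral>\<^sup>+x. ennreal (normal_density h s x) \<partial>lborel) = 1"
    using \<open>0 < s\<close> by (simp add: nn_integral_eq_integral normal_density_nonneg)
  finally show ?thesis by (simp add: emeasure_eq_measure)
qed

lemma distributed_normal_scale:
  assumes "distributed M lborel Z (\<lambda>x. ennreal (normal_density 0 s x))" "0 < s" "c \<noteq> 0"
  shows "distributed M lborel (\<lambda>\<omega>. c * Z \<omega>) (\<lambda>x. ennreal (normal_density 0 (\<bar>c\<bar> * s) x))"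
  using normal_density_affine[OF assms, of 0] by simp

lemma distr_uminus_normal:
  assumes Z: "distributed M lborel Z (\<lambda>x. ennreal (normal_density 0 s x))" and "0 < s"
  shows "distr M borel (\<lambda>\<omega>. - Z \<omega>) = distr M borel Z"
proof -
  have "distributed M lborel (\<lambda>\<omega>. - Z \<omega>) (\<lambda>x. ennreal (normal_density 0 s x))"
    using distributed_normal_scale[OF assms, of "-1"] by simp
  then have "distr M lborel (\<lambda>\<omega>. - Z \<omega>) = distr M lborel Z"
    using Z by (simp add: distributed_def)
  moreover have "distr M borel f = distr M lborel f" for f :: "'a \<Rightarrow> real"
    by (rule distr_cong) auto
  ultimately show ?thesis by simp
qed

lemma normal_abs_tail:
  assumes Z: "distributed M lborel Z (\<lambda>x. ennreal (normal_density 0 s x))" and "0 < s" "0 \<le> h"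
  shows "prob {\<omega>\<in>space M. h \<le> \<bar>Z \<omega>\<bar>} \<le> 2 * exp (- h\<^sup>2 / (2 * s\<^sup>2))"
proof -
  have [measurable]: "Z \<in> borel_measurable M" using Z by (auto simp: distributed_def)
  have "prob {\<omega>\<in>space M. h \<le> \<bar>Z \<omega>\<bar>} \<le> prob ({\<omega>\<in>space M. h \<le> Z \<omega>} \<union> {\<omega>\<in>space M. h \<le> - Z \<omega>})"
    by (intro finite_measure_mono) auto
  also have "\<dots> \<le> prob {\<omega>\<in>space M. h \<le> Z \<omega>} + prob {\<omega>\<in>space M. h \<le> - Z \<omega>}"
    by (rule measure_Un_le) auto
  also have "\<dots> \<le> exp (- h\<^sup>2 / (2 * s\<^sup>2)) + exp (- h\<^sup>2 / (2 * s\<^sup>2))"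
    using distributed_normal_scale[OF Z \<open>0 < s\<close>, of "-1"] assms
    by (intro add_mono normal_upper_tail) auto
  finally show ?thesis by simp
qed

text \<open>For a fixed value of \<open>U\<close> the event confines \<open>Z\<close> to an interval
  of length \<open>2 * \<eta>\<close>, where the density is at most \<open>1 / (2 * s)\<close>
  because \<open>sqrt (2 * pi) \<ge> 2\<close>. Independence allows integration over
  \<open>U\<close>, whatever its law.\<close>

lemma small_ball_add_normal:
  assumes indep: "indep_var borel U borel Z"
    and Z: "distributed M lborel Z (\<lambda>x. ennreal (normal_density 0 s x))" and "0 < s" "0 \<le> \<eta>"
  shows "prob {\<omega>\<in>space M. \<bar>U \<omega> + Z \<omega>\<bar> \<le> \<eta>} \<le> \<eta> / s"
proof -
  have [measurable]: "U \<in> borel_measurable M" "Z \<in> borel_measurable M"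
    using indep by (auto dest: indep_var_rv1 indep_var_rv2)
  let ?U = "distr M borel U" and ?Z = "distr M borel Z"
  interpret PU: prob_space ?U by (rule prob_space_distr) simp
  interpret PZ: prob_space ?Z by (rule prob_space_distr) simp
  let ?A = "{p :: real \<times> real. \<bar>fst p + snd p\<bar> \<le> \<eta>}"
  have [measurable]: "?A \<in> sets (borel \<Otimes>\<^sub>M borel)"
  proof -
    have "{p\<in>space (borel \<Otimes>\<^sub>M borel). \<bar>fst p + snd p\<bar> \<le> \<eta>} \<in> sets (borel \<Otimes>\<^sub>M borel)" by measurable
    then show ?thesis by (simp add: space_pair_measure)
  qed
  have peak: "normal_density 0 s x \<le> 1 / (2 * s)" for x
  proof -
    have "2 \<le> sqrt (2 * pi)" using pi_ge_two by (intro real_le_rsqrt) auto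
    then have "2 * s \<le> sqrt (2 * pi * s\<^sup>2)" using \<open>0 < s\<close> by (simp add: real_sqrt_mult)
    then have "1 / sqrt (2 * pi * s\<^sup>2) \<le> 1 / (2 * s)"
      using \<open>0 < s\<close> by (intro divide_left_mono) auto
    moreover have "exp (- x\<^sup>2 / (2 * s\<^sup>2)) \<le> 1" by simp
    ultimately have "1 / sqrt (2 * pi * s\<^sup>2) * exp (- x\<^sup>2 / (2 * s\<^sup>2)) \<le> 1 / (2 * s) * 1"
      using \<open>0 < s\<close> by (intro mult_mono) auto
    then show ?thesis by (simp add: normal_density_def)
  qed
  have sec: "emeasure ?Z (Pair u -` ?A) \<le> ennreal (\<eta> / s)" for u
  proof -
    have e: "Pair u -` ?A = {- \<eta> - u .. \<eta> - u}" by auto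
    have "emeasure ?Z (Pair u -` ?A) = emeasure M (Z -` {- \<eta> - u .. \<eta> - u} \<inter> space M)"
      unfolding e by (rule emeasure_distr) auto
    also have "\<dots> = (\<integral>\<^sup>+x. ennreal (normal_density 0 s x) * indicator {- \<eta> - u .. \<eta> - u} x \<partial>lborel)"
      using Z by (intro distributed_emeasure) auto
    also have "\<dots> \<le> (\<integral>\<^sup>+x. ennreal (1 / (2 * s)) * indicator {- \<eta> - u .. \<eta> - u} x \<partial>lborel)"
      using peak by (intro nn_integral_mono mult_right_mono ennreal_leI) auto
    also have "\<dots> = ennreal (1 / (2 * s)) * emeasure lborel {- \<eta> - u .. \<eta> - u}"
      by (intro nn_integral_cmult_indicator) auto
    also have "\<dots> = ennreal (\<eta> / s)"
      using \<open>0 < s\<close> \<open>0 \<le> \<eta>\<close> by (simp add: ennreal_mult'[symmetric] field_simps)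
    finally show ?thesis .
  qed
  have "emeasure M {\<omega>\<in>space M. \<bar>U \<omega> + Z \<omega>\<bar> \<le> \<eta>}
      = emeasure (distr M (borel \<Otimes>\<^sub>M borel) (\<lambda>\<omega>. (U \<omega>, Z \<omega>))) ?A"
    by (subst emeasure_distr) (auto intro!: arg_cong[where f="emeasure M"])
  also have "\<dots> = emeasure (?U \<Otimes>\<^sub>M ?Z) ?A"
    using indep_var_distribution_eq[THEN iffD1, OF indep] by simp
  also have "\<dots> = (\<integral>\<^sup>+u. emeasure ?Z (Pair u -` ?A) \<partial>?U)"
    by (rule PZ.emeasure_pair_measure_alt) simp
  also have "\<dots> \<le> (\<integral>\<^sup>+u. ennreal (\<eta> / s) \<partial>?U)"
    by (intro nn_integral_mono sec)
  also have "\<dots> = ennreal (\<eta> / s)" using PU.emeasure_space_1 by simp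
  finally show ?thesis using assms by (simp add: emeasure_eq_measure)
qed

end

text \<open>The witness is the last grid point at or before \<open>t\<close>: its distance to
  \<open>t\<close> is below the mesh, and strictness of \<open>h < f t\<close> leaves a
  neighbourhood on which \<open>f\<close> still exceeds \<open>h\<close>.\<close>

lemma continuous_gt_on_dyadic_grid:
  fixes f :: "real \<Rightarrow> real"
  assumes cont: "continuous_on UNIV f" and t: "s \<le> t" "t \<le> s + D" and "h < f t" and "0 < D"
  shows "\<forall>\<^sub>F m in sequentially. \<exists>k\<le>2^m. h < f (s + real k * (D / 2^m))"
proof -
  have "\<exists>e>0. \<forall>t'. dist t' t < e \<longrightarrow> dist (f t') (f t) < f t - h"
    using cont \<open>h < f t\<close> by (simp add: continuous_on_iff)
  then obtain e where "e > 0" and e: "\<And>t'. dist t' t < e \<Longrightarrow> dist (f t') (f t) < f t - h" by auto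
  have "(\<lambda>m. D / 2^m) \<longlonglongrightarrow> 0"
    by (rule LIMSEQ_divide_realpow_zero) simp
  then have "\<forall>\<^sub>F m in sequentially. D / 2^m < e"
    using \<open>e > 0\<close> by (rule order_tendstoD)
  then show ?thesis
  proof eventually_elim
    case (elim m)
    let ?d = "D / 2^m"
    let ?k = "nat \<lfloor>(t - s) / ?d\<rfloor>"
    have d: "?d > 0" using \<open>0 < D\<close> by simp
    have k: "real ?k \<le> (t - s) / ?d" "(t - s) / ?d < real ?k + 1"
      using t d by (auto simp: of_nat_nat)
    have "(t - s) / ?d \<le> D / ?d" using t d by (intro divide_right_mono) auto
    also have "D / ?d = 2^m" using \<open>0 < D\<close> by simp
    finally have "real ?k \<le> real (2^m)" using k(1) unfolding of_nat_power of_nat_numeral by linarith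
    then have k2: "?k \<le> 2^m" by (simp only: of_nat_le_iff)
    have "real ?k * ?d \<le> t - s" "t - s < real ?k * ?d + ?d"
      using k d by (simp_all only: pos_le_divide_eq pos_divide_less_eq distrib_right mult_1)
    moreover have "\<bar>s + a - t\<bar> < b" if "a \<le> t - s" "t - s < a + b" for a b :: real
      using that by arith
    ultimately have "dist (s + real ?k * ?d) t < ?d"
      unfolding dist_real_def by blast
    then have "dist (f (s + real ?k * ?d)) (f t) < f t - h" using elim by (intro e) simp
    then have "h < f (s + real ?k * ?d)" by (simp add: dist_real_def abs_if split: if_splits)
    with k2 show ?case by blast
  qed
qed

section \<open>Brownian motion: independent increments and maximal inequalities\<close>

locale brownian =
  fixes M :: "'a measure" and W :: "real \<Rightarrow> 'a \<Rightarrow> real"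
  assumes bm: "brownian_motion M W"
begin

sublocale prob_space M
  using bm by (simp add: brownian_motion_def)

lemma W_measurable [measurable]: "W t \<in> borel_measurable M"
  using bm by (simp add: brownian_motion_def)

lemma W_continuous: "\<omega> \<in> space M \<Longrightarrow> continuous_on UNIV (\<lambda>t. W t \<omega>)"
  using bm by (simp add: brownian_motion_def)

lemma W_increment:
  "s < t \<Longrightarrow> distributed M lborel (\<lambda>\<omega>. W t \<omega> - W s \<omega>) (\<lambda>y. ennreal (normal_density 0 (sqrt (t - s)) y))"
  using bm by (simp add: brownian_motion_def)

lemma W_indep_increments:
  assumes "\<And>i. i < N \<Longrightarrow> t i < (t (Suc i) :: real)"
  shows "indep_vars (\<lambda>_. borel) (\<lambda>i \<omega>. W (t (Suc i)) \<omega> - W (t i) \<omega>) {..<N}"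
proof -
  have lt: "t i < t j" if "i < j" "j \<le> N" for i j
    using that
  proof (induction j)
    case (Suc j)
    then show ?case using assms[of j] by (cases "i = j") (auto intro: less_trans)
  qed simp
  let ?ts = "map t [0..<Suc N]"
  have nth: "?ts ! i = t i" if "i \<le> N" for i
    using that by (subst nth_map) (auto simp del: upt_Suc)
  have "sorted_wrt (<) ?ts"
    unfolding sorted_wrt_iff_nth_less
  proof (intro allI impI)
    fix i j assume "i < j" "j < length ?ts"
    then show "?ts ! i < ?ts ! j" using lt[of i j] nth[of i] nth[of j] by auto
  qed
  then have "indep_vars (\<lambda>_. borel) (\<lambda>i \<omega>. W (?ts ! Suc i) \<omega> - W (?ts ! i) \<omega>) {..<length ?ts - 1}"
    using bm unfolding brownian_motion_def by blast
  then show ?thesis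
    by (rule indep_vars_cong[THEN iffD1, rotated 3]) (auto simp: nth simp del: upt_Suc)
qed

text \<open>Reflection for the chain with identity steps started at \<open>h\<close>: it becomes
  non-positive exactly when the walk reaches \<open>h\<close>. The factor \<open>c\<close> is
  \<open>1\<close> or \<open>-1\<close> and serves both tails.\<close>

lemma W_grid_max:
  fixes c d h s :: real
  assumes "0 < d" "0 \<le> h" "c\<^sup>2 = 1"
  shows "prob {\<omega>\<in>space M. \<exists>k\<le>N. h \<le> c * (W (s + real k * d) \<omega> - W s \<omega>)}
    \<le> 2 * exp (- h\<^sup>2 / (2 * (real N * d)))"
proof (cases "N = 0")
  case True
  \<comment> \<open>For \<open>N = 0\<close> the quotient divides by zero and equals
    \<open>0\<close>, so the bound is \<open>2\<close>.\<close>
  then show ?thesis by (auto intro: order_trans[OF prob_le_1])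
next
  case False
  have c: "c \<noteq> 0" "\<bar>c\<bar> = 1" using assms by (auto simp: power2_eq_1_iff)
  let ?t = "\<lambda>i. s + real i * d"
  let ?Z = "\<lambda>i \<omega>. - c * (W (?t (Suc i)) \<omega> - W (?t i) \<omega>)"
  let ?Y = "\<lambda>\<omega>. chain (\<lambda>_ x. x) h (\<lambda>i. ?Z i \<omega>)"
  have lt: "?t i < ?t (Suc i)" for i using \<open>0 < d\<close> by simp
  have indep: "indep_vars (\<lambda>_. borel) ?Z {..<N}"
    by (rule indep_vars_compose2[OF W_indep_increments[of N ?t]]) (use lt in auto)
  have Z: "distributed M lborel (?Z i) (\<lambda>y. ennreal (normal_density 0 (sqrt d) y))" for i
    using distributed_normal_scale[OF W_increment[OF lt], where c="- c"] c \<open>0 < d\<close>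
    by (simp add: algebra_simps)
  have Y: "?Y \<omega> k = h - c * (W (?t k) \<omega> - W s \<omega>)" for \<omega> k
    by (induction k) (auto simp: algebra_simps)
  have "prob {\<omega>\<in>space M. \<exists>k\<le>N. ?Y \<omega> k \<le> 0}
       \<le> prob {\<omega>\<in>space M. \<bar>?Y \<omega> N\<bar> \<le> 0} + 2 * prob {\<omega>\<in>space M. ?Y \<omega> N < - 0}"
    using \<open>0 < d\<close>
    by (intro reflection_chain indep distr_uminus_normal[OF Z]) (auto simp: mono_def)
  \<comment> \<open>With \<open>\<eta> = 0\<close> the strip is the single point \<open>0\<close>;
    doubling its probability merges it with the lower event into a closed tail.\<close>
  also have "\<dots> \<le> 2 * (prob {\<omega>\<in>space M. ?Y \<omega> N = 0} + prob {\<omega>\<in>space M. ?Y \<omega> N < 0})"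
    by simp
  also have "prob {\<omega>\<in>space M. ?Y \<omega> N = 0} + prob {\<omega>\<in>space M. ?Y \<omega> N < 0}
      = prob ({\<omega>\<in>space M. ?Y \<omega> N = 0} \<union> {\<omega>\<in>space M. ?Y \<omega> N < 0})"
    unfolding Y by (intro finite_measure_Union[symmetric]) auto
  also have "\<dots> = prob {\<omega>\<in>space M. h \<le> c * (W (?t N) \<omega> - W s \<omega>)}"
    unfolding Y by (rule arg_cong[where f=prob]) auto
  also have "\<dots> \<le> exp (- h\<^sup>2 / (2 * (sqrt (real N * d))\<^sup>2))"
    using distributed_normal_scale[OF W_increment[of s "?t N"], where c=c] c assms False
    by (intro normal_upper_tail) auto
  finally show ?thesis using assms False unfolding Y by simp
qed

lemma W_grid_abs_max:
  assumes "0 < d" "0 \<le> h"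
  shows "prob {\<omega>\<in>space M. \<exists>k\<le>N. h \<le> \<bar>W (s + real k * d) \<omega> - W s \<omega>\<bar>}
    \<le> 4 * exp (- h\<^sup>2 / (2 * (real N * d)))"
proof -
  let ?A = "\<lambda>c. {\<omega>\<in>space M. \<exists>k\<le>N. h \<le> c * (W (s + real k * d) \<omega> - W s \<omega>)}"
  have "prob {\<omega>\<in>space M. \<exists>k\<le>N. h \<le> \<bar>W (s + real k * d) \<omega> - W s \<omega>\<bar>} \<le> prob (?A 1 \<union> ?A (-1))"
    by (intro finite_measure_mono) (auto simp: abs_if split: if_splits)
  also have "\<dots> \<le> prob (?A 1) + prob (?A (-1))"
    by (rule measure_Un_le) auto
  also have "\<dots> \<le> 2 * exp (- h\<^sup>2 / (2 * (real N * d))) + 2 * exp (- h\<^sup>2 / (2 * (real N * d)))"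
    using assms by (intro add_mono W_grid_max) auto
  finally show ?thesis by simp
qed

text \<open>A strict exceedance by a continuous path is already visible on a fine dyadic grid. This
  yields measurability of an uncountable union and transfers the grid bound, which depends on the
  grid only through its total length \<open>D\<close>.\<close>

lemma W_max:
  assumes "0 < D" "0 \<le> h"
  shows "{\<omega>\<in>space M. \<exists>t\<in>{s..s + D}. h < \<bar>W t \<omega> - W s \<omega>\<bar>} \<in> events" (is "?S \<in> events")
    and "prob {\<omega>\<in>space M. \<exists>t\<in>{s..s + D}. h < \<bar>W t \<omega> - W s \<omega>\<bar>} \<le> 4 * exp (- h\<^sup>2 / (2 * D))"
proof -
  let ?B = "\<lambda>m. {\<omega>\<in>space M. \<exists>k\<le>2^m. h < \<bar>W (s + real k * (D / 2^m)) \<omega> - W s \<omega>\<bar>}"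
  have ev: "\<forall>\<^sub>F m in sequentially. \<omega> \<in> ?B m" if "\<omega> \<in> ?S" for \<omega>
  proof -
    from that obtain t where t: "s \<le> t" "t \<le> s + D" "h < \<bar>W t \<omega> - W s \<omega>\<bar>" and w: "\<omega> \<in> space M"
      by auto
    have "continuous_on UNIV (\<lambda>t. \<bar>W t \<omega> - W s \<omega>\<bar>)"
      using W_continuous[OF w] by (intro continuous_intros)
    from continuous_gt_on_dyadic_grid[OF this t \<open>0 < D\<close>] w show ?thesis by simp
  qed
  have B: "?B m \<in> events" for m by measurable
  have "?S = (\<Union>m. ?B m)"
  proof
    show "?S \<subseteq> (\<Union>m. ?B m)"
    proof
      fix \<omega> assume "\<omega> \<in> ?S"
      from ev[OF this] obtain m where "\<omega> \<in> ?B m" using eventually_happens by force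
      then show "\<omega> \<in> (\<Union>m. ?B m)" by blast
    qed
    show "(\<Union>m. ?B m) \<subseteq> ?S"
    proof safe
      fix m \<omega> and k :: nat assume "k \<le> 2 ^ m" "h < \<bar>W (s + real k * (D / 2^m)) \<omega> - W s \<omega>\<bar>"
      moreover have "real k * (D / 2^m) \<le> real (2^m) * (D / 2^m)"
        using \<open>k \<le> 2^m\<close> \<open>0 < D\<close> by (intro mult_right_mono) (simp_all only: of_nat_le_iff, simp)
      moreover have "real (2^m) * (D / 2^m) = D" by simp
      ultimately show "\<exists>t\<in>{s..s + D}. h < \<bar>W t \<omega> - W s \<omega>\<bar>"
        using \<open>0 < D\<close> by (intro bexI[of _ "s + real k * (D / 2^m)"]) auto
    qed
  qed
  then show S: "?S \<in> events" using B by auto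
  have "prob (?B m) \<le> 4 * exp (- h\<^sup>2 / (2 * D))" for m
  proof -
    have "prob (?B m) \<le> prob {\<omega>\<in>space M. \<exists>k\<le>2^m. h \<le> \<bar>W (s + real k * (D / 2^m)) \<omega> - W s \<omega>\<bar>}"
      by (intro finite_measure_mono) (auto intro: less_imp_le)
    also have "\<dots> \<le> 4 * exp (- h\<^sup>2 / (2 * (real (2^m) * (D / 2^m))))"
      using assms by (intro W_grid_abs_max) auto
    finally show ?thesis by simp
  qed
  show "prob ?S \<le> 4 * exp (- h\<^sup>2 / (2 * D))"
  proof (rule prob_le_if_eventually_in[of ?B, OF B _ S])
    show "prob (?B m) \<le> 4 * exp (- h\<^sup>2 / (2 * D))" for m by fact
    show "AE \<omega> in M. \<omega> \<in> ?S \<longrightarrow> (\<forall>\<^sub>F m in sequentially. \<omega> \<in> ?B m)"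
      by (intro AE_I2 impI ev)
  qed
qed

end

section \<open>Euler approximation\<close>

context prob_space
begin

text \<open>\<open>S j\<close> collects the points that avoid \<open>B j m\<close> for all large
  \<open>m\<close>. Its complement becomes negligible as \<open>j\<close> grows, and inside a fixed
  \<open>S j\<close> the sets \<open>B j m\<close> become negligible as \<open>m\<close> grows. In
  the application \<open>j\<close> governs the truncation radius and \<open>m\<close> the
  mesh.\<close>

lemma prob_iterated_eventually_notin:
  assumes B: "\<And>j m :: nat. B j m \<in> events"
    and ev: "AE \<omega> in M. \<forall>\<^sub>F j in sequentially. \<forall>\<^sub>F m in sequentially. \<omega> \<notin> B j m"
    and "0 < \<zeta>"
  shows "\<forall>\<^sub>F j in sequentially. \<forall>\<^sub>F m in sequentially. prob (B j m) < \<zeta>"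
proof -
  define S where "S j = (\<Union>m. \<Inter>n\<in>{m..}. space M - B j n)" for j
  have S: "S j \<in> events" for j
    unfolding S_def by (intro sets.countable_UN'' sets.countable_INT') (use B in auto)
  have inS: "\<omega> \<in> S j \<longleftrightarrow> \<omega> \<in> space M \<and> (\<forall>\<^sub>F m in sequentially. \<omega> \<notin> B j m)" for j \<omega>
    unfolding S_def eventually_sequentially by auto
  have "(\<lambda>j. prob (space M - S j)) \<longlonglongrightarrow> 0"
  proof (rule prob_tendsto_0_if_eventually_notin)
    show "AE \<omega> in M. \<forall>\<^sub>F j in sequentially. \<omega> \<notin> space M - S j"
      using ev AE_space
    proof eventually_elim
      case (elim \<omega>)
      then show ?case by (auto simp: inS elim: eventually_mono)
    qed
  qed (use S in auto)
  then have "\<forall>\<^sub>F j in sequentially. prob (space M - S j) < \<zeta> / 2"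
    using \<open>0 < \<zeta>\<close> by (intro order_tendstoD) auto
  then show ?thesis
  proof eventually_elim
    case (elim j)
    have "(\<lambda>m. prob (B j m \<inter> S j)) \<longlonglongrightarrow> 0"
    proof (rule prob_tendsto_0_if_eventually_notin)
      show "AE \<omega> in M. \<forall>\<^sub>F m in sequentially. \<omega> \<notin> B j m \<inter> S j"
      proof (rule AE_I2)
        fix \<omega>
        show "\<forall>\<^sub>F m in sequentially. \<omega> \<notin> B j m \<inter> S j"
          by (cases "\<omega> \<in> S j") (auto simp: inS elim: eventually_mono)
      qed
    qed (use B S in auto)
    then have "\<forall>\<^sub>F m in sequentially. prob (B j m \<inter> S j) < \<zeta> / 2"
      using \<open>0 < \<zeta>\<close> by (intro order_tendstoD) auto
    then show ?case
    proof eventually_elim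
      case inner: (elim m)
      have "prob (B j m) \<le> prob ((B j m \<inter> S j) \<union> (space M - S j))"
        using B S sets.sets_into_space[OF B, of j m] by (intro finite_measure_mono) auto
      also have "\<dots> \<le> prob (B j m \<inter> S j) + prob (space M - S j)"
        using B S by (intro measure_Un_le) auto
      finally show ?case using inner elim by simp
    qed
  qed
qed

text \<open>The chain up to index \<open>n\<close> reads only the noise before \<open>n\<close>.
  This is the independence that the small-ball estimate needs for the last step.\<close>

lemma indep_var_chain_step:
  fixes Z :: "nat \<Rightarrow> 'a \<Rightarrow> real"
  assumes indep: "indep_vars (\<lambda>_. borel) Z {..<Suc n}"
    and mono: "\<And>i. i < Suc n \<Longrightarrow> mono (F i)"
  shows "indep_var borel (\<lambda>\<omega>. F n (chain F y (\<lambda>i. Z i \<omega>) n)) borel (Z n)"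
proof -
  let ?P = "\<lambda>I. \<Pi>\<^sub>M i\<in>I. (borel :: real measure)"
  have [measurable]: "F n \<in> borel_measurable borel"
    using mono[of n] by (simp add: borel_measurable_mono)
  have [measurable]: "(\<lambda>z. chain F y z n) \<in> borel_measurable (?P {..<n})"
    using measurable_chain[of n "\<lambda>i z. z i" "?P {..<n}" F n y] mono by auto
  have m1: "(\<lambda>z. F n (chain F y z n)) \<in> measurable (?P {..<n}) borel" by measurable
  have m2: "(\<lambda>z. z n) \<in> measurable (?P {n}) borel" by simp
  have "indep_var (?P {..<n}) (\<lambda>\<omega>. restrict (\<lambda>i. Z i \<omega>) {..<n})
      (?P {n}) (\<lambda>\<omega>. restrict (\<lambda>i. Z i \<omega>) {n})"
    by (rule indep_var_restrict[OF indep]) auto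
  from indep_var_compose[OF this m1 m2]
  have "indep_var borel (\<lambda>\<omega>. F n (chain F y (restrict (\<lambda>i. Z i \<omega>) {..<n}) n))
     borel (\<lambda>\<omega>. restrict (\<lambda>i. Z i \<omega>) {n} n)"
    by (simp add: comp_def)
  moreover have "chain F y (restrict (\<lambda>i. Z i \<omega>) {..<n}) n = chain F y (\<lambda>i. Z i \<omega>) n" for \<omega>
    by (rule chain_cong) auto
  ultimately show ?thesis by simp
qed

end

section \<open>Truncated drift and monotone Euler steps\<close>

definition clip :: "real \<Rightarrow> real \<Rightarrow> real" where
  "clip R y = max (- R) (min R y)"

text \<open>A Lipschitz constant in space, uniform in time, for the drift after
  \<open>clip R\<close>: \<open>\<bar>a0\<bar> + 2\<close> bounds \<open>mu\<close> in absolute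
  value and \<open>3 * R\<^sup>2\<close> bounds the difference quotient of the cube.\<close>

definition clip_rate :: "real \<Rightarrow> real \<Rightarrow> real" where
  "clip_rate a0 R = \<bar>a0\<bar> + 2 + 3 * R\<^sup>2"

lemma mu_bounds: "a0 \<le> mu a0 t" "mu a0 t \<le> a0 + 2"
  using cos_le_one[of "2 * pi * t"] cos_ge_minus_one[of "2 * pi * t"] by (auto simp: mu_def)

lemma clip_id: "\<bar>y\<bar> \<le> R \<Longrightarrow> clip R y = y"
  by (auto simp: clip_def)

lemma abs_clip_le: "0 \<le> R \<Longrightarrow> \<bar>clip R y\<bar> \<le> R"
  by (auto simp: clip_def)

lemma clip_uminus: "0 \<le> R \<Longrightarrow> clip R (- y) = - clip R y"
  by (auto simp: clip_def max_def min_def)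

lemma clip_lipschitz: "\<bar>clip R u - clip R v\<bar> \<le> \<bar>u - v\<bar>"
  by (auto simp: clip_def max_def min_def)

lemma drift_uminus: "drift a0 t (- y) = - drift a0 t y"
  by (simp add: drift_def)

lemma drift_clip_lipschitz:
  assumes "0 \<le> R"
  shows "\<bar>drift a0 t (clip R u) - drift a0 t (clip R v)\<bar> \<le> clip_rate a0 R * \<bar>u - v\<bar>"
proof -
  let ?u = "clip R u" and ?v = "clip R v"
  have b: "\<bar>?u\<bar> \<le> R" "\<bar>?v\<bar> \<le> R" using abs_clip_le[OF assms] by auto
  have "\<bar>a * c\<bar> \<le> R * R" if "\<bar>a\<bar> \<le> R" "\<bar>c\<bar> \<le> R" for a c
    unfolding abs_mult using that assms by (intro mult_mono) auto
  with b have "\<bar>?u * ?u\<bar> \<le> R * R" "\<bar>?u * ?v\<bar> \<le> R * R" "\<bar>?v * ?v\<bar> \<le> R * R"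
    by blast+
  then have r: "\<bar>mu a0 t - (?u * ?u + ?u * ?v + ?v * ?v)\<bar> \<le> clip_rate a0 R"
    using mu_bounds[of a0 t] unfolding clip_rate_def power2_eq_square by linarith
  have "drift a0 t ?u - drift a0 t ?v = (mu a0 t - (?u * ?u + ?u * ?v + ?v * ?v)) * (?u - ?v)"
    by (simp add: drift_def power3_eq_cube algebra_simps)
  then have "\<bar>drift a0 t ?u - drift a0 t ?v\<bar> = \<bar>mu a0 t - (?u * ?u + ?u * ?v + ?v * ?v)\<bar> * \<bar>?u - ?v\<bar>"
    by (simp add: abs_mult)
  also have "\<dots> \<le> clip_rate a0 R * \<bar>u - v\<bar>"
    using r clip_lipschitz by (intro mult_mono) (auto simp: clip_rate_def)
  finally show ?thesis .
qed

lemma abs_drift_clip_le: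
  assumes "0 \<le> R"
  shows "\<bar>drift a0 t (clip R u)\<bar> \<le> clip_rate a0 R * R"
proof -
  have "clip R (clip R u) = clip R u" "clip R 0 = 0" using assms by (auto simp: clip_def)
  then have "\<bar>drift a0 t (clip R u)\<bar> \<le> clip_rate a0 R * \<bar>clip R u\<bar>"
    using drift_clip_lipschitz[OF assms, of a0 t "clip R u" 0] by (simp add: drift_def)
  also have "\<dots> \<le> clip_rate a0 R * R"
    using abs_clip_le[OF assms] by (intro mult_left_mono) (auto simp: clip_rate_def)
  finally show ?thesis .
qed

definition euler_step :: "real \<Rightarrow> real \<Rightarrow> real \<Rightarrow> (nat \<Rightarrow> real) \<Rightarrow> nat \<Rightarrow> real \<Rightarrow> real" where
  "euler_step \<epsilon> a0 R \<tau> k y = y + (\<tau> (Suc k) - \<tau> k) / \<epsilon> * drift a0 (\<tau> k) (clip R y)"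

lemma euler_step_uminus:
  "0 \<le> R \<Longrightarrow> euler_step \<epsilon> a0 R \<tau> k (- y) = - euler_step \<epsilon> a0 R \<tau> k y"
  by (simp add: euler_step_def clip_uminus drift_uminus)

text \<open>The drift changes the distance of two points by at most the fraction
  \<open>small\<close> allows, that is, by at most the distance itself, so it cannot swap
  them.\<close>

lemma mono_euler_step:
  assumes "0 \<le> R" "0 < \<epsilon>" "\<tau> k \<le> \<tau> (Suc k)"
    and small: "(\<tau> (Suc k) - \<tau> k) * clip_rate a0 R \<le> \<epsilon>"
  shows "mono (euler_step \<epsilon> a0 R \<tau> k)"
proof (rule monoI)
  fix u v :: real assume "u \<le> v"
  let ?h = "(\<tau> (Suc k) - \<tau> k) / \<epsilon>" and ?d = "\<lambda>y. drift a0 (\<tau> k) (clip R y)"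
  have "?h * (?d u - ?d v) \<le> ?h * \<bar>?d u - ?d v\<bar>"
    using assms by (intro mult_left_mono) auto
  also have "\<dots> \<le> ?h * (clip_rate a0 R * \<bar>u - v\<bar>)"
    using assms by (intro mult_left_mono drift_clip_lipschitz) auto
  also have "\<dots> = (?h * clip_rate a0 R) * (v - u)"
    using \<open>u \<le> v\<close> by simp
  also have "\<dots> \<le> 1 * (v - u)"
    using small \<open>0 < \<epsilon>\<close> \<open>u \<le> v\<close> by (intro mult_right_mono) (auto simp: field_simps)
  finally show "euler_step \<epsilon> a0 R \<tau> k u \<le> euler_step \<epsilon> a0 R \<tau> k v"
    by (simp add: euler_step_def right_diff_distrib)
qed

section \<open>Deterministic analysis of a single solution path\<close>

locale sde_path =
  fixes \<epsilon> a0 \<sigma> t0 t1 x0 :: real and x w :: "real \<Rightarrow> real"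
  assumes eps_pos: "0 < \<epsilon>"
    and cont_x: "continuous_on {t0..t1} x"
    and x_eq: "\<And>t. t \<in> {t0..t1} \<Longrightarrow>
      x t = x0 + integral {t0..t} (\<lambda>s. drift a0 s (x s) / \<epsilon>) + \<sigma> / sqrt \<epsilon> * (w t - w t0)"
begin

lemma cont_drift: "continuous_on {t0..t1} (\<lambda>t. drift a0 t (x t))"
  unfolding drift_def mu_def by (intro continuous_intros cont_x)

lemma x_t0: "t0 \<le> t1 \<Longrightarrow> x t0 = x0"
  using x_eq[of t0] by simp

lemma x_increment:
  assumes "t0 \<le> s" "s \<le> t" "t \<le> t1"
  shows "x t - x s = integral {s..t} (\<lambda>u. drift a0 u (x u) / \<epsilon>) + \<sigma> / sqrt \<epsilon> * (w t - w s)"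
proof -
  have c: "continuous_on {t0..t1} (\<lambda>u. drift a0 u (x u) / \<epsilon>)"
    using cont_drift eps_pos by (intro continuous_intros) auto
  have "integral {t0..s} (\<lambda>u. drift a0 u (x u) / \<epsilon>) + integral {s..t} (\<lambda>u. drift a0 u (x u) / \<epsilon>)
      = integral {t0..t} (\<lambda>u. drift a0 u (x u) / \<epsilon>)"
    using assms by (intro Henstock_Kurzweil_Integration.integral_combine integrable_continuous_real
        continuous_on_subset[OF c]) auto
  then show ?thesis
    using x_eq[of t] x_eq[of s] assms by (simp add: algebra_simps)
qed

text \<open>Comparison with one Euler step whose drift is frozen at a free constant: the value at
  the left end point in the error recursion, and \<open>0\<close> where only a bound on the drift is
  used.\<close>

lemma x_step:
  assumes "t0 \<le> s" "s \<le> t" "t \<le> t1" and "\<And>u. u \<in> {s..t} \<Longrightarrow> \<bar>drift a0 u (x u) - c\<bar> \<le> \<zeta>"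
  shows "\<bar>x t - (x s + (t - s) / \<epsilon> * c + \<sigma> / sqrt \<epsilon> * (w t - w s))\<bar> \<le> (t - s) / \<epsilon> * \<zeta>"
proof -
  have c: "continuous_on {s..t} (\<lambda>u. drift a0 u (x u) / \<epsilon>)"
    using eps_pos assms by (intro continuous_intros continuous_on_subset[OF cont_drift]) auto
  have "\<bar>drift a0 u (x u) / \<epsilon> - c / \<epsilon>\<bar> \<le> \<zeta> / \<epsilon>" if "u \<in> {s..t}" for u
    using assms(4)[OF that] eps_pos
    by (simp add: diff_divide_distrib[symmetric] divide_right_mono)
  then have "norm (integral {s..t} (\<lambda>u. drift a0 u (x u) / \<epsilon> - c / \<epsilon>)) \<le> \<zeta> / \<epsilon> * (t - s)"
    using assms by (intro integral_bound continuous_intros c) auto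
  also have "integral {s..t} (\<lambda>u. drift a0 u (x u) / \<epsilon> - c / \<epsilon>)
      = integral {s..t} (\<lambda>u. drift a0 u (x u) / \<epsilon>) - integral {s..t} (\<lambda>u. c / \<epsilon>)"
    by (intro Henstock_Kurzweil_Integration.integral_diff integrable_continuous_real c continuous_intros)
  also have "\<dots> = x t - (x s + (t - s) / \<epsilon> * c + \<sigma> / sqrt \<epsilon> * (w t - w s))"
    using x_increment[OF assms(1-3)] assms by (simp add: algebra_simps)
  finally show ?thesis by (simp add: mult.commute)
qed

text \<open>Discrete Gronwall: a step of scaled length \<open>h\<close> multiplies the error by at
  most \<open>1 + h * L \<le> exp (h * L)\<close> and adds \<open>h * \<zeta>\<close>. The chain
  uses the truncated drift, but the path stays within \<open>R\<close>, where truncation changes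
  nothing.\<close>

lemma euler_error:
  assumes \<tau>: "\<tau> 0 = t0" "\<And>k. k < n \<Longrightarrow> \<tau> k \<le> \<tau> (Suc k)" "\<tau> n \<le> t1"
    and bd: "\<And>t. t \<in> {t0..t1} \<Longrightarrow> \<bar>x t\<bar> \<le> R" and "0 \<le> R" "0 \<le> \<zeta>" "t0 \<le> t1"
    and osc: "\<And>k u. k < n \<Longrightarrow> u \<in> {\<tau> k..\<tau> (Suc k)} \<Longrightarrow>
      \<bar>drift a0 u (x u) - drift a0 (\<tau> k) (x (\<tau> k))\<bar> \<le> \<zeta>"
    and "k \<le> n"
  defines "L \<equiv> clip_rate a0 R"
  defines "Y \<equiv> chain (euler_step \<epsilon> a0 R \<tau>) x0 (\<lambda>i. \<sigma> / sqrt \<epsilon> * (w (\<tau> (Suc i)) - w (\<tau> i)))"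
  shows "\<bar>x (\<tau> k) - Y k\<bar> \<le> (\<tau> k - t0) / \<epsilon> * \<zeta> * exp (L * (\<tau> k - t0) / \<epsilon>)"
  using \<open>k \<le> n\<close>
proof (induction k)
  case 0
  show ?case using \<tau> x_t0[OF \<open>t0 \<le> t1\<close>] by (simp add: Y_def)
next
  case (Suc k)
  have up: "i \<le> j \<Longrightarrow> j \<le> n \<Longrightarrow> \<tau> i \<le> \<tau> j" for i j
  proof (induction j)
    case (Suc j)
    then show ?case using \<tau>(2)[of j] by (cases "i = Suc j") auto
  qed simp
  have k: "t0 \<le> \<tau> k" "\<tau> k \<le> \<tau> (Suc k)" "\<tau> (Suc k) \<le> t1" "\<tau> k \<le> t1"
    using up[of 0 k] up[of k "Suc k"] up[of "Suc k" n] up[of k n] \<tau>(1,3) Suc.prems by auto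
  define h where "h = (\<tau> (Suc k) - \<tau> k) / \<epsilon>"
  have h: "0 \<le> h" using k eps_pos by (simp add: h_def)
  have L: "0 \<le> L" by (simp add: L_def clip_rate_def)
  let ?n = "\<sigma> / sqrt \<epsilon> * (w (\<tau> (Suc k)) - w (\<tau> k))"
  have 1: "\<bar>x (\<tau> (Suc k)) - (x (\<tau> k) + h * drift a0 (\<tau> k) (x (\<tau> k)) + ?n)\<bar> \<le> h * \<zeta>"
    unfolding h_def using k Suc.prems by (intro x_step osc) auto
  have "drift a0 (\<tau> k) (x (\<tau> k)) = drift a0 (\<tau> k) (clip R (x (\<tau> k)))"
    using bd[of "\<tau> k"] k by (simp add: clip_id)
  then have "\<bar>h * drift a0 (\<tau> k) (x (\<tau> k)) - h * drift a0 (\<tau> k) (clip R (Y k))\<bar> \<le> h * (L * \<bar>x (\<tau> k) - Y k\<bar>)"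
    using drift_clip_lipschitz[OF \<open>0 \<le> R\<close>, of a0 "\<tau> k" "x (\<tau> k)" "Y k"] h
    by (simp add: right_diff_distrib[symmetric] abs_mult L_def mult_left_mono)
  moreover have "Y (Suc k) = Y k + h * drift a0 (\<tau> k) (clip R (Y k)) + ?n"
    by (simp add: Y_def euler_step_def h_def)
  ultimately have "\<bar>x (\<tau> (Suc k)) - Y (Suc k)\<bar> \<le> \<bar>x (\<tau> k) - Y k\<bar> + h * (L * \<bar>x (\<tau> k) - Y k\<bar>) + h * \<zeta>"
    using 1 by linarith
  also have "\<dots> = (1 + h * L) * \<bar>x (\<tau> k) - Y k\<bar> + h * \<zeta>" by (simp add: algebra_simps)
  also have "\<dots> \<le> exp (h * L) * ((\<tau> k - t0) / \<epsilon> * \<zeta> * exp (L * (\<tau> k - t0) / \<epsilon>)) + h * \<zeta>"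
    using Suc exp_ge_add_one_self[of "h * L"] h L \<open>0 \<le> \<zeta>\<close> by (intro add_mono mult_mono) auto
  also have "exp (h * L) * ((\<tau> k - t0) / \<epsilon> * \<zeta> * exp (L * (\<tau> k - t0) / \<epsilon>))
      = (\<tau> k - t0) / \<epsilon> * \<zeta> * exp (L * (\<tau> (Suc k) - t0) / \<epsilon>)"
    using eps_pos by (simp add: h_def mult_exp_exp algebra_simps diff_divide_distrib add_divide_distrib)
  also have "h * \<zeta> \<le> h * \<zeta> * exp (L * (\<tau> (Suc k) - t0) / \<epsilon>)"
    using mult_left_mono[of 1 "exp (L * (\<tau> (Suc k) - t0) / \<epsilon>)" "h * \<zeta>"]
      h L k eps_pos \<open>0 \<le> \<zeta>\<close> by simp
  also have "(\<tau> k - t0) / \<epsilon> * \<zeta> * exp (L * (\<tau> (Suc k) - t0) / \<epsilon>)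
      + h * \<zeta> * exp (L * (\<tau> (Suc k) - t0) / \<epsilon>)
      = (\<tau> (Suc k) - t0) / \<epsilon> * \<zeta> * exp (L * (\<tau> (Suc k) - t0) / \<epsilon>)"
    by (simp add: h_def diff_divide_distrib algebra_simps)
  finally show ?case by simp
qed

end

context sde_path
begin

lemma oscillation_on_dyadic_grid:
  assumes "t0 \<le> b" "b \<le> t1" "0 < \<zeta>"
  shows "\<forall>\<^sub>F m in sequentially. \<forall>k<2^m.
    \<forall>u\<in>{t0 + real k * ((b - t0) / 2^m)..t0 + real (Suc k) * ((b - t0) / 2^m)}.
      \<bar>drift a0 u (x u) - drift a0 (t0 + real k * ((b - t0) / 2^m)) (x (t0 + real k * ((b - t0) / 2^m)))\<bar> \<le> \<zeta>"
proof -
  have "uniformly_continuous_on {t0..t1} (\<lambda>t. drift a0 t (x t))"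
    using cont_drift by (rule compact_uniformly_continuous) simp
  then obtain d where d: "0 < d" and
    uc: "\<And>s t. s \<in> {t0..t1} \<Longrightarrow> t \<in> {t0..t1} \<Longrightarrow> dist t s < d \<Longrightarrow>
      dist (drift a0 t (x t)) (drift a0 s (x s)) < \<zeta>"
    using \<open>0 < \<zeta>\<close> unfolding uniformly_continuous_on_def by metis
  have "(\<lambda>m. (b - t0) / 2^m) \<longlonglongrightarrow> 0"
    by (rule LIMSEQ_divide_realpow_zero) simp
  then have "\<forall>\<^sub>F m in sequentially. (b - t0) / 2^m < d"
    using d by (rule order_tendstoD)
  then show ?thesis
  proof (eventually_elim, intro allI impI ballI)
    fix m k :: nat and u
    let ?h = "(b - t0) / 2^m"
    assume m: "?h < d" and k: "k < 2^m" and u: "u \<in> {t0 + real k * ?h..t0 + real (Suc k) * ?h}"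
    have h: "0 \<le> ?h" using assms by simp
    have "real (Suc k) \<le> real (2^m)" using k by (simp only: of_nat_le_iff)
    then have "real (Suc k) * ?h \<le> real (2^m) * ?h" by (rule mult_right_mono[OF _ h])
    then have "real (Suc k) * ?h \<le> b - t0" by simp
    moreover have "0 \<le> real k * ?h" by (rule mult_nonneg_nonneg[OF of_nat_0_le_iff h])
    moreover have "real (Suc k) * ?h = real k * ?h + ?h" unfolding of_nat_Suc distrib_right by simp
    moreover have "u \<in> {t0..t1} \<and> t0 + a \<in> {t0..t1} \<and> dist u (t0 + a) < d"
      if "0 \<le> a" "a + h \<le> b - t0" "u \<in> {t0 + a..t0 + (a + h)}" "0 \<le> h" "h < d" for a h
      using that assms by (auto simp: dist_real_def)
    ultimately have "u \<in> {t0..t1} \<and> t0 + real k * ?h \<in> {t0..t1} \<and> dist u (t0 + real k * ?h) < d"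
      using u m h by metis
    then have "dist (drift a0 u (x u)) (drift a0 (t0 + real k * ?h) (x (t0 + real k * ?h))) < \<zeta>"
      by (intro uc) (auto simp: dist_commute)
    then show "\<bar>drift a0 u (x u) - drift a0 (t0 + real k * ?h) (x (t0 + real k * ?h))\<bar> \<le> \<zeta>"
      by (simp add: dist_real_def)
  qed
qed

end

text \<open>The last step has length \<open>\<nu>\<close> for every \<open>m\<close>, so the
  Gaussian increment over it keeps its variance while the mesh is refined.\<close>

definition euler_grid :: "real \<Rightarrow> real \<Rightarrow> real \<Rightarrow> nat \<Rightarrow> nat \<Rightarrow> real" where
  "euler_grid t0 t1 \<nu> m k = (if k \<le> 2^m then t0 + real k * ((t1 - \<nu> - t0) / 2^m) else t1)"

definition euler_chain ::
  "real \<Rightarrow> real \<Rightarrow> real \<Rightarrow> real \<Rightarrow> real \<Rightarrow> real \<Rightarrow> real \<Rightarrow> real \<Rightarrow> nat \<Rightarrow> (real \<Rightarrow> real) \<Rightarrow> nat \<Rightarrow> real" where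
  "euler_chain \<epsilon> a0 \<sigma> t0 t1 x0 R \<nu> m w = chain (euler_step \<epsilon> a0 R (euler_grid t0 t1 \<nu> m)) x0
     (\<lambda>i. \<sigma> / sqrt \<epsilon> * (w (euler_grid t0 t1 \<nu> m (Suc i)) - w (euler_grid t0 t1 \<nu> m i)))"

lemma euler_grid_simps:
  "euler_grid t0 t1 \<nu> m 0 = t0" "euler_grid t0 t1 \<nu> m (2^m) = t1 - \<nu>"
  "euler_grid t0 t1 \<nu> m (Suc (2^m)) = t1"
  "k < 2^m \<Longrightarrow> euler_grid t0 t1 \<nu> m (Suc k) = euler_grid t0 t1 \<nu> m k + (t1 - \<nu> - t0) / 2^m"
  by (auto simp: euler_grid_def distrib_right add_divide_distrib)

lemma euler_grid_less_Suc:
  assumes "0 < \<nu>" "\<nu> < t1 - t0" "k < Suc (2^m)"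
  shows "euler_grid t0 t1 \<nu> m k < euler_grid t0 t1 \<nu> m (Suc k)"
proof (cases "k < 2^m")
  case False
  then have "k = 2^m" using assms by simp
  then show ?thesis using assms by (simp add: euler_grid_simps)
qed (use assms in \<open>simp add: euler_grid_simps\<close>)

context sde_path
begin

context
  fixes R \<nu> :: real
  assumes bd: "\<And>t. t \<in> {t0..t1} \<Longrightarrow> \<bar>x t\<bar> \<le> R" and \<nu>: "0 < \<nu>" "\<nu> < t1 - t0"
begin

abbreviation (input) Y where "Y m \<equiv> euler_chain \<epsilon> a0 \<sigma> t0 t1 x0 R \<nu> m w"
abbreviation (input) \<tau> where "\<tau> m \<equiv> euler_grid t0 t1 \<nu> m"

lemma R_nonneg: "0 \<le> R"
  using bd[of t0] \<nu> by force

lemma euler_chain_converges: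
  assumes "0 < \<rho>"
  shows "\<forall>\<^sub>F m in sequentially. \<forall>k\<le>2^m. \<bar>x (\<tau> m k) - Y m k\<bar> \<le> \<rho>"
proof -
  define L where "L = clip_rate a0 R"
  define E where "E = (t1 - t0) / \<epsilon> * exp (L * (t1 - t0) / \<epsilon>)"
  have L: "0 \<le> L" by (simp add: L_def clip_rate_def)
  have E: "0 < E" using \<nu> eps_pos by (simp add: E_def)
  define \<zeta> where "\<zeta> = \<rho> / E"
  have \<zeta>: "0 < \<zeta>" using assms E by (simp add: \<zeta>_def)
  have b: "t0 \<le> t1 - \<nu>" "t1 - \<nu> \<le> t1" using \<nu> by auto
  from oscillation_on_dyadic_grid[OF b \<zeta>] show ?thesis
  proof (eventually_elim, intro allI impI)
    fix m k :: nat
    assume osc: "\<forall>k<2^m. \<forall>u\<in>{t0 + real k * ((t1 - \<nu> - t0) / 2^m)..t0 + real (Suc k) * ((t1 - \<nu> - t0) / 2^m)}.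
      \<bar>drift a0 u (x u) - drift a0 (t0 + real k * ((t1 - \<nu> - t0) / 2^m)) (x (t0 + real k * ((t1 - \<nu> - t0) / 2^m)))\<bar> \<le> \<zeta>"
      and k: "k \<le> 2^m"
    have grid: "\<tau> m i = t0 + real i * ((t1 - \<nu> - t0) / 2^m)" if "i \<le> 2^m" for i
      using that by (simp add: euler_grid_def)
    have range: "t0 \<le> \<tau> m k" "\<tau> m k \<le> t1"
    proof -
      have "0 \<le> real k * ((t1 - \<nu> - t0) / 2^m)" using \<nu> by simp
      moreover have "real k * ((t1 - \<nu> - t0) / 2^m) \<le> real (2^m) * ((t1 - \<nu> - t0) / 2^m)"
        using k \<nu> by (intro mult_right_mono) (simp_all only: of_nat_le_iff, simp)
      ultimately show "t0 \<le> \<tau> m k" "\<tau> m k \<le> t1" using grid[OF k] \<nu> by auto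
    qed
    have "\<bar>x (\<tau> m k) - Y m k\<bar> \<le> (\<tau> m k - t0) / \<epsilon> * \<zeta> * exp (L * (\<tau> m k - t0) / \<epsilon>)"
      unfolding euler_chain_def L_def
    proof (rule euler_error[OF _ _ _ bd R_nonneg _ _ _ k])
      show "\<tau> m i \<le> \<tau> m (Suc i)" if "i < 2^m" for i
        using euler_grid_less_Suc[OF \<nu>, of i m] that by simp
      show "\<bar>drift a0 u (x u) - drift a0 (\<tau> m i) (x (\<tau> m i))\<bar> \<le> \<zeta>"
        if "i < 2^m" "u \<in> {\<tau> m i..\<tau> m (Suc i)}" for i u
      proof -
        have i: "Suc i \<le> 2^m" "i \<le> 2^m" using that by auto
        show ?thesis
          using osc[rule_format, OF that(1), of u] that(2)
          unfolding grid[OF i(1), symmetric] grid[OF i(2), symmetric] by blast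
      qed
    qed (use \<nu> \<zeta> in \<open>auto simp: euler_grid_simps\<close>)
    also have "\<dots> \<le> (t1 - t0) / \<epsilon> * \<zeta> * exp (L * (t1 - t0) / \<epsilon>)"
      using range \<nu> \<zeta> L eps_pos by (intro mult_mono divide_right_mono iffD2[OF exp_le_cancel_iff]) auto
    also have "\<dots> = E * \<zeta>" by (simp add: E_def)
    also have "\<dots> = \<rho>" using E by (simp add: \<zeta>_def)
    finally show "\<bar>x (\<tau> m k) - Y m k\<bar> \<le> \<rho>" .
  qed
qed

text \<open>Path and chain share the noise increment of the last step, and the drift contributes at
  most \<open>\<nu> / \<epsilon> * (clip_rate a0 R * R)\<close> to each. This error does not vanish
  with the mesh.\<close>

lemma euler_chain_last_step:
  "\<bar>x t1 - Y m (Suc (2^m))\<bar> \<le> \<bar>x (t1 - \<nu>) - Y m (2^m)\<bar> + 2 * (\<nu> / \<epsilon> * (clip_rate a0 R * R))"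
proof -
  let ?D = "clip_rate a0 R * R" and ?n = "\<sigma> / sqrt \<epsilon> * (w t1 - w (t1 - \<nu>))"
  have "\<bar>x t1 - (x (t1 - \<nu>) + (t1 - (t1 - \<nu>)) / \<epsilon> * 0 + ?n)\<bar> \<le> (t1 - (t1 - \<nu>)) / \<epsilon> * ?D"
  proof (rule x_step)
    fix u assume "u \<in> {t1 - \<nu>..t1}"
    then have "clip R (x u) = x u" using bd[of u] \<nu> by (intro clip_id) auto
    then show "\<bar>drift a0 u (x u) - 0\<bar> \<le> ?D"
      using abs_drift_clip_le[OF R_nonneg, of a0 u "x u"] by simp
  qed (use \<nu> in auto)
  then have 1: "\<bar>x t1 - (x (t1 - \<nu>) + ?n)\<bar> \<le> \<nu> / \<epsilon> * ?D" by simp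
  let ?d = "\<nu> / \<epsilon> * drift a0 (t1 - \<nu>) (clip R (Y m (2^m)))"
  have Y: "Y m (Suc (2^m)) = Y m (2^m) + ?d + ?n"
    by (simp add: euler_chain_def euler_step_def euler_grid_simps)
  have "\<bar>?d\<bar> \<le> \<nu> / \<epsilon> * ?D"
    unfolding abs_mult using \<nu> eps_pos abs_drift_clip_le[OF R_nonneg] by (intro mult_mono) auto
  with 1 show ?thesis unfolding Y by linarith
qed

lemma euler_chain_end_negative:
  assumes "2 * (\<nu> / \<epsilon> * (clip_rate a0 R * R)) < \<eta>"
  shows "\<forall>\<^sub>F m in sequentially. Y m (Suc (2^m)) < - \<eta> \<longrightarrow> x t1 < 0"
proof -
  let ?\<rho> = "\<eta> - 2 * (\<nu> / \<epsilon> * (clip_rate a0 R * R))"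
  from assms have "0 < ?\<rho>" by simp
  from euler_chain_converges[OF this] show ?thesis
  proof eventually_elim
    case (elim m)
    then have "\<bar>x (\<tau> m (2^m)) - Y m (2^m)\<bar> \<le> ?\<rho>" by simp
    then show ?case using euler_chain_last_step[of m] unfolding euler_grid_simps by linarith
  qed
qed

lemma euler_chain_hits:
  assumes q: "t0 \<le> q" "q \<le> t1 - \<nu>" "x q < 0"
  shows "\<forall>\<^sub>F m in sequentially. \<exists>k\<le>2^m. Y m k \<le> 0"
proof -
  \<comment> \<open>Constant extension beyond \<open>{t0..t1}\<close> gives a function continuous on
    the whole line. Half of the depth \<open>- x q\<close> locates a grid point, the other half
    absorbs the Euler error.\<close>
  let ?f = "\<lambda>t. - x (max t0 (min t1 t))" and ?\<rho> = "- x q / 2"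
  have "continuous_on UNIV ?f"
    using \<nu> by (intro continuous_intros continuous_on_compose2[OF cont_x]) auto
  moreover have "?\<rho> < ?f q" using q \<nu> by (simp add: max_def min_def)
  moreover have "q \<le> t0 + (t1 - \<nu> - t0)" "0 < t1 - \<nu> - t0" using q \<nu> by auto
  ultimately have "\<forall>\<^sub>F m in sequentially. \<exists>k\<le>2^m. ?\<rho> < ?f (t0 + real k * ((t1 - \<nu> - t0) / 2^m))"
    using q(1) by (intro continuous_gt_on_dyadic_grid) auto
  moreover have "\<forall>\<^sub>F m in sequentially. \<forall>k\<le>2^m. \<bar>x (\<tau> m k) - Y m k\<bar> \<le> ?\<rho>"
    using q by (intro euler_chain_converges) simp
  ultimately show ?thesis
  proof eventually_elim
    case (elim m)
    then obtain k where k: "k \<le> 2^m" "?\<rho> < ?f (t0 + real k * ((t1 - \<nu> - t0) / 2^m))" by blast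
    have "0 \<le> real k * ((t1 - \<nu> - t0) / 2^m)" using \<nu> by simp
    moreover have "real k * ((t1 - \<nu> - t0) / 2^m) \<le> real (2^m) * ((t1 - \<nu> - t0) / 2^m)"
      using k \<nu> by (intro mult_right_mono) (simp_all only: of_nat_le_iff, simp)
    ultimately have g: "t0 \<le> \<tau> m k" "\<tau> m k \<le> t1" "\<tau> m k = t0 + real k * ((t1 - \<nu> - t0) / 2^m)"
      using k \<nu> by (auto simp: euler_grid_def)
    have "max t0 (min t1 (\<tau> m k)) = \<tau> m k" using g(1,2) by simp
    then have "?\<rho> < - x (\<tau> m k)" using k(2) unfolding g(3)[symmetric] by simp
    moreover have "\<bar>x (\<tau> m k) - Y m k\<bar> \<le> ?\<rho>" using elim k(1) by blast
    ultimately have "Y m k \<le> 0" by linarith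
    with k(1) show ?case by blast
  qed
qed

end

end

section \<open>Reflection inequality for the solution\<close>

locale sde = brownian M W for M :: "'a measure" and W +
  fixes X :: "real \<Rightarrow> 'a \<Rightarrow> real" and \<epsilon> a0 \<sigma> t0 t1 x0 :: real
  assumes solution: "sde_solution M W \<epsilon> a0 \<sigma> t0 t1 x0 X"
    and \<epsilon>_pos: "0 < \<epsilon>" and \<sigma>_pos: "0 < \<sigma>" and t0_less_t1: "t0 < t1"
begin

lemma X_measurable: "t \<in> {t0..t1} \<Longrightarrow> X t \<in> borel_measurable M"
  using solution by (simp add: sde_solution_def)

lemma AE_path: "AE \<omega> in M. sde_path \<epsilon> a0 \<sigma> t0 t1 x0 (\<lambda>t. X t \<omega>) (\<lambda>t. W t \<omega>)"
proof -
  have "AE \<omega> in M. continuous_on {t0..t1} (\<lambda>t. X t \<omega>) \<and>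
        (\<forall>t\<in>{t0..t1}. X t \<omega> = x0 + integral {t0..t} (\<lambda>s. drift a0 s (X s \<omega>) / \<epsilon>)
                             + \<sigma> / sqrt \<epsilon> * (W t \<omega> - W t0 \<omega>))"
    using solution by (simp add: sde_solution_def)
  then show ?thesis
    by eventually_elim (use \<epsilon>_pos in \<open>auto simp: sde_path_def\<close>)
qed

lemma measurable_X_neg [measurable]: "{\<omega>\<in>space M. X t1 \<omega> < 0} \<in> events"
proof -
  have [measurable]: "X t1 \<in> borel_measurable M" using t0_less_t1 by (intro X_measurable) simp
  show ?thesis by measurable
qed

text \<open>Rational times make this a countable union of measurable sets. Strict negativity
  survives small errors, and times strictly before \<open>t1\<close> leave room for the last Euler
  step.\<close>

definition crossed :: "'a set" where
  "crossed = {\<omega>\<in>space M. \<exists>q\<in>\<rat> \<inter> {t0..<t1}. X q \<omega> < 0}"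

lemma measurable_crossed [measurable]: "crossed \<in> events"
proof -
  have "crossed = (\<Union>q\<in>\<rat> \<inter> {t0..<t1}. {\<omega>\<in>space M. X q \<omega> < 0})"
    unfolding crossed_def by auto
  also have "\<dots> \<in> events"
  proof (rule sets.countable_UN')
    show "countable (\<rat> \<inter> {t0..<t1})" using countable_rat by blast
    show "(\<lambda>q. {\<omega>\<in>space M. X q \<omega> < 0}) ` (\<rat> \<inter> {t0..<t1}) \<subseteq> events"
      using X_measurable by (auto intro!: borel_measurable_less)
  qed
  finally show ?thesis .
qed

text \<open>The two ways in which the chain can misreport the solution: it misses a crossing, or it
  ends clearly negative although the solution does not.\<close>

definition mismatch :: "real \<Rightarrow> real \<Rightarrow> real \<Rightarrow> nat \<Rightarrow> 'a set" where
  "mismatch R \<nu> \<eta> m = {\<omega>\<in>space M. let Y = euler_chain \<epsilon> a0 \<sigma> t0 t1 x0 R \<nu> m (\<lambda>t. W t \<omega>) in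
     \<omega> \<in> crossed \<and> \<not> (\<exists>k\<le>Suc (2^m). Y k \<le> 0) \<or> Y (Suc (2^m)) < - \<eta> \<and> \<not> X t1 \<omega> < 0}"

context
  fixes R \<nu> :: real
  assumes R: "0 < R" and \<nu>: "0 < \<nu>" "\<nu> < t1 - t0" and small: "\<nu> * clip_rate a0 R \<le> \<epsilon>"
begin

definition noise :: "nat \<Rightarrow> nat \<Rightarrow> 'a \<Rightarrow> real" where
  "noise m i \<omega> = \<sigma> / sqrt \<epsilon> * (W (euler_grid t0 t1 \<nu> m (Suc i)) \<omega> - W (euler_grid t0 t1 \<nu> m i) \<omega>)"

lemma noise_measurable [measurable]: "noise m i \<in> borel_measurable M"
  unfolding noise_def by measurable

lemma indep_noise: "indep_vars (\<lambda>_. borel) (noise m) {..<Suc (2^m)}"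
  unfolding noise_def[abs_def]
  by (rule indep_vars_compose2[OF W_indep_increments[of _ "euler_grid t0 t1 \<nu> m"]])
    (use euler_grid_less_Suc[OF \<nu>] in auto)

lemma noise_normal:
  assumes "i < Suc (2^m)"
  shows "distributed M lborel (noise m i) (\<lambda>x. ennreal (normal_density 0
    (\<sigma> / sqrt \<epsilon> * sqrt (euler_grid t0 t1 \<nu> m (Suc i) - euler_grid t0 t1 \<nu> m i)) x))"
  using distributed_normal_scale[OF W_increment[OF euler_grid_less_Suc[OF \<nu> assms]], where c="\<sigma> / sqrt \<epsilon>"]
    euler_grid_less_Suc[OF \<nu> assms] \<sigma>_pos \<epsilon>_pos by (simp add: noise_def[abs_def])

text \<open>Reflection applies to the chain. Replacing \<open>crossed\<close> by a visit of the
  chain costs one \<open>mismatch\<close>; replacing the final value of the chain costs two more,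
  because it enters with factor two. The quotient is the small-ball bound for the last step.\<close>

lemma crossed_le_Euler:
  assumes mesh: "(t1 - \<nu> - t0) / 2^m * clip_rate a0 R \<le> \<epsilon>" and "0 \<le> \<eta>"
  shows "prob crossed \<le> 2 * prob {\<omega>\<in>space M. X t1 \<omega> < 0} + \<eta> / (\<sigma> / sqrt \<epsilon> * sqrt \<nu>)
    + 3 * prob (mismatch R \<nu> \<eta> m)"
    and "mismatch R \<nu> \<eta> m \<in> events"
proof -
  let ?N = "Suc (2^m)" and ?\<tau> = "euler_grid t0 t1 \<nu> m"
  let ?F = "euler_step \<epsilon> a0 R ?\<tau>"
  let ?Y = "\<lambda>\<omega>. chain ?F x0 (\<lambda>i. noise m i \<omega>)"
  have Y: "euler_chain \<epsilon> a0 \<sigma> t0 t1 x0 R \<nu> m (\<lambda>t. W t \<omega>) = ?Y \<omega>" for \<omega>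
    by (simp add: euler_chain_def noise_def)
  have mono: "mono (?F i)" if "i < ?N" for i
  proof (rule mono_euler_step)
    show "?\<tau> i \<le> ?\<tau> (Suc i)" using euler_grid_less_Suc[OF \<nu> that] by simp
    show "(?\<tau> (Suc i) - ?\<tau> i) * clip_rate a0 R \<le> \<epsilon>"
    proof (cases "i < 2^m")
      case False
      then have "i = 2^m" using that by simp
      then show ?thesis using small by (simp add: euler_grid_simps)
    qed (use mesh in \<open>simp add: euler_grid_simps\<close>)
  qed (use R \<epsilon>_pos in auto)
  have mY [measurable]: "(\<lambda>\<omega>. ?Y \<omega> k) \<in> borel_measurable M" if "k \<le> ?N" for k
    using that by (intro measurable_chain[of ?N] mono) auto
  have [measurable]: "(\<lambda>\<omega>. ?Y \<omega> ?N) \<in> borel_measurable M" by (rule mY) simp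
  have [measurable]: "X t1 \<in> borel_measurable M" using t0_less_t1 by (intro X_measurable) simp
  let ?H = "{\<omega>\<in>space M. \<exists>k\<le>?N. ?Y \<omega> k \<le> 0}"
  have "?H = (\<Union>k\<le>?N. {\<omega>\<in>space M. ?Y \<omega> k \<le> 0})" by auto
  also have "\<dots> \<in> events"
    using mY by (intro sets.finite_UN) (auto intro!: borel_measurable_le)
  finally have H [measurable]: "?H \<in> events" .
  have mm: "mismatch R \<nu> \<eta> m = (crossed - ?H) \<union> {\<omega>\<in>space M. ?Y \<omega> ?N < - \<eta> \<and> \<not> X t1 \<omega> < 0}"
    unfolding mismatch_def Y Let_def using sets.sets_into_space[OF measurable_crossed] by blast
  show [measurable]: "mismatch R \<nu> \<eta> m \<in> events" unfolding mm by measurable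
  have "prob crossed \<le> prob (?H \<union> mismatch R \<nu> \<eta> m)"
    by (intro finite_measure_mono) (unfold mm, blast, measurable)
  also have "\<dots> \<le> prob ?H + prob (mismatch R \<nu> \<eta> m)"
    by (intro measure_Un_le) auto
  also have "prob ?H \<le> prob {\<omega>\<in>space M. \<bar>?Y \<omega> ?N\<bar> \<le> \<eta>} + 2 * prob {\<omega>\<in>space M. ?Y \<omega> ?N < - \<eta>}"
  proof (rule reflection_chain[OF indep_noise _ _ mono])
    show "distr M borel (\<lambda>\<omega>. - noise m i \<omega>) = distr M borel (noise m i)" if "i < ?N" for i
      using \<sigma>_pos \<epsilon>_pos euler_grid_less_Suc[OF \<nu> that]
      by (intro distr_uminus_normal[OF noise_normal[OF that]]) auto
  qed (use R in \<open>auto simp: euler_step_uminus\<close>)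
  also have "prob {\<omega>\<in>space M. ?Y \<omega> ?N < - \<eta>}
      \<le> prob ({\<omega>\<in>space M. X t1 \<omega> < 0} \<union> mismatch R \<nu> \<eta> m)"
    by (intro finite_measure_mono) (unfold mm, blast, measurable)
  also have "\<dots> \<le> prob {\<omega>\<in>space M. X t1 \<omega> < 0} + prob (mismatch R \<nu> \<eta> m)"
    by (intro measure_Un_le) auto
  also have "prob {\<omega>\<in>space M. \<bar>?Y \<omega> ?N\<bar> \<le> \<eta>} \<le> \<eta> / (\<sigma> / sqrt \<epsilon> * sqrt \<nu>)"
  proof -
    have "prob {\<omega>\<in>space M. \<bar>?F (2^m) (?Y \<omega> (2^m)) + noise m (2^m) \<omega>\<bar> \<le> \<eta>} \<le> \<eta> / (\<sigma> / sqrt \<epsilon> * sqrt \<nu>)"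
      using indep_var_chain_step[OF indep_noise mono] noise_normal[of "2^m" m] \<sigma>_pos \<epsilon>_pos \<nu> assms
      by (intro small_ball_add_normal) (auto simp: euler_grid_simps)
    then show ?thesis by simp
  qed
  finally show "prob crossed \<le> 2 * prob {\<omega>\<in>space M. X t1 \<omega> < 0} + \<eta> / (\<sigma> / sqrt \<epsilon> * sqrt \<nu>)
    + 3 * prob (mismatch R \<nu> \<eta> m)" by simp
qed

end

lemma eventually_not_mismatch:
  assumes path: "sde_path \<epsilon> a0 \<sigma> t0 t1 x0 (\<lambda>t. X t \<omega>) (\<lambda>t. W t \<omega>)"
    and bd: "\<And>t. t \<in> {t0..t1} \<Longrightarrow> \<bar>X t \<omega>\<bar> \<le> R" and \<nu>: "0 < \<nu>" "\<nu> < t1 - t0"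
    and q: "\<omega> \<in> crossed \<Longrightarrow> \<exists>q\<in>{t0..t1 - \<nu>}. X q \<omega> < 0"
    and \<eta>: "2 * (\<nu> / \<epsilon> * (clip_rate a0 R * R)) < \<eta>"
  shows "\<forall>\<^sub>F m in sequentially. \<omega> \<notin> mismatch R \<nu> \<eta> m"
proof -
  interpret p: sde_path \<epsilon> a0 \<sigma> t0 t1 x0 "\<lambda>t. X t \<omega>" "\<lambda>t. W t \<omega>" by (rule path)
  let ?Y = "\<lambda>m. euler_chain \<epsilon> a0 \<sigma> t0 t1 x0 R \<nu> m (\<lambda>t. W t \<omega>)"
  have 1: "\<forall>\<^sub>F m in sequentially. \<omega> \<in> crossed \<longrightarrow> (\<exists>k\<le>2^m. ?Y m k \<le> 0)"
  proof (cases "\<omega> \<in> crossed")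
    case True
    with q obtain q where "t0 \<le> q" "q \<le> t1 - \<nu>" "X q \<omega> < 0" by auto
    then have "\<forall>\<^sub>F m in sequentially. \<exists>k\<le>2^m. ?Y m k \<le> 0"
      by (intro p.euler_chain_hits bd \<nu>) auto
    then show ?thesis by eventually_elim auto
  qed simp
  have "\<forall>\<^sub>F m in sequentially. ?Y m (Suc (2^m)) < - \<eta> \<longrightarrow> X t1 \<omega> < 0"
    by (intro p.euler_chain_end_negative bd \<nu> \<eta>)
  with 1 show ?thesis
  proof eventually_elim
    case (elim m)
    have "\<exists>k\<le>Suc (2^m). ?Y m k \<le> 0" if "\<omega> \<in> crossed"
      using elim(1) that le_SucI by blast
    with elim(2) show ?case unfolding mismatch_def Let_def by blast
  qed
qed

theorem crossed_le: "prob crossed \<le> 2 * prob {\<omega>\<in>space M. X t1 \<omega> < 0}"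
proof -
  define R where "R j = real (Suc j)" for j
  define L where "L j = clip_rate a0 (R j)" for j
  define K where "K j = L j * R j" for j
  \<comment> \<open>The three bounds keep the last step inside the time interval, keep it monotone,
    and force \<open>K j * sqrt (\<nu> j) \<le> 1 / R j\<close>, which sends the small-ball term to
    zero.\<close>
  define \<nu> where "\<nu> j = min ((t1 - t0) / 2) (min (\<epsilon> / L j) ((1 / (K j * R j))\<^sup>2))" for j
  \<comment> \<open>The factor \<open>3\<close> lets \<open>\<eta> j\<close> exceed the last-step
    error, which carries the factor \<open>2\<close>.\<close>
  define \<eta> where "\<eta> j = 3 * (\<nu> j / \<epsilon> * K j)" for j
  have R: "1 \<le> R j" for j by (simp add: R_def)
  have L: "2 \<le> L j" for j by (simp add: L_def clip_rate_def)
  have K: "1 \<le> K j" for j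
    using mult_mono[of 1 "L j" 1 "R j"] L[of j] R[of j] by (simp add: K_def)
  have pos: "0 < L j" "0 < K j" "0 < R j" for j using L[of j] K[of j] R[of j] by linarith+
  have \<nu>: "0 < \<nu> j" "\<nu> j < t1 - t0" "\<nu> j * L j \<le> \<epsilon>" "sqrt (\<nu> j) \<le> 1 / (K j * R j)" for j
  proof -
    show "0 < \<nu> j" using t0_less_t1 \<epsilon>_pos pos[of j] by (auto simp: \<nu>_def)
    have "\<nu> j \<le> (t1 - t0) / 2" unfolding \<nu>_def by (rule min.cobounded1)
    then show "\<nu> j < t1 - t0" using t0_less_t1 by simp
    have "\<nu> j \<le> \<epsilon> / L j" by (simp add: \<nu>_def)
    then show "\<nu> j * L j \<le> \<epsilon>" using pos[of j] by (simp add: pos_le_divide_eq)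
    have "\<nu> j \<le> (1 / (K j * R j))\<^sup>2" by (simp add: \<nu>_def)
    then show "sqrt (\<nu> j) \<le> 1 / (K j * R j)" using pos[of j] by (intro real_le_lsqrt) auto
  qed
  have \<eta>: "2 * (\<nu> j / \<epsilon> * (L j * R j)) < \<eta> j" "0 \<le> \<eta> j" for j
  proof -
    have "0 < \<nu> j / \<epsilon> * K j" using \<nu>(1)[of j] \<epsilon>_pos pos[of j] by simp
    then show "2 * (\<nu> j / \<epsilon> * (L j * R j)) < \<eta> j" "0 \<le> \<eta> j"
      unfolding \<eta>_def K_def[symmetric] by linarith+
  qed
  have sb: "\<eta> j / (\<sigma> / sqrt \<epsilon> * sqrt (\<nu> j)) \<le> 3 / (\<sigma> * sqrt \<epsilon>) / R j" for j
  proof -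
    have "\<eta> j / (\<sigma> / sqrt \<epsilon> * sqrt (\<nu> j)) = 3 / (\<sigma> * sqrt \<epsilon>) * (K j * sqrt (\<nu> j))"
      using \<nu>(1)[of j] \<epsilon>_pos \<sigma>_pos real_sqrt_pow2[of \<epsilon>] real_sqrt_pow2[of "\<nu> j"]
      by (simp add: \<eta>_def field_simps power2_eq_square)
    also have "\<dots> \<le> 3 / (\<sigma> * sqrt \<epsilon>) * (K j * (1 / (K j * R j)))"
      using pos[of j] \<nu>(4)[of j] \<epsilon>_pos \<sigma>_pos by (intro mult_left_mono) auto
    also have "K j * (1 / (K j * R j)) = 1 / R j" using pos[of j] by simp
    finally show ?thesis by simp
  qed
  define mesh where "mesh j m \<longleftrightarrow> (t1 - \<nu> j - t0) / 2^m * L j \<le> \<epsilon>" for j m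
  \<comment> \<open>On coarse meshes the Euler steps need not be monotone, and the measurability and
    reflection arguments rest on that. The empty set stands in there; \<open>mesh j m\<close> holds
    for all large \<open>m\<close>.\<close>
  define B where "B j m = (if mesh j m then mismatch (R j) (\<nu> j) (\<eta> j) m else {})" for j m
  note step = crossed_le_Euler[OF pos(3) \<nu>(1,2) \<nu>(3)[unfolded L_def] _ \<eta>(2)]
  have B: "B j m \<in> events" for j m
    unfolding B_def mesh_def L_def using step(2) by auto
  have ev: "AE \<omega> in M. \<forall>\<^sub>F j in sequentially. \<forall>\<^sub>F m in sequentially. \<omega> \<notin> B j m"
    using AE_path
  proof eventually_elim
    case (elim \<omega>)
    interpret p: sde_path \<epsilon> a0 \<sigma> t0 t1 x0 "\<lambda>t. X t \<omega>" "\<lambda>t. W t \<omega>" by fact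
    have "bounded ((\<lambda>t. X t \<omega>) ` {t0..t1})"
      by (intro compact_imp_bounded compact_continuous_image p.cont_x) simp
    then obtain b where "\<forall>y\<in>(\<lambda>t. X t \<omega>) ` {t0..t1}. norm y \<le> b"
      unfolding bounded_iff by blast
    then have b: "\<bar>X t \<omega>\<bar> \<le> b" if "t \<in> {t0..t1}" for t using that by simp
    \<comment> \<open>One \<open>q < t1\<close> for both cases, so that
      \<open>\<nu> j \<le> t1 - q\<close> can be demanded for large \<open>j\<close> without a case
      split.\<close>
    have "\<exists>q<t1. \<omega> \<in> crossed \<longrightarrow> t0 \<le> q \<and> X q \<omega> < 0"
      using t0_less_t1 unfolding crossed_def by (cases "\<omega> \<in> crossed") (auto simp: crossed_def)
    then obtain q where q: "q < t1" "\<omega> \<in> crossed \<Longrightarrow> t0 \<le> q \<and> X q \<omega> < 0" by blast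
    have lim: "(\<lambda>j. 1 / R j) \<longlonglongrightarrow> 0"
      unfolding R_def using LIMSEQ_inverse_real_of_nat by (simp add: inverse_eq_divide)
    have "(\<lambda>j. (1 / R j)\<^sup>2) \<longlonglongrightarrow> 0" using tendsto_power[OF lim, of 2] by simp
    then have "\<forall>\<^sub>F j in sequentially. (1 / R j)\<^sup>2 < t1 - q"
      by (rule order_tendstoD(2)) (use q(1) in simp)
    moreover have "\<forall>\<^sub>F j in sequentially. b \<le> R j"
    proof -
      obtain n :: nat where "b \<le> real n" using real_arch_simple by blast
      then show ?thesis unfolding R_def eventually_sequentially
        by (intro exI[of _ n] allI impI) (metis le_SucI of_nat_le_iff order_trans)
    qed
    ultimately show ?case
    proof eventually_elim
      case inner: (elim j)
      have "(1 / (K j * R j))\<^sup>2 \<le> (1 / R j)\<^sup>2"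
        using pos[of j] K[of j] by (intro power_mono divide_left_mono) auto
      then have "\<nu> j \<le> (1 / R j)\<^sup>2" unfolding \<nu>_def by linarith
      then have "q \<le> t1 - \<nu> j" using inner by linarith
      then have q': "\<omega> \<in> crossed \<Longrightarrow> \<exists>q\<in>{t0..t1 - \<nu> j}. X q \<omega> < 0"
        using q by auto
      have "\<forall>\<^sub>F m in sequentially. \<omega> \<notin> mismatch (R j) (\<nu> j) (\<eta> j) m"
      proof (rule eventually_not_mismatch[OF elim])
        show "\<bar>X t \<omega>\<bar> \<le> R j" if "t \<in> {t0..t1}" for t using b[OF that] inner(2) by linarith
        show "2 * (\<nu> j / \<epsilon> * (clip_rate a0 (R j) * R j)) < \<eta> j" using \<eta>(1)[of j] unfolding L_def .
      qed (use \<nu> q' in auto)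
      then show ?case by eventually_elim (simp add: B_def)
    qed
  qed
  have est: "prob crossed \<le> 2 * prob {\<omega>\<in>space M. X t1 \<omega> < 0} + \<zeta>" if "0 < \<zeta>" for \<zeta>
  proof -
    have "0 < \<zeta> / 6" using that by simp
    from prob_iterated_eventually_notin[OF B ev this]
    have 1: "\<forall>\<^sub>F j in sequentially. \<forall>\<^sub>F m in sequentially. prob (B j m) < \<zeta> / 6" .
    have "(\<lambda>j. 3 / (\<sigma> * sqrt \<epsilon>) * (1 / R j)) \<longlonglongrightarrow> 3 / (\<sigma> * sqrt \<epsilon>) * 0"
      unfolding R_def using LIMSEQ_inverse_real_of_nat
      by (intro tendsto_mult tendsto_const) (simp add: inverse_eq_divide)
    then have "\<forall>\<^sub>F j in sequentially. 3 / (\<sigma> * sqrt \<epsilon>) * (1 / R j) < \<zeta> / 2"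
      by (rule order_tendstoD(2)) (use that in simp)
    with 1 have "\<forall>\<^sub>F j in sequentially. (\<forall>\<^sub>F m in sequentially. prob (B j m) < \<zeta> / 6)
      \<and> 3 / (\<sigma> * sqrt \<epsilon>) * (1 / R j) < \<zeta> / 2" by (rule eventually_conj)
    then obtain j where j: "\<forall>\<^sub>F m in sequentially. prob (B j m) < \<zeta> / 6"
      "3 / (\<sigma> * sqrt \<epsilon>) * (1 / R j) < \<zeta> / 2"
      using eventually_happens'[OF sequentially_bot] by blast
    have "(\<lambda>m. (t1 - \<nu> j - t0) / 2^m * L j) \<longlonglongrightarrow> 0 * L j"
      by (intro tendsto_mult tendsto_const LIMSEQ_divide_realpow_zero) simp
    then have "\<forall>\<^sub>F m in sequentially. (t1 - \<nu> j - t0) / 2^m * L j < \<epsilon>"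
      by (rule order_tendstoD(2)) (use \<epsilon>_pos in simp)
    with j(1) have "\<forall>\<^sub>F m in sequentially. prob (B j m) < \<zeta> / 6
      \<and> (t1 - \<nu> j - t0) / 2^m * L j < \<epsilon>" by (rule eventually_conj)
    then obtain m where m: "prob (B j m) < \<zeta> / 6" "(t1 - \<nu> j - t0) / 2^m * L j < \<epsilon>"
      using eventually_happens'[OF sequentially_bot] by blast
    then have "mesh j m" by (simp add: mesh_def)
    then have "prob crossed \<le> 2 * prob {\<omega>\<in>space M. X t1 \<omega> < 0}
      + \<eta> j / (\<sigma> / sqrt \<epsilon> * sqrt (\<nu> j)) + 3 * prob (B j m)"
      using step(1)[of j m] by (simp add: B_def mesh_def L_def)
    then show ?thesis using sb[of j] j(2) m(1) by simp
  qed
  show ?thesis by (rule field_le_epsilon) (rule est)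
qed

end

section \<open>Crossing the saddle\<close>

text \<open>\<open>mu a0 t = a0 + 2 * (sin (pi * t))\<^sup>2\<close>, and \<open>pi < 4\<close>
  gives \<open>2 * 4\<^sup>2 = 32\<close>.\<close>

lemma mu_upper: "mu a0 t \<le> a0 + 32 * t\<^sup>2"
proof -
  have "(sin (pi * t))\<^sup>2 \<le> (pi * t)\<^sup>2"
    using abs_sin_x_le_abs_x[of "pi * t"] by (simp add: abs_le_square_iff)
  also have "\<dots> \<le> 4\<^sup>2 * t\<^sup>2"
    unfolding power_mult_distrib using pi_less_4 pi_ge_zero by (intro mult_right_mono power_mono) auto
  finally show ?thesis
    using cos_double_sin[of "pi * t"] by (simp add: mu_def mult.assoc)
qed

context sde_path
begin

lemma x_increment_le:
  assumes "t0 \<le> s" "s \<le> t" "t \<le> t1" "\<And>u. u \<in> {s..t} \<Longrightarrow> drift a0 u (x u) \<le> c"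
  shows "x t - x s \<le> (t - s) / \<epsilon> * c + \<sigma> / sqrt \<epsilon> * (w t - w s)"
proof -
  have c: "continuous_on {s..t} (\<lambda>u. drift a0 u (x u) / \<epsilon>)"
    using eps_pos assms by (intro continuous_intros continuous_on_subset[OF cont_drift]) auto
  have "integral {s..t} (\<lambda>u. drift a0 u (x u) / \<epsilon>) \<le> integral {s..t} (\<lambda>u. c / \<epsilon>)"
    using assms eps_pos by (intro integral_le integrable_continuous_real c continuous_intros divide_right_mono) auto
  then show ?thesis using x_increment[OF assms(1-3)] assms by simp
qed

lemma x_increment_ge:
  assumes "t0 \<le> s" "s \<le> t" "t \<le> t1" "\<And>u. u \<in> {s..t} \<Longrightarrow> c \<le> drift a0 u (x u)"
  shows "(t - s) / \<epsilon> * c + \<sigma> / sqrt \<epsilon> * (w t - w s) \<le> x t - x s"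
proof -
  have c: "continuous_on {s..t} (\<lambda>u. drift a0 u (x u) / \<epsilon>)"
    using eps_pos assms by (intro continuous_intros continuous_on_subset[OF cont_drift]) auto
  have "integral {s..t} (\<lambda>u. c / \<epsilon>) \<le> integral {s..t} (\<lambda>u. drift a0 u (x u) / \<epsilon>)"
    using assms eps_pos by (intro integral_le integrable_continuous_real c continuous_intros divide_right_mono) auto
  then show ?thesis using x_increment[OF assms(1-3)] assms by simp
qed

text \<open>The cubic drift brings any positive initial value down to order \<open>\<surd>\<sigma>\<close> within time
  \<open>\<epsilon> / \<sigma>\<close>, because \<open>1 / x\<^sup>2\<close> grows at rate at least \<open>1 / (8 \<epsilon>)\<close>.\<close>
lemma comes_down:
  assumes Q: "0 < Q" and \<theta>: "\<theta> = \<epsilon> / Q\<^sup>2" and s: "t0 \<le> s" "s + \<theta> \<le> t1"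
    and mu: "\<And>u. u \<in> {s..s + \<theta>} \<Longrightarrow> mu a0 u \<le> 48 * Q\<^sup>2"
    and noise: "\<And>u. u \<in> {s..s + \<theta>} \<Longrightarrow> \<bar>\<sigma> / sqrt \<epsilon> * (w u - w s)\<bar> \<le> 3 * Q"
  shows "\<exists>u\<in>{s..s + \<theta>}. x u \<le> 16 * Q"
proof (rule ccontr)
  assume "\<not> ?thesis"
  then have big: "16 * Q < x u" if "u \<in> {s..s + \<theta>}" for u using that by force
  have th: "0 < \<theta>" using Q eps_pos by (simp add: \<theta>)
  let ?f = "\<lambda>u. drift a0 u (x u) / \<epsilon>"
  have cf: "continuous_on {s..s + \<theta>} ?f"
    using eps_pos s by (intro continuous_intros continuous_on_subset[OF cont_drift]) auto
  \<comment> \<open>Without the noise the path is differentiable, and it has moved by at most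
    \<open>3 * Q\<close>.\<close>
  define z where "z u = x s + integral {s..u} ?f" for u
  have z: "z u = x u - \<sigma> / sqrt \<epsilon> * (w u - w s)" if "u \<in> {s..s + \<theta>}" for u
    using x_increment[of s u] that s by (simp add: z_def)
  have z_big: "13 * Q \<le> z u" if "u \<in> {s..s + \<theta>}" for u
    using z[OF that] big[OF that] noise[OF that] by linarith
  have cz: "continuous_on {s..s + \<theta>} z"
    unfolding z_def by (intro continuous_intros indefinite_integral_continuous_1 integrable_continuous_real cf)
  have dz: "(z has_real_derivative ?f u) (at u)" if "s < u" "u < s + \<theta>" for u
  proof -
    have "(z has_real_derivative 0 + ?f u) (at u within {s..s + \<theta>})"
      unfolding z_def using that
      by (intro DERIV_add DERIV_const integral_has_real_derivative cf) auto
    then show ?thesis using that by (simp add: at_within_Icc_at)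
  qed
  \<comment> \<open>Above \<open>16 * Q\<close> the linear part of the drift is at most half of the
    cubic part, as \<open>48 \<le> 256 / 2\<close>; then \<open>x u \<ge> z u / 2\<close> replaces
    the cube of \<open>x\<close> by that of \<open>z\<close>.\<close>
  have slope: "?f u \<le> - (z u ^ 3) / (16 * \<epsilon>)" if "u \<in> {s..s + \<theta>}" for u
  proof -
    have x: "16 * Q < x u" "z u / 2 \<le> x u" "0 < z u"
      using big[OF that] z[OF that] z_big[OF that] noise[OF that] Q by linarith+
    have "(16 * Q)\<^sup>2 \<le> (x u)\<^sup>2" using x Q by (intro power_mono) auto
    then have "256 * Q\<^sup>2 \<le> (x u)\<^sup>2" by (simp add: power_mult_distrib)
    then have "mu a0 u \<le> (x u)\<^sup>2 / 2" using mu[OF that] zero_le_power2[of Q] by linarith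
    then have "mu a0 u * x u \<le> (x u)\<^sup>2 / 2 * x u" using x Q by (intro mult_right_mono) auto
    then have "drift a0 u (x u) \<le> - (x u ^ 3) / 2"
      by (simp add: drift_def power3_eq_cube power2_eq_square)
    also have "\<dots> \<le> - ((z u / 2) ^ 3) / 2"
      using power_mono[OF x(2), of 3] x(3) by simp
    finally have "drift a0 u (x u) \<le> - (z u ^ 3) / 16" by (simp add: power_divide)
    then show ?thesis using eps_pos by (simp add: divide_simps)
  qed
  let ?g = "\<lambda>u. inverse (z u * z u) - u / (8 * \<epsilon>)"
  have "?g s \<le> ?g (s + \<theta>)"
  proof (rule DERIV_nonneg_imp_increasing_open[where f = ?g])
    fix u assume u: "s < u" "u < s + \<theta>"
    then have zu: "0 < z u" "z u \<noteq> 0" using z_big[of u] Q by auto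
    have "(?g has_real_derivative - (inverse (z u * z u) * (z u * ?f u + ?f u * z u) * inverse (z u * z u)) - 1 / (8 * \<epsilon>)) (at u)"
      using zu eps_pos by (auto intro!: derivative_eq_intros dz[OF u])
    moreover have "0 \<le> - (inverse (z u * z u) * (z u * ?f u + ?f u * z u) * inverse (z u * z u)) - 1 / (8 * \<epsilon>)"
    proof -
      have "- (inverse (z u * z u) * (z u * ?f u + ?f u * z u) * inverse (z u * z u)) = 2 / z u ^ 3 * - ?f u"
        using zu by (simp add: field_simps power3_eq_cube)
      moreover have "2 / z u ^ 3 * (z u ^ 3 / (16 * \<epsilon>)) \<le> 2 / z u ^ 3 * - ?f u"
        using slope[of u] u zu by (intro mult_left_mono) auto
      moreover have "2 / z u ^ 3 * (z u ^ 3 / (16 * \<epsilon>)) = 1 / (8 * \<epsilon>)" using zu by simp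
      ultimately show ?thesis by linarith
    qed
    ultimately show "\<exists>y. (?g has_real_derivative y) (at u) \<and> 0 \<le> y" by blast
  next
    have "z u * z u \<noteq> 0" if "u \<in> {s..s + \<theta>}" for u using z_big[OF that] Q by auto
    then show "continuous_on {s..s + \<theta>} ?g"
      using eps_pos by (intro continuous_intros cz) auto
  qed (use th in simp)
  moreover have "0 < inverse (z s * z s)" using z_big[of s] Q th by simp
  ultimately have "\<theta> / (8 * \<epsilon>) < inverse (z (s + \<theta>) * z (s + \<theta>))"
    by (simp add: add_divide_distrib)
  also have "\<dots> \<le> inverse ((13 * Q) * (13 * Q))"
    using z_big[of "s + \<theta>"] Q th by (intro le_imp_inverse_le mult_mono) auto
  \<comment> \<open>The left side is \<open>1 / (8 * Q\<^sup>2)\<close>, the right side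
    \<open>1 / (169 * Q\<^sup>2)\<close>.\<close>
  finally show False using Q eps_pos by (simp add: \<theta> divide_simps power2_eq_square)
qed

text \<open>A path that stays non-negative has some value at most \<open>16 * Q\<close> in the first
  half of the block. From there the drift lifts it by at most \<open>256 * Q\<close>, the calm half
  by at most \<open>6 * Q\<close>, and the drop takes away more than \<open>279 * Q\<close>; since
  \<open>16 + 256 + 6 < 279\<close>, it ends below zero.\<close>

lemma block_forces_crossing:
  assumes Q: "0 < Q" "\<sigma> = Q\<^sup>2" and \<theta>: "\<theta> = \<epsilon> / \<sigma>" and s: "t0 \<le> s" "s + 2 * \<theta> \<le> t1"
    and mu: "\<And>u. u \<in> {s..s + 2 * \<theta>} \<Longrightarrow> mu a0 u \<le> 48 * Q\<^sup>2"
    and up: "\<And>u. u \<in> {s..s + \<theta>} \<Longrightarrow> \<bar>w u - w s\<bar> \<le> 3 * sqrt \<theta>"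
    and down: "w (s + 2 * \<theta>) - w (s + \<theta>) < - 279 * sqrt \<theta>"
  shows "\<exists>u\<in>{s..s + 2 * \<theta>}. x u < 0"
proof (rule ccontr)
  assume "\<not> ?thesis"
  then have nonneg: "0 \<le> x u" if "u \<in> {s..s + 2 * \<theta>}" for u using that not_less by blast
  have th: "0 < \<theta>" using Q eps_pos by (simp add: \<theta>)
  have scale: "\<sigma> / sqrt \<epsilon> * sqrt \<theta> = Q"
    using Q eps_pos by (simp add: \<theta> real_sqrt_divide power2_eq_square)
  have sp: "0 < \<sigma> / sqrt \<epsilon>" using Q eps_pos by simp
  let ?n = "\<lambda>u v. \<sigma> / sqrt \<epsilon> * (w u - w v)"
  have n1: "\<bar>?n u s\<bar> \<le> 3 * Q" if "u \<in> {s..s + \<theta>}" for u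
  proof -
    have "\<bar>?n u s\<bar> = \<sigma> / sqrt \<epsilon> * \<bar>w u - w s\<bar>" using sp by (simp only: abs_mult abs_of_pos)
    also have "\<dots> \<le> \<sigma> / sqrt \<epsilon> * (3 * sqrt \<theta>)" using up[OF that] sp by (intro mult_left_mono) auto
    also have "\<dots> = 3 * (\<sigma> / sqrt \<epsilon> * sqrt \<theta>)" by simp
    finally show ?thesis unfolding scale .
  qed
  have "?n (s + 2 * \<theta>) (s + \<theta>) < \<sigma> / sqrt \<epsilon> * (- 279 * sqrt \<theta>)"
    using down sp by (intro mult_strict_left_mono) auto
  also have "\<dots> = - 279 * (\<sigma> / sqrt \<epsilon> * sqrt \<theta>)" by simp
  finally have n2: "?n (s + 2 * \<theta>) (s + \<theta>) < - 279 * Q" unfolding scale .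
  have "\<exists>u\<in>{s..s + \<theta>}. x u \<le> 16 * Q"
    using Q \<theta> s th mu n1 by (intro comes_down) auto
  then obtain v where v: "v \<in> {s..s + \<theta>}" "x v \<le> 16 * Q" by blast
  \<comment> \<open>For \<open>y \<ge> 0\<close> the cubic \<open>48 * Q\<^sup>2 * y - y ^ 3\<close>
    is maximal at \<open>y = 4 * Q\<close>; the product below is the maximum minus the cubic, with
    its double root there.\<close>
  have bound: "drift a0 u (x u) \<le> 128 * Q ^ 3" if "u \<in> {v..s + 2 * \<theta>}" for u
  proof -
    have u: "u \<in> {s..s + 2 * \<theta>}" using that v by auto
    have "0 \<le> (x u - 4 * Q)\<^sup>2 * (x u + 8 * Q)" using nonneg[OF u] Q by simp
    then have "48 * Q\<^sup>2 * x u - x u ^ 3 \<le> 128 * Q ^ 3"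
      by (simp add: power2_eq_square power3_eq_cube algebra_simps)
    moreover have "mu a0 u * x u \<le> 48 * Q\<^sup>2 * x u"
      using mu[OF u] nonneg[OF u] by (intro mult_right_mono)
    ultimately show ?thesis unfolding drift_def by linarith
  qed
  have "x (s + 2 * \<theta>) - x v \<le> (s + 2 * \<theta> - v) / \<epsilon> * (128 * Q ^ 3) + ?n (s + 2 * \<theta>) v"
    using v s th bound by (intro x_increment_le) auto
  also have "(s + 2 * \<theta> - v) / \<epsilon> * (128 * Q ^ 3) \<le> (2 * \<theta>) / \<epsilon> * (128 * Q ^ 3)"
    using v eps_pos Q by (intro mult_right_mono divide_right_mono) auto
  also have "(2 * \<theta>) / \<epsilon> * (128 * Q ^ 3) = 256 * Q"
    using eps_pos Q by (simp add: \<theta> field_simps power2_eq_square power3_eq_cube)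
  also have "?n (s + 2 * \<theta>) v = ?n (s + 2 * \<theta>) (s + \<theta>) + ?n (s + \<theta>) s - ?n v s"
    by (simp add: algebra_simps)
  also have "\<dots> < - 279 * Q + 3 * Q + 3 * Q"
  proof -
    have "s + \<theta> \<in> {s..s + \<theta>}" using th by simp
    from n1[OF this] n1[OF v(1)] n2 show ?thesis by linarith
  qed
  finally have "x (s + 2 * \<theta>) < 0" using v(2) Q by simp
  with nonneg[of "s + 2 * \<theta>"] th show False by simp
qed

end

definition std_tail :: real where
  "std_tail = measure (density lborel (\<lambda>x. ennreal (std_normal_density x))) {..< -279}"

lemma std_tail_pos: "0 < std_tail"
proof -
  interpret prob_space "density lborel (\<lambda>x. ennreal (std_normal_density x))"
    using prob_space_normal_density[of 1 0] by simp
  \<comment> \<open>A unit interval inside the tail suffices; on it the density is smallest at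
    \<open>-281\<close>.\<close>
  let ?c = "std_normal_density 281"
  have c: "0 < ?c" by (rule normal_density_pos) simp
  have "ennreal ?c = (\<integral>\<^sup>+x. ennreal ?c * indicator {- 281..- 280 :: real} x \<partial>lborel)"
    by (subst nn_integral_cmult_indicator) auto
  also have "\<dots> \<le> (\<integral>\<^sup>+x. ennreal (std_normal_density x) * indicator {..< -279} x \<partial>lborel)"
  proof (intro nn_integral_mono)
    fix x :: real
    have "?c \<le> std_normal_density x" if "x \<in> {- 281..- 280}"
    proof -
      have "x\<^sup>2 \<le> 281\<^sup>2" using that abs_le_square_iff[of x 281] by auto
      then show ?thesis by (simp add: std_normal_density_def divide_right_mono)
    qed
    then show "ennreal ?c * indicator {- 281..- 280} x \<le> ennreal (std_normal_density x) * indicator {..< -279} x"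
      by (auto simp: indicator_def ennreal_leI)
  qed
  also have "\<dots> = emeasure (density lborel (\<lambda>x. ennreal (std_normal_density x))) {..< -279}"
    by (subst emeasure_density) auto
  finally have "ennreal ?c \<le> ennreal std_tail" by (simp add: emeasure_eq_measure std_tail_def)
  then have "?c \<le> std_tail" by (subst (asm) ennreal_le_iff) (simp add: std_tail_def)
  with c show ?thesis by linarith
qed

section \<open>Independent blocks of Brownian increments\<close>

context brownian
begin

definition block_event :: "real \<Rightarrow> real \<Rightarrow> 'a \<Rightarrow> bool" where
  "block_event \<theta> s \<omega> \<longleftrightarrow> (\<forall>u\<in>{s..s + \<theta>}. \<bar>W u \<omega> - W s \<omega>\<bar> \<le> 3 * sqrt \<theta>) \<and>
    W (s + 2 * \<theta>) \<omega> - W (s + \<theta>) \<omega> < - 279 * sqrt \<theta>"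

text \<open>Calmness is tested at grid times only, so for positive \<open>\<theta>\<close> this is
  weaker than \<open>block_event\<close>; it depends on finitely many increments, to which
  independence applies.\<close>

definition grid_block_event :: "nat \<Rightarrow> real \<Rightarrow> real \<Rightarrow> 'a \<Rightarrow> bool" where
  "grid_block_event N \<theta> s \<omega> \<longleftrightarrow> (\<forall>k\<le>N. \<bar>W (s + real k * (\<theta> / real N)) \<omega> - W s \<omega>\<bar> \<le> 3 * sqrt \<theta>) \<and>
    W (s + 2 * \<theta>) \<omega> - W (s + \<theta>) \<omega> < - 279 * sqrt \<theta>"

lemma measurable_grid_block_event [measurable]:
  "Measurable.pred M (grid_block_event N \<theta> s)"
  unfolding grid_block_event_def by measurable

lemma W_down_prob:
  assumes "0 < \<theta>"
  shows "prob {\<omega>\<in>space M. W (s + \<theta>) \<omega> - W s \<omega> < - 279 * sqrt \<theta>} = std_tail"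
proof -
  let ?Z = "\<lambda>\<omega>. 1 / sqrt \<theta> * (W (s + \<theta>) \<omega> - W s \<omega>)"
  have "distributed M lborel ?Z (\<lambda>x. ennreal (std_normal_density x))"
    using distributed_normal_scale[OF W_increment[of s "s + \<theta>"], where c="1 / sqrt \<theta>"] assms by simp
  then have "distr M lborel ?Z = density lborel (\<lambda>x. ennreal (std_normal_density x))"
    by (rule distributed_distr_eq_density)
  then have "std_tail = measure (distr M lborel ?Z) {..< -279}" by (simp add: std_tail_def)
  also have "\<dots> = prob (?Z -` {..< -279} \<inter> space M)"
    by (rule measure_distr) auto
  also have "?Z -` {..< -279} \<inter> space M = {\<omega>\<in>space M. W (s + \<theta>) \<omega> - W s \<omega> < - 279 * sqrt \<theta>}"
    using assms by (auto simp: divide_simps)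
  finally show ?thesis by simp
qed

lemma grid_calm_prob:
  fixes N :: nat
  assumes "0 < \<theta>" "0 < N"
  shows "1 / 2 \<le> prob {\<omega>\<in>space M. \<forall>k\<le>N. \<bar>W (s + real k * (\<theta> / real N)) \<omega> - W s \<omega>\<bar> \<le> 3 * sqrt \<theta>}"
proof -
  let ?G = "{\<omega>\<in>space M. \<forall>k\<le>N. \<bar>W (s + real k * (\<theta> / real N)) \<omega> - W s \<omega>\<bar> \<le> 3 * sqrt \<theta>}"
  have G: "?G \<in> events" by measurable
  \<comment> \<open>Level \<open>3 * sqrt \<theta>\<close> over time \<open>\<theta>\<close> gives
    the exponent \<open>9/2\<close>, enough to bring the factor \<open>4\<close> of the maximal
    inequality below one half.\<close>
  have "1 + 9/2 + (9/2)\<^sup>2 / 2 \<le> exp (9/2 :: real)" by (rule exp_lower_Taylor_quadratic) simp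
  then have "8 \<le> exp (9/2 :: real)" by (simp add: power2_eq_square)
  then have e: "4 * exp (- (9/2)) \<le> (1/2 :: real)" by (simp add: exp_minus divide_simps)
  have "prob (space M - ?G) \<le> prob {\<omega>\<in>space M. \<exists>k\<le>N. 3 * sqrt \<theta> \<le> \<bar>W (s + real k * (\<theta> / real N)) \<omega> - W s \<omega>\<bar>}"
    by (intro finite_measure_mono) (auto simp: not_le intro: less_imp_le)
  also have "\<dots> \<le> 4 * exp (- (3 * sqrt \<theta>)\<^sup>2 / (2 * (real N * (\<theta> / real N))))"
    using assms by (intro W_grid_abs_max) auto
  also have "\<dots> = 4 * exp (- (9/2))" using assms by (simp add: power_mult_distrib)
  finally show ?thesis using e prob_compl[OF G] by simp
qed

text \<open>Block \<open>i\<close> owns the increments with index in \<open>K i\<close>, so the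
  blocks are independent. Inside a block calmness reads the first \<open>N\<close> increments and
  the drop the last \<open>N\<close>, so the block probability is a product of a factor at least
  \<open>1/2\<close> and \<open>std_tail\<close>.\<close>

lemma no_grid_block_event_prob:
  assumes \<theta>: "0 < \<theta>" and N: "0 < N"
  shows "prob {\<omega>\<in>space M. \<forall>i<n. \<not> grid_block_event N \<theta> (s + 2 * \<theta> * real i) \<omega>} \<le> (1 - std_tail / 2) ^ n"
proof (cases "n = 0")
  case False
  define d where "d = \<theta> / real N"
  have d: "0 < d" "real N * d = \<theta>" using assms by (auto simp: d_def)
  let ?t = "\<lambda>j. s + real j * d"
  define Z where "Z j \<omega> = W (?t (Suc j)) \<omega> - W (?t j) \<omega>" for j \<omega>
  define b where "b i = i * (2 * N)" for i
  define K where "K i = {b i..<b i + 2 * N}" for i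
  let ?P = "\<lambda>I. \<Pi>\<^sub>M j\<in>I. (borel :: real measure)"
  have indep: "indep_vars (\<lambda>_. borel) Z {..<n * (2 * N)}"
    unfolding Z_def[abs_def] by (rule W_indep_increments) (use d in simp)
  have Ksub: "K i \<subseteq> {..<n * (2 * N)}" if "i < n" for i
  proof -
    have "Suc i * (2 * N) \<le> n * (2 * N)" using that by (intro mult_right_mono) auto
    then show ?thesis by (auto simp: K_def b_def)
  qed
  have disj: "disjoint_family_on K {..<n}"
  proof -
    have "K i \<inter> K j = {}" if "i < j" for i j
    proof -
      have "Suc i * (2 * N) \<le> j * (2 * N)" using that by (intro mult_right_mono) auto
      then show ?thesis by (auto simp: K_def b_def)
    qed
    then show ?thesis unfolding disjoint_family_on_def by (metis inf_commute nat_neq_iff)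
  qed
  have sum: "W (?t (b i + k)) \<omega> - W (?t (b i + l)) \<omega> = (\<Sum>j=b i + l..<b i + k. Z j \<omega>)" if "l \<le> k" for i k l \<omega>
    unfolding Z_def using sum_Suc_diff'[of "b i + l" "b i + k" "\<lambda>j. W (?t j) \<omega>"] that by simp
  have pt: "s + 2 * \<theta> * real i + real k * (\<theta> / real N) = ?t (b i + k)"
    "s + 2 * \<theta> * real i = ?t (b i + 0)" "s + 2 * \<theta> * real i + \<theta> = ?t (b i + N)"
    "s + 2 * \<theta> * real i + 2 * \<theta> = ?t (b i + 2 * N)" for i k
    unfolding b_def d(2)[symmetric] using N by (simp_all add: algebra_simps)
  have inc: "W (s + 2 * \<theta> * real i + real k * (\<theta> / real N)) \<omega> - W (s + 2 * \<theta> * real i) \<omega>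
      = (\<Sum>j=b i..<b i + k. Z j \<omega>)"
    "W (s + 2 * \<theta> * real i + 2 * \<theta>) \<omega> - W (s + 2 * \<theta> * real i + \<theta>) \<omega>
      = (\<Sum>j=b i + N..<b i + 2 * N. Z j \<omega>)" for i k \<omega>
    using sum[of 0 k i \<omega>, folded pt] sum[of N "2 * N" i \<omega>, folded pt] N by simp_all
  define calm where "calm i z \<longleftrightarrow> (\<forall>k\<le>N. \<bar>\<Sum>j=b i..<b i + k. z j\<bar> \<le> 3 * sqrt \<theta>)" for i and z :: "nat \<Rightarrow> real"
  define down where "down i z \<longleftrightarrow> (\<Sum>j=b i + N..<b i + 2 * N. z j) < - 279 * sqrt \<theta>" for i and z :: "nat \<Rightarrow> real"
  have ge: "grid_block_event N \<theta> (s + 2 * \<theta> * real i) \<omega> \<longleftrightarrow> calm i (\<lambda>j. Z j \<omega>) \<and> down i (\<lambda>j. Z j \<omega>)" for i \<omega>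
    unfolding grid_block_event_def inc calm_def down_def by simp
  have calm_cong: "calm i z = calm i z'" if "\<And>j. j \<in> {b i..<b i + N} \<Longrightarrow> z j = z' j" for i z z'
  proof -
    have "(\<Sum>j=b i..<b i + k. z j) = (\<Sum>j=b i..<b i + k. z' j)" if "k \<le> N" for k
      using that \<open>\<And>j. j \<in> {b i..<b i + N} \<Longrightarrow> z j = z' j\<close> by (intro sum.cong) auto
    then show ?thesis unfolding calm_def by auto
  qed
  have down_cong: "down i z = down i z'" if "\<And>j. j \<in> {b i + N..<b i + 2 * N} \<Longrightarrow> z j = z' j" for i z z'
    unfolding down_def using that by (metis (no_types, lifting) sum.cong)
  have m_calm: "{z\<in>space (?P I). calm i z} \<in> sets (?P I)" if "{b i..<b i + N} \<subseteq> I" for i I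
  proof -
    have [measurable]: "(\<lambda>z. \<Sum>j=b i..<b i + k. z j) \<in> borel_measurable (?P I)" if "k \<le> N" for k
      using that \<open>{b i..<b i + N} \<subseteq> I\<close> by (intro borel_measurable_sum measurable_component_singleton) auto
    have "{z\<in>space (?P I). \<forall>k\<in>{..N}. \<bar>\<Sum>j=b i..<b i + k. z j\<bar> \<le> 3 * sqrt \<theta>} \<in> sets (?P I)"
      by (rule sets.sets_Collect_finite_All) auto
    then show ?thesis by (simp add: calm_def Ball_def)
  qed
  have m_down: "{z\<in>space (?P I). down i z} \<in> sets (?P I)" if "{b i + N..<b i + 2 * N} \<subseteq> I" for i I
  proof -
    have [measurable]: "(\<lambda>z. \<Sum>j=b i + N..<b i + 2 * N. z j) \<in> borel_measurable (?P I)"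
      using that by (intro borel_measurable_sum measurable_component_singleton) auto
    show ?thesis unfolding down_def by measurable
  qed
  have one: "std_tail / 2 \<le> prob {\<omega>\<in>space M. grid_block_event N \<theta> (s + 2 * \<theta> * real i) \<omega>}" if "i < n" for i
  proof -
    let ?A = "{b i..<b i + N}" and ?B = "{b i + N..<b i + 2 * N}"
    have "?A \<subseteq> K i" "?B \<subseteq> K i" "?A \<inter> ?B = {}" by (auto simp: K_def)
    then have AB: "?A \<subseteq> {..<n * (2 * N)}" "?B \<subseteq> {..<n * (2 * N)}" "?A \<inter> ?B = {}"
      using Ksub[OF that] by blast+
    have iv: "indep_var (?P ?A) (\<lambda>\<omega>. \<lambda>j\<in>?A. Z j \<omega>) (?P ?B) (\<lambda>\<omega>. \<lambda>j\<in>?B. Z j \<omega>)"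
      by (rule indep_var_restrict[OF indep AB(3,1,2)])
    have ra: "(\<lambda>\<omega>. \<lambda>j\<in>?A. Z j \<omega>) -` {z\<in>space (?P ?A). calm i z} \<inter> space M = {\<omega>\<in>space M. calm i (\<lambda>j. Z j \<omega>)}"
      using calm_cong[of i "\<lambda>j\<in>?A. Z j \<omega>" "\<lambda>j. Z j \<omega>" for \<omega>] measurable_space[OF indep_var_rv1[OF iv]] by auto
    have rb: "(\<lambda>\<omega>. \<lambda>j\<in>?B. Z j \<omega>) -` {z\<in>space (?P ?B). down i z} \<inter> space M = {\<omega>\<in>space M. down i (\<lambda>j. Z j \<omega>)}"
      using down_cong[of i "\<lambda>j\<in>?B. Z j \<omega>" "\<lambda>j. Z j \<omega>" for \<omega>] measurable_space[OF indep_var_rv2[OF iv]] by auto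
    have "prob ((\<lambda>\<omega>. (\<lambda>j\<in>?A. Z j \<omega>, \<lambda>j\<in>?B. Z j \<omega>)) -` ({z\<in>space (?P ?A). calm i z} \<times> {z\<in>space (?P ?B). down i z}) \<inter> space M)
      = prob {\<omega>\<in>space M. calm i (\<lambda>j. Z j \<omega>)} * prob {\<omega>\<in>space M. down i (\<lambda>j. Z j \<omega>)}"
      unfolding ra[symmetric] rb[symmetric] by (rule indep_varD[OF iv]) (auto intro!: m_calm m_down)
    also have "(\<lambda>\<omega>. (\<lambda>j\<in>?A. Z j \<omega>, \<lambda>j\<in>?B. Z j \<omega>)) -` ({z\<in>space (?P ?A). calm i z} \<times> {z\<in>space (?P ?B). down i z}) \<inter> space M
      = {\<omega>\<in>space M. grid_block_event N \<theta> (s + 2 * \<theta> * real i) \<omega>}"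
      unfolding ge using ra rb by blast
    finally have eq: "prob {\<omega>\<in>space M. grid_block_event N \<theta> (s + 2 * \<theta> * real i) \<omega>}
      = prob {\<omega>\<in>space M. calm i (\<lambda>j. Z j \<omega>)} * prob {\<omega>\<in>space M. down i (\<lambda>j. Z j \<omega>)}" .
    have "calm i (\<lambda>j. Z j \<omega>) \<longleftrightarrow> (\<forall>k\<le>N. \<bar>W (s + 2 * \<theta> * real i + real k * (\<theta> / real N)) \<omega> - W (s + 2 * \<theta> * real i) \<omega>\<bar> \<le> 3 * sqrt \<theta>)" for \<omega>
      unfolding calm_def inc by simp
    then have 1: "1 / 2 \<le> prob {\<omega>\<in>space M. calm i (\<lambda>j. Z j \<omega>)}"
      using grid_calm_prob[OF assms, of "s + 2 * \<theta> * real i"] by simp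
    have "down i (\<lambda>j. Z j \<omega>) \<longleftrightarrow> W (s + 2 * \<theta> * real i + \<theta> + \<theta>) \<omega> - W (s + 2 * \<theta> * real i + \<theta>) \<omega> < - 279 * sqrt \<theta>" for \<omega>
      using inc(2)[of i \<omega>] unfolding down_def by (simp add: add.assoc)
    then have 2: "prob {\<omega>\<in>space M. down i (\<lambda>j. Z j \<omega>)} = std_tail"
      using W_down_prob[OF \<theta>, of "s + 2 * \<theta> * real i + \<theta>"] by simp
    show ?thesis unfolding eq 2 using mult_right_mono[OF 1, of std_tail] std_tail_pos by simp
  qed
  have iv: "indep_vars (\<lambda>i. ?P (K i)) (\<lambda>i \<omega>. restrict (\<lambda>j. Z j \<omega>) (K i)) {..<n}"
    using Ksub disj by (intro indep_vars_restrict[OF indep]) auto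
  let ?C = "\<lambda>i. {z\<in>space (?P (K i)). \<not> (calm i z \<and> down i z)}"
  have C: "?C i \<in> sets (?P (K i))" for i
  proof -
    have "?C i = space (?P (K i)) - ({z\<in>space (?P (K i)). calm i z} \<inter> {z\<in>space (?P (K i)). down i z})" by auto
    also have "\<dots> \<in> sets (?P (K i))"
      by (intro sets.Diff sets.top sets.Int m_calm m_down) (auto simp: K_def)
    finally show ?thesis .
  qed
  have rc: "(\<lambda>\<omega>. restrict (\<lambda>j. Z j \<omega>) (K i)) -` ?C i \<inter> space M
      = space M - {\<omega>\<in>space M. grid_block_event N \<theta> (s + 2 * \<theta> * real i) \<omega>}" if "i < n" for i
  proof -
    have rv: "(\<lambda>\<omega>. restrict (\<lambda>j. Z j \<omega>) (K i)) \<in> measurable M (?P (K i))"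
      using iv that by (auto simp: indep_vars_def)
    have "calm i (restrict (\<lambda>j. Z j \<omega>) (K i)) = calm i (\<lambda>j. Z j \<omega>)"
      "down i (restrict (\<lambda>j. Z j \<omega>) (K i)) = down i (\<lambda>j. Z j \<omega>)" for \<omega>
      by (auto intro!: calm_cong down_cong simp: K_def)
    then show ?thesis unfolding ge using measurable_space[OF rv] by auto
  qed
  have "{\<omega>\<in>space M. \<forall>i<n. \<not> grid_block_event N \<theta> (s + 2 * \<theta> * real i) \<omega>}
      = (\<Inter>i\<in>{..<n}. (\<lambda>\<omega>. restrict (\<lambda>j. Z j \<omega>) (K i)) -` ?C i \<inter> space M)"
  proof -
    have "{\<omega>\<in>space M. \<forall>i<n. \<not> grid_block_event N \<theta> (s + 2 * \<theta> * real i) \<omega>}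
      = (\<Inter>i\<in>{..<n}. space M - {\<omega>\<in>space M. grid_block_event N \<theta> (s + 2 * \<theta> * real i) \<omega>})"
      using False by auto
    also have "\<dots> = (\<Inter>i\<in>{..<n}. (\<lambda>\<omega>. restrict (\<lambda>j. Z j \<omega>) (K i)) -` ?C i \<inter> space M)"
      by (intro INF_cong refl) (simp only: rc lessThan_iff)
    finally show ?thesis .
  qed
  also have "prob \<dots> = (\<Prod>i\<in>{..<n}. prob ((\<lambda>\<omega>. restrict (\<lambda>j. Z j \<omega>) (K i)) -` ?C i \<inter> space M))"
    using False by (intro indep_varsD_finite[OF iv] C) auto
  also have "\<dots> \<le> (\<Prod>i\<in>{..<n}. 1 - std_tail / 2)"
  proof (intro prod_mono conjI measure_nonneg)
    fix i assume "i \<in> {..<n}"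
    then have i: "i < n" by simp
    show "prob ((\<lambda>\<omega>. restrict (\<lambda>j. Z j \<omega>) (K i)) -` ?C i \<inter> space M) \<le> 1 - std_tail / 2"
      unfolding rc[OF i] using one[OF i] by (subst prob_compl) auto
  qed
  finally show ?thesis by simp
qed simp

text \<open>A block event fails either for lack of a drop, which every grid sees, or by a strict
  exceedance, which all fine dyadic grids see. So finitely many failures persist on all fine
  grids.\<close>

lemma no_block_event_prob:
  assumes \<theta>: "0 < \<theta>" and A: "A \<in> events"
    and no: "AE \<omega> in M. \<omega> \<in> A \<longrightarrow> (\<forall>i<n. \<not> block_event \<theta> (s + 2 * \<theta> * real i) \<omega>)"
  shows "prob A \<le> (1 - std_tail / 2) ^ n"
proof (rule prob_le_if_eventually_in[OF _ _ A])
  let ?B = "\<lambda>m. {\<omega>\<in>space M. \<forall>i<n. \<not> grid_block_event (2^m) \<theta> (s + 2 * \<theta> * real i) \<omega>}"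
  show "?B m \<in> events" "prob (?B m) \<le> (1 - std_tail / 2) ^ n" for m
    using no_grid_block_event_prob[OF \<theta>, of "2^m"] by simp_all
  show "AE \<omega> in M. \<omega> \<in> A \<longrightarrow> (\<forall>\<^sub>F m in sequentially. \<omega> \<in> ?B m)"
    using no AE_space
  proof eventually_elim
    case (elim \<omega>)
    have "\<forall>\<^sub>F m in sequentially. \<not> grid_block_event (2^m) \<theta> t \<omega>" if "\<not> block_event \<theta> t \<omega>" for t
    proof (cases "W (t + 2 * \<theta>) \<omega> - W (t + \<theta>) \<omega> < - 279 * sqrt \<theta>")
      case True
      with that obtain u where u: "t \<le> u" "u \<le> t + \<theta>" "3 * sqrt \<theta> < \<bar>W u \<omega> - W t \<omega>\<bar>"
        unfolding block_event_def by (auto simp: not_le)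
      have "continuous_on UNIV (\<lambda>u. \<bar>W u \<omega> - W t \<omega>\<bar>)"
        using W_continuous[OF elim(2)] by (intro continuous_intros)
      from continuous_gt_on_dyadic_grid[OF this u \<theta>] show ?thesis
        by eventually_elim (auto simp: grid_block_event_def not_le)
    qed (simp add: grid_block_event_def)
    then have "\<forall>\<^sub>F m in sequentially. \<forall>i\<in>{..<n}. \<not> grid_block_event (2^m) \<theta> (s + 2 * \<theta> * real i) \<omega>" if "\<omega> \<in> A"
      using elim(1) that by (intro eventually_ball_finite) auto
    then show ?case using elim(2) by (simp add: lessThan_def)
  qed
qed

end

context sde
begin

text \<open>The blocks lie in \<open>{- sqrt \<sigma>..0}\<close>, where
  \<open>mu a0 u \<le> a0 + 32 * \<sigma> \<le> 48 * \<sigma>\<close>. Off \<open>crossed\<close>,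
  almost surely no block event can occur.\<close>

lemma crossed_lower_bound:
  assumes a0: "0 \<le> a0" "a0 \<le> \<sigma>" and t0: "t0 \<le> - sqrt \<sigma>" and t1: "0 < t1"
    and n: "real n * (2 * (\<epsilon> / \<sigma>)) \<le> sqrt \<sigma>"
  shows "1 - (1 - std_tail / 2) ^ n \<le> prob crossed"
proof -
  let ?\<theta> = "\<epsilon> / \<sigma>"
  have th: "0 < ?\<theta>" using \<epsilon>_pos \<sigma>_pos by simp
  have "prob (space M - crossed) \<le> (1 - std_tail / 2) ^ n"
  proof (rule no_block_event_prob[OF th])
    show "AE \<omega> in M. \<omega> \<in> space M - crossed \<longrightarrow> (\<forall>i<n. \<not> block_event ?\<theta> (- sqrt \<sigma> + 2 * ?\<theta> * real i) \<omega>)"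
      using AE_path
    proof (eventually_elim, intro impI allI notI)
      fix \<omega> i assume path: "sde_path \<epsilon> a0 \<sigma> t0 t1 x0 (\<lambda>t. X t \<omega>) (\<lambda>t. W t \<omega>)"
        and w: "\<omega> \<in> space M - crossed" and i: "i < n"
        and be: "block_event ?\<theta> (- sqrt \<sigma> + 2 * ?\<theta> * real i) \<omega>"
      interpret p: sde_path \<epsilon> a0 \<sigma> t0 t1 x0 "\<lambda>t. X t \<omega>" "\<lambda>t. W t \<omega>" by (rule path)
      let ?s = "- sqrt \<sigma> + 2 * ?\<theta> * real i"
      have "real (Suc i) * (2 * ?\<theta>) \<le> real n * (2 * ?\<theta>)"
        using i th by (intro mult_right_mono) auto
      moreover have "real (Suc i) * (2 * c) = 2 * c * real i + 2 * c" for c by (simp add: algebra_simps)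
      ultimately have "2 * ?\<theta> * real i + 2 * ?\<theta> \<le> sqrt \<sigma>" using n order_trans by metis
      then have s_end: "?s + 2 * ?\<theta> \<le> 0" by linarith
      have s_start: "- sqrt \<sigma> \<le> ?s" using \<epsilon>_pos \<sigma>_pos by simp
      have "\<exists>u\<in>{?s..?s + 2 * ?\<theta>}. X u \<omega> < 0"
      proof (rule p.block_forces_crossing[where Q = "sqrt \<sigma>"])
        fix u assume u: "u \<in> {?s..?s + 2 * ?\<theta>}"
        then have "- sqrt \<sigma> \<le> u" "u \<le> 0"
          using s_end s_start unfolding atLeastAtMost_iff by linarith+
        then have "\<bar>u\<bar> \<le> \<bar>sqrt \<sigma>\<bar>" by auto
        then have "u\<^sup>2 \<le> \<sigma>" using abs_le_square_iff[of u "sqrt \<sigma>"] \<sigma>_pos by simp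
        then show "mu a0 u \<le> 48 * (sqrt \<sigma>)\<^sup>2" using mu_upper[of a0 u] a0 \<sigma>_pos by simp
      qed (use be \<sigma>_pos t0 t1 s_end s_start in \<open>auto simp: block_event_def\<close>)
      then obtain u where u: "?s \<le> u" "u \<le> ?s + 2 * ?\<theta>" "X u \<omega> < 0" by auto
      have u01: "t0 \<le> u" "u < t1" using u s_start s_end t0 t1 by linarith+
      \<comment> \<open>The crossing happens at a real time; continuity moves it to a rational time
        before \<open>t1\<close>.\<close>
      have "\<forall>e>0. \<exists>d>0. \<forall>v\<in>{t0..t1}. dist v u < d \<longrightarrow> dist (X v \<omega>) (X u \<omega>) < e"
        using p.cont_x u01 unfolding continuous_on_iff by auto
      then obtain d where d: "0 < d" "\<And>v. v \<in> {t0..t1} \<Longrightarrow> dist v u < d \<Longrightarrow> dist (X v \<omega>) (X u \<omega>) < - X u \<omega>"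
        using u(3) by (metis neg_0_less_iff_less)
      have "u < min t1 (u + d)" using u01 d by simp
      then obtain q where q: "q \<in> \<rat>" "u < q" "q < min t1 (u + d)"
        using Rats_dense_in_real by blast
      have "dist (X q \<omega>) (X u \<omega>) < - X u \<omega>"
        using q u01 by (intro d(2)) (auto simp: dist_real_def)
      then have "X q \<omega> < 0" by (simp add: dist_real_def abs_if split: if_splits)
      with q u01 w show False unfolding crossed_def by auto
    qed
  qed simp
  then show ?thesis using prob_compl[OF measurable_crossed] by simp
qed

end

section \<open>Staying in the well\<close>

text \<open>Just before the first contact time \<open>\<tau>\<close> the path lies in the strip of
  width \<open>\<eta>\<close> above the line, where \<open>step\<close> forbids the gap
  \<open>f\<close> to shrink; yet the gap is positive before \<open>\<tau>\<close> and zero at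
  \<open>\<tau>\<close>.\<close>

lemma affine_barrier:
  fixes z :: "real \<Rightarrow> real"
  assumes cont: "continuous_on {a..b} z" and start: "p < z a" and "0 < \<eta>"
    and step: "\<And>s t. a \<le> s \<Longrightarrow> s \<le> t \<Longrightarrow> t \<le> b \<Longrightarrow>
      (\<And>u. u \<in> {s..t} \<Longrightarrow> p + q * (u - a) \<le> z u \<and> z u \<le> p + q * (u - a) + \<eta>) \<Longrightarrow>
      q * (t - s) \<le> z t - z s"
    and t: "t \<in> {a..b}"
  shows "p + q * (t - a) < z t"
proof (rule ccontr)
  define f where "f u = z u - (p + q * (u - a))" for u
  assume "\<not> ?thesis"
  then have "f t \<le> 0" by (simp add: f_def)
  have cf: "continuous_on {a..b} f" unfolding f_def by (intro continuous_intros cont)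
  have fa: "0 < f a" using start by (simp add: f_def)
  have zero: "\<exists>y. a \<le> y \<and> y \<le> u \<and> f y = 0" if "u \<in> {a..b}" "f u \<le> 0" for u
    using that fa by (intro IVT2' continuous_on_subset[OF cf]) auto
  define S where "S = {a..b} \<inter> f -` {0}"
  have "closed S"
    unfolding S_def by (intro continuous_closed_preimage cf) auto
  then have "compact ({a..b} \<inter> S)" by (intro compact_Int_closed) auto
  moreover have "{a..b} \<inter> S = S" by (auto simp: S_def)
  ultimately have "compact S" by simp
  moreover have "S \<noteq> {}" using zero[OF t \<open>f t \<le> 0\<close>] t unfolding S_def by force
  ultimately obtain \<tau> where \<tau>: "\<tau> \<in> S" "\<And>u. u \<in> S \<Longrightarrow> \<tau> \<le> u"
    using compact_attains_inf[of S] by blast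
  have \<tau>_ab: "a \<le> \<tau>" "\<tau> \<le> b" "f \<tau> = 0" using \<tau>(1) by (auto simp: S_def)
  have before: "0 < f u" if "a \<le> u" "u < \<tau>" for u
  proof (rule ccontr)
    assume "\<not> ?thesis"
    then have "u \<in> {a..b}" "f u \<le> 0" using that \<tau>_ab by auto
    from zero[OF this] obtain y where "a \<le> y" "y \<le> u" "f y = 0" by blast
    then have "\<tau> \<le> y" using that \<tau>_ab by (intro \<tau>(2)) (auto simp: S_def)
    then show False using \<open>y \<le> u\<close> that by simp
  qed
  have "a < \<tau>" using fa \<tau>_ab by (cases "a = \<tau>") auto
  obtain d where d: "0 < d" "\<And>u. u \<in> {a..b} \<Longrightarrow> dist u \<tau> < d \<Longrightarrow> dist (f u) (f \<tau>) < \<eta>"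
    using cf \<tau>_ab \<open>0 < \<eta>\<close> unfolding continuous_on_iff by (metis atLeastAtMost_iff)
  define s where "s = max a (\<tau> - d / 2)"
  have s: "a \<le> s" "s < \<tau>" "\<tau> - s < d" using \<open>a < \<tau>\<close> d by (auto simp: s_def)
  have "q * (\<tau> - s) \<le> z \<tau> - z s"
  proof (rule step)
    fix u assume u: "u \<in> {s..\<tau>}"
    then have "dist (f u) (f \<tau>) < \<eta>" using s \<tau>_ab by (intro d) (auto simp: dist_real_def)
    then have "f u \<le> \<eta>" using \<tau>_ab by (simp add: dist_real_def)
    moreover have "0 \<le> f u" using before[of u] u s \<tau>_ab by (cases "u = \<tau>") auto
    ultimately show "p + q * (u - a) \<le> z u \<and> z u \<le> p + q * (u - a) + \<eta>" by (simp add: f_def)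
  qed (use s \<tau>_ab in auto)
  then have "f s \<le> f \<tau>" by (simp add: f_def algebra_simps)
  with before[of s] s \<tau>_ab show False by simp
qed

text \<open>Each summand is the length of the part of the \<open>k\<close>-th interval of length
  \<open>e\<close> that lies below \<open>v\<close>.\<close>

lemma clamp_sum:
  fixes e v :: real
  assumes "0 \<le> e"
  shows "(\<Sum>k<n. max 0 (min e (v - real k * e))) = max 0 (min (real n * e) v)"
proof (induction n)
  case (Suc n)
  have "max 0 (min A v) + max 0 (min e (v - A)) = max 0 (min (A + e) v)" if "0 \<le> A" for A
    using assms that by (auto simp: max_def min_def)
  from this[of "real n * e"] show ?case using Suc assms by (simp add: distrib_right add.commute)
qed simp

lemma chain_linear:
  "chain (\<lambda>_ y. r * y) 0 z k = (\<Sum>j<k. r ^ (k - Suc j) * z j)"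
proof (induction k)
  case (Suc k)
  have "r * r ^ (k - Suc j) = r ^ (k - j)" if "j < k" for j
    using that by (metis Suc_diff_Suc power_Suc)
  then have "r * (\<Sum>j<k. r ^ (k - Suc j) * z j) = (\<Sum>j<k. r ^ (k - j) * z j)"
    unfolding sum_distrib_left by (intro sum.cong) (auto simp: mult.assoc[symmetric])
  then show ?case using Suc by simp
qed simp

section \<open>Solution minus the discretised Ornstein-Uhlenbeck process\<close>

context sde_path
begin

text \<open>Discretised Ornstein--Uhlenbeck process with damping rate \<open>\<gamma> / \<epsilon>\<close>.\<close>
definition ou :: "real \<Rightarrow> nat \<Rightarrow> real" where
  "ou \<gamma> = chain (\<lambda>_ y. (1 - \<gamma>) * y) 0
     (\<lambda>i. \<sigma> / sqrt \<epsilon> * (w (t0 + real (Suc i) * \<epsilon>) - w (t0 + real i * \<epsilon>)))"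

text \<open>Summation of the recursion, in which each increment of \<open>ou \<gamma>\<close> is a
  noise increment minus \<open>\<gamma>\<close> times the current value.\<close>

lemma ou_noise:
  "\<sigma> / sqrt \<epsilon> * (w (t0 + real k * \<epsilon>) - w t0) = ou \<gamma> k + \<gamma> * (\<Sum>j<k. ou \<gamma> j)"
proof (induction k)
  case (Suc k)
  have "\<sigma> / sqrt \<epsilon> * (w (t0 + real (Suc k) * \<epsilon>) - w t0)
      = \<sigma> / sqrt \<epsilon> * (w (t0 + real k * \<epsilon>) - w t0)
        + \<sigma> / sqrt \<epsilon> * (w (t0 + real (Suc k) * \<epsilon>) - w (t0 + real k * \<epsilon>))"
    by (simp only: distrib_left[symmetric]) simp
  moreover have "ou \<gamma> (Suc k) = (1 - \<gamma>) * ou \<gamma> k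
      + \<sigma> / sqrt \<epsilon> * (w (t0 + real (Suc k) * \<epsilon>) - w (t0 + real k * \<epsilon>))"
    by (simp add: ou_def)
  ultimately show ?case using Suc by (simp add: algebra_simps)
qed (simp add: ou_def)

context
  fixes \<gamma> h :: real and n :: nat
  assumes \<gamma>: "0 < \<gamma>" "\<gamma> \<le> 1" and "0 \<le> h"
    and ou_le: "\<And>k. k < n \<Longrightarrow> \<bar>ou \<gamma> k\<bar> \<le> h"
    and local_le: "\<And>k u. k < n \<Longrightarrow> u \<in> {t0 + real k * \<epsilon>..t0 + real k * \<epsilon> + \<epsilon>} \<Longrightarrow>
      \<bar>\<sigma> / sqrt \<epsilon> * (w u - w (t0 + real k * \<epsilon>))\<bar> \<le> h"
    and n: "t1 < t0 + real n * \<epsilon>"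
begin

text \<open>For \<open>t \<ge> t0\<close>, the integral from \<open>t0\<close> to \<open>t\<close>
  of the step function equal to \<open>ou \<gamma> k\<close> on the \<open>k\<close>-th step; the
  clamp is the time spent in that step.\<close>

definition ou_integral :: "real \<Rightarrow> real" where
  "ou_integral t = (\<Sum>k<n. ou \<gamma> k * max 0 (min \<epsilon> (t - t0 - real k * \<epsilon>)))"

text \<open>By the integral equation this is \<open>x0\<close> plus the integral of
  \<open>(drift + \<gamma> * ou) / \<epsilon>\<close>, with no noise left. By
  \<open>ou_noise\<close> it agrees at grid times with the solution minus the process.\<close>

definition residual :: "real \<Rightarrow> real" where
  "residual t = x t - \<sigma> / sqrt \<epsilon> * (w t - w t0) + \<gamma> / \<epsilon> * ou_integral t"

lemma ou_integral_lipschitz: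
  assumes "s \<le> t"
  shows "\<bar>ou_integral t - ou_integral s\<bar> \<le> h * (t - s)"
proof -
  let ?c = "\<lambda>t k. max 0 (min \<epsilon> (t - t0 - real k * \<epsilon>))"
  have mono: "?c s k \<le> ?c t k" for k using assms by (auto simp: max_def min_def)
  have "\<bar>ou_integral t - ou_integral s\<bar> = \<bar>\<Sum>k<n. ou \<gamma> k * (?c t k - ?c s k)\<bar>"
    by (simp add: ou_integral_def sum_subtractf right_diff_distrib)
  also have "\<dots> \<le> (\<Sum>k<n. \<bar>ou \<gamma> k * (?c t k - ?c s k)\<bar>)" by (rule sum_abs)
  also have "\<dots> \<le> (\<Sum>k<n. h * (?c t k - ?c s k))"
    using ou_le mono by (intro sum_mono) (auto simp: abs_mult intro!: mult_right_mono)
  also have "\<dots> = h * ((\<Sum>k<n. ?c t k) - (\<Sum>k<n. ?c s k))"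
    by (simp add: sum_distrib_left[symmetric] sum_subtractf)
  also have "\<dots> \<le> h * (t - s)"
    using \<open>0 \<le> h\<close> eps_pos assms unfolding clamp_sum[OF less_imp_le[OF eps_pos]]
    by (intro mult_left_mono) (auto simp: max_def min_def)
  finally show ?thesis .
qed

text \<open>At fraction \<open>\<theta>\<close> of step \<open>k\<close> the difference is the local
  noise increment plus \<open>(1 - \<gamma> * \<theta>) * ou \<gamma> k\<close>, each at most
  \<open>h\<close> in absolute value.\<close>

lemma x_minus_residual:
  assumes "t \<in> {t0..t1}"
  shows "\<bar>x t - residual t\<bar> \<le> 2 * h"
proof -
  define k where "k = nat \<lfloor>(t - t0) / \<epsilon>\<rfloor>"
  have "0 \<le> (t - t0) / \<epsilon>" using assms eps_pos by simp
  then have "real k \<le> (t - t0) / \<epsilon>" "(t - t0) / \<epsilon> < real k + 1"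
    by (auto simp: k_def of_nat_nat)
  then have k: "real k * \<epsilon> \<le> t - t0" "t - t0 < real k * \<epsilon> + \<epsilon>"
    using eps_pos by (simp_all add: pos_le_divide_eq pos_divide_less_eq distrib_right)
  have "real k * \<epsilon> < real n * \<epsilon>" using k(1) n assms by simp
  then have kn: "k < n" using eps_pos by simp
  \<comment> \<open>Finished steps count \<open>\<epsilon>\<close>, the current one its elapsed
    part, later ones nothing.\<close>
  have "max 0 (min \<epsilon> (t - t0 - real j * \<epsilon>)) = (if j < k then \<epsilon> else if j = k then t - t0 - real k * \<epsilon> else 0)" for j
  proof -
    consider "j < k" | "j = k" | "k < j" by linarith
    then show ?thesis
    proof cases
      case 1
      then have "real (Suc j) * \<epsilon> \<le> real k * \<epsilon>" using eps_pos by (intro mult_right_mono) auto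
      then show ?thesis using 1 k eps_pos by (simp add: distrib_right)
    next
      case 3
      then have "real (Suc k) * \<epsilon> \<le> real j * \<epsilon>" using eps_pos by (intro mult_right_mono) auto
      then show ?thesis using 3 k eps_pos by (simp add: distrib_right)
    qed (use k in simp)
  qed
  then have "ou_integral t = (\<Sum>j<n. ou \<gamma> j * (if j < k then \<epsilon> else if j = k then t - t0 - real k * \<epsilon> else 0))"
    by (simp add: ou_integral_def)
  also have "\<dots> = (\<Sum>j<Suc k. ou \<gamma> j * (if j < k then \<epsilon> else if j = k then t - t0 - real k * \<epsilon> else 0))"
    using kn by (intro sum.mono_neutral_right) auto
  also have "\<dots> = (\<Sum>j<k. ou \<gamma> j * \<epsilon>) + ou \<gamma> k * (t - t0 - real k * \<epsilon>)" by simp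
  also have "(\<Sum>j<k. ou \<gamma> j * \<epsilon>) = (\<Sum>j<k. ou \<gamma> j) * \<epsilon>" by (rule sum_distrib_right[symmetric])
  finally have oi: "ou_integral t = (\<Sum>j<k. ou \<gamma> j) * \<epsilon> + ou \<gamma> k * (t - t0 - real k * \<epsilon>)" .
  define \<theta> where "\<theta> = (t - t0 - real k * \<epsilon>) / \<epsilon>"
  have \<theta>: "0 \<le> \<theta>" "\<theta> \<le> 1" using k eps_pos by (auto simp: \<theta>_def divide_simps)
  have "\<gamma> / \<epsilon> * ou_integral t = \<gamma> * (\<Sum>j<k. ou \<gamma> j) + \<gamma> * \<theta> * ou \<gamma> k"
    using eps_pos unfolding oi \<theta>_def by (simp add: distrib_left)
  moreover have "\<sigma> / sqrt \<epsilon> * (w t - w t0) = \<sigma> / sqrt \<epsilon> * (w t - w (t0 + real k * \<epsilon>))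
      + \<sigma> / sqrt \<epsilon> * (w (t0 + real k * \<epsilon>) - w t0)"
    by (simp only: distrib_left[symmetric]) simp
  ultimately have "x t - residual t = \<sigma> / sqrt \<epsilon> * (w t - w (t0 + real k * \<epsilon>)) + (1 - \<gamma> * \<theta>) * ou \<gamma> k"
    unfolding residual_def ou_noise[of k \<gamma>] by (simp add: algebra_simps)
  moreover have "\<bar>\<sigma> / sqrt \<epsilon> * (w t - w (t0 + real k * \<epsilon>))\<bar> \<le> h"
    using k by (intro local_le kn) auto
  moreover have "\<bar>(1 - \<gamma> * \<theta>) * ou \<gamma> k\<bar> \<le> 1 * h"
  proof -
    have "0 \<le> \<gamma> * \<theta>" "\<gamma> * \<theta> \<le> 1" using \<gamma> \<theta> by (auto intro!: mult_le_one)
    then show ?thesis unfolding abs_mult using ou_le[OF kn] by (intro mult_mono) auto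
  qed
  ultimately show ?thesis by linarith
qed

lemma residual_increment:
  assumes "t0 \<le> s" "s \<le> t" "t \<le> t1" "\<And>u. u \<in> {s..t} \<Longrightarrow> c \<le> drift a0 u (x u)"
  shows "(t - s) / \<epsilon> * (c - \<gamma> * h) \<le> residual t - residual s"
proof -
  have "\<sigma> / sqrt \<epsilon> * (w t - w t0) - \<sigma> / sqrt \<epsilon> * (w s - w t0) = \<sigma> / sqrt \<epsilon> * (w t - w s)"
    by (simp only: right_diff_distrib[symmetric]) simp
  then have "residual t - residual s = x t - x s - \<sigma> / sqrt \<epsilon> * (w t - w s)
      + \<gamma> / \<epsilon> * (ou_integral t - ou_integral s)"
    unfolding residual_def right_diff_distrib[of "\<gamma> / \<epsilon>"] by linarith
  moreover have "(t - s) / \<epsilon> * c + \<sigma> / sqrt \<epsilon> * (w t - w s) \<le> x t - x s"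
    using assms by (rule x_increment_ge)
  moreover have "\<gamma> / \<epsilon> * - (h * (t - s)) \<le> \<gamma> / \<epsilon> * (ou_integral t - ou_integral s)"
    using ou_integral_lipschitz[OF assms(2)] \<gamma> eps_pos by (intro mult_left_mono) auto
  moreover have "(t - s) / \<epsilon> * (c - \<gamma> * h) = (t - s) / \<epsilon> * c + \<gamma> / \<epsilon> * - (h * (t - s))"
    using eps_pos by (simp add: field_simps)
  ultimately show ?thesis by linarith
qed

text \<open>The integral equation cancels \<open>w\<close>, about whose regularity the locale says
  nothing, and leaves an integral and finitely many clamps.\<close>

lemma continuous_residual: "continuous_on {t0..t1} residual"
proof -
  have c: "continuous_on {t0..t1} (\<lambda>u. drift a0 u (x u) / \<epsilon>)"
    using eps_pos by (intro continuous_intros cont_drift) auto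
  have "continuous_on {t0..t1} (\<lambda>t. x0 + integral {t0..t} (\<lambda>u. drift a0 u (x u) / \<epsilon>) + \<gamma> / \<epsilon> * ou_integral t)"
    unfolding ou_integral_def
    by (intro continuous_intros indefinite_integral_continuous_1 integrable_continuous_real c)
  then show ?thesis
    by (rule continuous_on_cong[THEN iffD1, rotated 2]) (auto simp: residual_def x_eq)
qed

lemma residual_t0:
  assumes "t0 \<le> t1"
  shows "residual t0 = x0"
proof -
  have "max 0 (min \<epsilon> (t0 - t0 - real k * \<epsilon>)) = 0" for k
    using eps_pos by (intro max_absorb1 min.coboundedI2) simp
  then have "ou_integral t0 = 0" by (simp add: ou_integral_def)
  then show ?thesis using x_t0[OF assms] by (simp add: residual_def)
qed

text \<open>The residual cannot cross a barrier that is constant away from \<open>t = 0\<close>. For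
  \<open>\<bar>t\<bar> \<le> \<surd>\<gamma>\<close>, where the wells may be too close to the saddle to support it, the barrier is
  lowered at a constant rate faster than the drift can push.\<close>
lemma stays_positive:
  assumes a0: "0 < a0" and B: "0 < B" "B \<le> 1 / 4"
    and h: "12 * h \<le> B * sqrt \<gamma>" "8 * h \<le> B ^ 3 * sqrt \<gamma>" "0 < h"
    and outer: "\<And>u. u \<in> {t0..t1} \<Longrightarrow> sqrt \<gamma> \<le> \<bar>u\<bar> \<Longrightarrow> 4 * B\<^sup>2 * \<gamma> \<le> mu a0 u"
    and inner: "\<gamma> \<le> a0 \<or> \<gamma> * sqrt \<gamma> \<le> \<epsilon>"
    and t: "t0 \<le> - sqrt \<gamma>" "sqrt \<gamma> \<le> t1" and x0: "B * sqrt \<gamma> < x0"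
  shows "0 < x t1"
proof -
  let ?g = "sqrt \<gamma>"
  have g: "0 < ?g" using \<gamma> by simp
  have order: "- ?g \<le> ?g" "- ?g \<le> t1" "t0 \<le> ?g" "t0 \<le> t1" using g t by linarith+
  have h3: "8 * (\<gamma> * h) \<le> B ^ 3 * (\<gamma> * ?g)"
    using mult_left_mono[OF h(2), of \<gamma>] \<gamma> by (simp add: mult_ac)
  \<comment> \<open>Here \<open>l \<ge> 6 * h\<close>, so the deviations \<open>2 * h\<close> below
    and \<open>3 * h\<close> above are at most a third and a half of \<open>l\<close>.\<close>
  have range: "2 / 3 * l \<le> x u \<and> x u \<le> 3 / 2 * l"
    if "u \<in> {t0..t1}" "B * ?g / 2 \<le> l" "l \<le> residual u" "residual u \<le> l + h" for u l
    using x_minus_residual[OF that(1)] that h by (auto simp: abs_le_iff)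
  \<comment> \<open>Near the barrier
    \<open>mu a0 u - (x u)\<^sup>2 \<ge> (4 - 9/4) * l\<^sup>2\<close>, so the drift is at least
    \<open>l ^ 3 \<ge> B ^ 3 * (\<gamma> * sqrt \<gamma>) / 8\<close>, which covers the push
    \<open>\<gamma> * h\<close> of the subtracted process.\<close>
  have up: "\<gamma> * h \<le> drift a0 u (x u)"
    if u: "u \<in> {t0..t1}" "B * ?g / 2 \<le> l" "l \<le> B * ?g" "l \<le> residual u" "residual u \<le> l + h"
      and m: "4 * B\<^sup>2 * \<gamma> \<le> mu a0 u" for u l
  proof -
    have l: "0 < l" using u(2) B g by (smt (verit) divide_pos_pos mult_pos_pos)
    note r = range[OF u(1,2,4,5)]
    have "(x u)\<^sup>2 \<le> (3 / 2 * l)\<^sup>2" using r l by (intro power_mono) auto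
    moreover have "l\<^sup>2 \<le> (B * ?g)\<^sup>2" using u l by (intro power_mono) auto
    then have "4 * l\<^sup>2 \<le> mu a0 u" using m \<gamma> by (simp add: power_mult_distrib)
    ultimately have "7 / 4 * l\<^sup>2 \<le> mu a0 u - (x u)\<^sup>2" by (simp add: power_mult_distrib power_divide)
    then have "(2 / 3 * l) * (7 / 4 * l\<^sup>2) \<le> x u * (mu a0 u - (x u)\<^sup>2)"
      using r l by (intro mult_mono) auto
    moreover have "l ^ 3 \<le> (2 / 3 * l) * (7 / 4 * l\<^sup>2)"
      using l by (simp add: power2_eq_square power3_eq_cube)
    moreover have "(B * ?g / 2) ^ 3 \<le> l ^ 3" using u B g by (intro power_mono) auto
    moreover have "(B * ?g / 2) ^ 3 = B ^ 3 * (\<gamma> * ?g) / 8"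
      unfolding power_divide power_mult_distrib using \<gamma> by (simp add: power3_eq_cube)
    moreover have "x u * (mu a0 u - (x u)\<^sup>2) = drift a0 u (x u)"
      by (simp add: drift_def right_diff_distrib power2_eq_square power3_eq_cube)
    ultimately show ?thesis using h3 by linarith
  qed
  \<comment> \<open>When the well is too narrow for \<open>up\<close>, positivity of
    \<open>mu\<close> still leaves only the cubic term pulling down.\<close>
  have down: "- (B ^ 3 * (\<gamma> * ?g) * (27 / 8)) \<le> drift a0 u (x u)"
    if u: "u \<in> {t0..t1}" "B * ?g / 2 \<le> l" "l \<le> B * ?g" "l \<le> residual u" "residual u \<le> l + h" for u l
  proof -
    have l: "0 < l" using u(2) B g by (smt (verit) divide_pos_pos mult_pos_pos)
    note r = range[OF u(1,2,4,5)]
    have "x u ^ 3 \<le> (3 / 2 * (B * ?g)) ^ 3" using r l u by (intro power_mono) auto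
    also have "\<dots> = B ^ 3 * (\<gamma> * ?g) * (27 / 8)"
      unfolding power_mult_distrib using \<gamma> by (simp add: power3_eq_cube)
    finally have "x u ^ 3 \<le> B ^ 3 * (\<gamma> * ?g) * (27 / 8)" .
    moreover have "0 \<le> mu a0 u * x u"
      using mu_bounds(1)[of a0 u] a0 r l by (intro mult_nonneg_nonneg) auto
    ultimately show ?thesis unfolding drift_def by linarith
  qed
  have lev: "B * ?g / 2 \<le> B * ?g" using B g by simp
  have outer_step: "0 * (t - s) \<le> residual t - residual s"
    if st: "t0 \<le> s" "s \<le> t" "t \<le> t1" and l: "B * ?g / 2 \<le> l" "l \<le> B * ?g"
      and far: "\<And>u. u \<in> {s..t} \<Longrightarrow> ?g \<le> \<bar>u\<bar>"
      and reg: "\<And>u. u \<in> {s..t} \<Longrightarrow> l \<le> residual u \<and> residual u \<le> l + h" for s t l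
  proof -
    have "\<gamma> * h \<le> drift a0 u (x u)" if "u \<in> {s..t}" for u
      using st l reg[OF that] far[OF that] that by (intro up[of u l] outer) auto
    from residual_increment[OF st this] show ?thesis by simp
  qed
  have 1: "B * ?g + 0 * (u - t0) < residual u" if "u \<in> {t0..- ?g}" for u
  proof (rule affine_barrier[OF _ _ h(3) _ that])
    show "continuous_on {t0..- ?g} residual"
      using t order by (intro continuous_on_subset[OF continuous_residual]) auto
    show "B * ?g < residual t0" using x0 residual_t0 order by simp
    show "0 * (v - s) \<le> residual v - residual s"
      if "t0 \<le> s" "s \<le> v" "v \<le> - ?g"
        "\<And>u. u \<in> {s..v} \<Longrightarrow> B * ?g + 0 * (u - t0) \<le> residual u \<and> residual u \<le> B * ?g + 0 * (u - t0) + h" for s v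
      using that t order lev by (intro outer_step[of s v "B * ?g"]) auto
  qed
  \<comment> \<open>Slope \<open>- B / 4\<close> over a window of length
    \<open>2 * sqrt \<gamma>\<close> brings the barrier to half its height, the level kept
    afterwards.\<close>
  have 2: "B * ?g + - (B / 4) * (u - (- ?g)) < residual u" if "u \<in> {- ?g..?g}" for u
  proof (rule affine_barrier[OF _ _ h(3) _ that])
    show "continuous_on {- ?g..?g} residual"
      using t order by (intro continuous_on_subset[OF continuous_residual]) auto
    show "B * ?g < residual (- ?g)" using 1[of "- ?g"] t by simp
    fix s v assume st: "- ?g \<le> s" "s \<le> v" "v \<le> ?g"
      and reg: "\<And>u. u \<in> {s..v} \<Longrightarrow> B * ?g + - (B / 4) * (u - (- ?g)) \<le> residual u
        \<and> residual u \<le> B * ?g + - (B / 4) * (u - (- ?g)) + h"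
    have lev: "B * ?g / 2 \<le> B * ?g + - (B / 4) * (u - (- ?g))" "B * ?g + - (B / 4) * (u - (- ?g)) \<le> B * ?g"
      if "u \<in> {s..v}" for u
    proof -
      have "0 \<le> B / 4 * (u - (- ?g))" "B / 4 * (u - (- ?g)) \<le> B / 4 * (2 * ?g)"
        using that st B by (auto intro!: mult_left_mono)
      then show "B * ?g / 2 \<le> B * ?g + - (B / 4) * (u - (- ?g))" "B * ?g + - (B / 4) * (u - (- ?g)) \<le> B * ?g"
        by auto
    qed
    have sub: "t0 \<le> s" "v \<le> t1" using st t by linarith+
    show "- (B / 4) * (v - s) \<le> residual v - residual s"
      using inner
    proof
      assume "\<gamma> \<le> a0"
      have "4 * B\<^sup>2 \<le> 4 * (1 / 4)\<^sup>2" using B by (intro mult_left_mono power_mono) auto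
      then have "4 * B\<^sup>2 * \<gamma> \<le> 1 * \<gamma>" using \<gamma> by (intro mult_right_mono) (auto simp: power2_eq_square)
      then have "4 * B\<^sup>2 * \<gamma> \<le> mu a0 u" for u using mu_bounds(1)[of a0 u] \<open>\<gamma> \<le> a0\<close> by linarith
      then have "\<gamma> * h \<le> drift a0 u (x u)" if "u \<in> {s..v}" for u
        using lev[OF that] reg[OF that] that sub st by (intro up[of u "B * ?g + - (B / 4) * (u - (- ?g))"]) auto
      from residual_increment[OF sub(1) st(2) sub(2) this] have "0 \<le> residual v - residual s" by simp
      moreover have "0 \<le> B / 4 * (v - s)" using B st by simp
      ultimately show ?thesis by linarith
    next
      \<comment> \<open>The cubic term and the process together pull with at most
        \<open>27/8 + 1/8 = 7/2\<close> times \<open>B ^ 3 * (\<gamma> * sqrt \<gamma>)\<close>. By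
        \<open>B\<^sup>2 \<le> 1/16\<close> this is at most \<open>7/32 * B * \<epsilon>\<close>,
        less than the \<open>B / 4 * \<epsilon>\<close> that the slope allows.\<close>
      assume eps: "\<gamma> * ?g \<le> \<epsilon>"
      have "- (B ^ 3 * (\<gamma> * ?g) * (27 / 8)) \<le> drift a0 u (x u)" if "u \<in> {s..v}" for u
        using lev[OF that] reg[OF that] that sub st by (intro down[of u "B * ?g + - (B / 4) * (u - (- ?g))"]) auto
      from residual_increment[OF sub(1) st(2) sub(2) this]
      have "(v - s) / \<epsilon> * (- (B ^ 3 * (\<gamma> * ?g) * (27 / 8)) - \<gamma> * h) \<le> residual v - residual s" .
      moreover have "(v - s) / \<epsilon> * (- (B / 4) * \<epsilon>) \<le> (v - s) / \<epsilon> * (- (B ^ 3 * (\<gamma> * ?g) * (27 / 8)) - \<gamma> * h)"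
      proof (rule mult_left_mono)
        have "B\<^sup>2 \<le> (1 / 4)\<^sup>2" using B by (intro power_mono) auto
        then have "B * B\<^sup>2 \<le> B * (1 / 16)" using B by (intro mult_left_mono) (auto simp: power2_eq_square)
        then have "B ^ 3 * (\<gamma> * ?g) \<le> B * (1 / 16) * \<epsilon>"
          using B \<gamma> eps by (intro mult_mono) (auto simp: power3_eq_cube power2_eq_square)
        then have "B ^ 3 * (\<gamma> * ?g) * (7 / 2) \<le> B / 4 * \<epsilon>"
          using mult_pos_pos[OF B(1) eps_pos] by linarith
        then show "- (B / 4) * \<epsilon> \<le> - (B ^ 3 * (\<gamma> * ?g) * (27 / 8)) - \<gamma> * h" using h3 by linarith
      qed (use st eps_pos in auto)
      moreover have "(v - s) / \<epsilon> * (- (B / 4) * \<epsilon>) = - (B / 4) * (v - s)" using eps_pos by simp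
      ultimately show ?thesis by linarith
    qed
  qed
  have 3: "B * ?g / 2 + 0 * (u - ?g) < residual u" if "u \<in> {?g..t1}" for u
  proof (rule affine_barrier[OF _ _ h(3) _ that])
    show "continuous_on {?g..t1} residual"
      using t order by (intro continuous_on_subset[OF continuous_residual]) auto
    show "B * ?g / 2 < residual ?g" using 2[of ?g] g by simp
    show "0 * (v - s) \<le> residual v - residual s"
      if "?g \<le> s" "s \<le> v" "v \<le> t1"
        "\<And>u. u \<in> {s..v} \<Longrightarrow> B * ?g / 2 + 0 * (u - ?g) \<le> residual u \<and> residual u \<le> B * ?g / 2 + 0 * (u - ?g) + h" for s v
      using that t order lev by (intro outer_step[of s v "B * ?g / 2"]) auto
  qed
  have "B * ?g / 2 < residual t1" using 3[of t1] t by simp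
  then show ?thesis using x_minus_residual[of t1] h order by (auto simp: abs_le_iff)
qed

end

end

text \<open>\<open>x - x ^ 3 / 6\<close> is at least \<open>x / 3\<close> when
  \<open>x\<^sup>2 \<le> 4\<close>; the bound \<open>2\<close> exceeds
  \<open>pi / 2\<close>.\<close>

lemma sin_lower:
  assumes "0 \<le> x" "x \<le> 2"
  shows "x / 3 \<le> sin (x :: real)"
proof -
  have "\<bar>sin x - (\<Sum>m<3. sin_coeff m * x ^ m)\<bar> \<le> inverse (fact 3) * \<bar>x\<bar> ^ 3"
    by (rule Maclaurin_sin_bound)
  then have "x - x ^ 3 / 6 \<le> sin x"
    using assms by (simp add: eval_nat_numeral sin_coeff_def abs_if split: if_splits)
  moreover have "x * (x * x) \<le> x * (2 * 2)"
    using assms by (intro mult_left_mono mult_mono) auto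
  ultimately show ?thesis by (simp add: power3_eq_cube)
qed

text \<open>\<open>\<bar>sin (pi * t)\<bar>\<close> is at least \<open>2/3\<close> of the distance
  from \<open>\<bar>t\<bar>\<close> to the nearer of \<open>0\<close> and \<open>1\<close>, and that
  distance is at least \<open>\<delta> * \<bar>t\<bar>\<close>. Twice the square gives
  \<open>8/9\<close>, more than the stated \<open>1/2\<close>.\<close>

lemma mu_lower:
  assumes "0 \<le> a0" "0 < \<delta>" "\<delta> \<le> 1" "\<bar>t\<bar> \<le> 1 - \<delta>"
  shows "\<delta>\<^sup>2 / 2 * t\<^sup>2 \<le> mu a0 t"
proof -
  have sin: "2 / 3 * v \<le> sin (pi * v)" if "0 \<le> v" "v \<le> 1 / 2" for v
  proof -
    have "pi * v \<le> 4 * (1 / 2)" using that pi_less_4 by (intro mult_mono) auto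
    then have "pi * v / 3 \<le> sin (pi * v)" using that by (intro sin_lower) auto
    moreover have "2 * v \<le> pi * v" using that pi_ge_two by (intro mult_right_mono) auto
    ultimately show ?thesis by linarith
  qed
  have "2 / 3 * (\<delta> * \<bar>t\<bar>) \<le> \<bar>sin (pi * t)\<bar>"
  proof (cases "\<bar>t\<bar> \<le> 1 / 2")
    case True
    have "\<delta> * \<bar>t\<bar> \<le> 1 * \<bar>t\<bar>" using assms by (intro mult_right_mono) auto
    moreover have "\<bar>sin (pi * t)\<bar> = \<bar>sin (pi * \<bar>t\<bar>)\<bar>" by (simp add: abs_if)
    ultimately show ?thesis using sin[of "\<bar>t\<bar>"] True by linarith
  next
    case False
    have "\<delta> * \<bar>t\<bar> \<le> \<delta> * 1" using assms by (intro mult_left_mono) auto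
    moreover have "\<bar>sin (pi * t)\<bar> = \<bar>sin (pi * \<bar>t\<bar>)\<bar>" by (simp add: abs_if)
    moreover have "sin (pi * (1 - \<bar>t\<bar>)) = sin (pi * \<bar>t\<bar>)" by (simp add: right_diff_distrib sin_diff)
    moreover have "2 / 3 * (1 - \<bar>t\<bar>) \<le> sin (pi * (1 - \<bar>t\<bar>))" using False assms by (intro sin) auto
    moreover have "sin (pi * \<bar>t\<bar>) \<le> \<bar>sin (pi * \<bar>t\<bar>)\<bar>" by (rule abs_ge_self)
    ultimately show ?thesis using assms(4) by (simp del: abs_ge_self)
  qed
  then have "(2 / 3 * (\<delta> * \<bar>t\<bar>))\<^sup>2 \<le> (sin (pi * t))\<^sup>2"
    using assms by (subst abs_le_square_iff[symmetric]) (simp add: abs_mult)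
  then have "4 / 9 * (\<delta>\<^sup>2 * t\<^sup>2) \<le> (sin (pi * t))\<^sup>2"
    by (simp add: power_mult_distrib power_divide)
  moreover have "mu a0 t = a0 + 2 * (sin (pi * t))\<^sup>2"
    using cos_double_sin[of "pi * t"] by (simp add: mu_def mult.assoc)
  moreover have "0 \<le> \<delta>\<^sup>2 * t\<^sup>2" by simp
  ultimately show ?thesis using assms(1) by linarith
qed

section \<open>Probability estimates for both bounds\<close>

context sde
begin

text \<open>Over a step of length \<open>\<epsilon>\<close> the scaled increment has standard
  deviation \<open>\<sigma>\<close>. The process is a Gaussian sum whose variance is
  \<open>\<sigma>\<^sup>2\<close> times a sum of squared powers of \<open>r\<close>; dropping the
  squares leaves a geometric sum bounded by \<open>1 / \<gamma>\<close>.\<close>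

lemma ou_tail:
  fixes \<gamma> h :: real
  assumes \<gamma>: "0 < \<gamma>" "\<gamma> < 1" and h: "0 < h"
  defines "Z \<equiv> (\<lambda>i \<omega>. \<sigma> / sqrt \<epsilon> * (W (t0 + real (Suc i) * \<epsilon>) \<omega> - W (t0 + real i * \<epsilon>) \<omega>))"
  shows "prob {\<omega>\<in>space M. h \<le> \<bar>chain (\<lambda>_ y. (1 - \<gamma>) * y) 0 (\<lambda>i. Z i \<omega>) k\<bar>}
    \<le> 2 * exp (- h\<^sup>2 * \<gamma> / (2 * \<sigma>\<^sup>2))"
proof (cases "k = 0")
  case False
  define r where "r = 1 - \<gamma>"
  have r: "0 < r" "r < 1" using \<gamma> by (auto simp: r_def)
  have lt: "t0 + real i * \<epsilon> < t0 + real (Suc i) * \<epsilon>" for i using \<epsilon>_pos by simp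
  have indep: "indep_vars (\<lambda>_. borel) (\<lambda>j \<omega>. r ^ (k - Suc j) * Z j \<omega>) {..<k}"
    unfolding Z_def
    by (rule indep_vars_compose2[OF W_indep_increments[of _ "\<lambda>i. t0 + real i * \<epsilon>"]]) (use lt in auto)
  have Z: "distributed M lborel (Z j) (\<lambda>x. ennreal (normal_density 0 \<sigma> x))" for j
    using distributed_normal_scale[OF W_increment[OF lt[of j]], where c="\<sigma> / sqrt \<epsilon>"] \<sigma>_pos \<epsilon>_pos
    by (simp add: Z_def distrib_right)
  have rZ: "distributed M lborel (\<lambda>\<omega>. r ^ (k - Suc j) * Z j \<omega>)
      (\<lambda>x. ennreal (normal_density 0 (r ^ (k - Suc j) * \<sigma>) x))" for j
    using distributed_normal_scale[OF Z[of j] \<sigma>_pos, where c="r ^ (k - Suc j)"] r by simp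
  define s where "s = sqrt (\<Sum>j<k. (r ^ (k - Suc j) * \<sigma>)\<^sup>2)"
  have "{..<k} \<noteq> {}" using False by auto
  have sum: "distributed M lborel (\<lambda>\<omega>. \<Sum>j<k. r ^ (k - Suc j) * Z j \<omega>) (\<lambda>x. ennreal (normal_density 0 s x))"
    using sum_indep_normal[OF _ \<open>{..<k} \<noteq> {}\<close> indep _ rZ] r \<sigma>_pos by (simp add: s_def)
  have "0 < (\<Sum>j<k. (r ^ (k - Suc j) * \<sigma>)\<^sup>2)"
    using r \<sigma>_pos \<open>{..<k} \<noteq> {}\<close> by (intro sum_pos) auto
  then have s: "0 < s" "s\<^sup>2 = (\<Sum>j<k. (r ^ (k - Suc j) * \<sigma>)\<^sup>2)" by (simp_all add: s_def)
  have "(\<Sum>j<k. (r ^ (k - Suc j))\<^sup>2) = (\<Sum>j<k. (r ^ j)\<^sup>2)"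
    by (rule sum.nat_diff_reindex)
  also have "\<dots> \<le> (\<Sum>j<k. r ^ j)"
  proof (rule sum_mono)
    fix j
    show "(r ^ j)\<^sup>2 \<le> r ^ j"
      using mult_left_mono[of "r ^ j" 1 "r ^ j"] power_le_one[of r j] r by (simp add: power2_eq_square)
  qed
  finally have "\<gamma> * (\<Sum>j<k. (r ^ (k - Suc j))\<^sup>2) \<le> \<gamma> * (\<Sum>j<k. r ^ j)"
    using \<gamma> by (intro mult_left_mono) auto
  also have "\<dots> = 1 - r ^ k" using one_diff_power_eq[of r k] by (simp add: r_def)
  also have "\<dots> \<le> 1" using r by simp
  finally have "\<gamma> * (\<Sum>j<k. (r ^ (k - Suc j))\<^sup>2) * \<sigma>\<^sup>2 \<le> 1 * \<sigma>\<^sup>2" by (rule mult_right_mono) simp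
  moreover have "s\<^sup>2 = (\<Sum>j<k. (r ^ (k - Suc j))\<^sup>2) * \<sigma>\<^sup>2"
    unfolding s(2) sum_distrib_right by (simp add: power_mult_distrib)
  ultimately have "\<gamma> * s\<^sup>2 \<le> \<sigma>\<^sup>2" by (simp add: mult.assoc)
  then have "h\<^sup>2 * (\<gamma> * s\<^sup>2) \<le> h\<^sup>2 * \<sigma>\<^sup>2" by (rule mult_left_mono) simp
  then have "h\<^sup>2 * \<gamma> / (2 * \<sigma>\<^sup>2) \<le> h\<^sup>2 / (2 * s\<^sup>2)"
    using s(1) \<sigma>_pos by (simp add: divide_simps mult_ac)
  then have "exp (- h\<^sup>2 / (2 * s\<^sup>2)) \<le> exp (- h\<^sup>2 * \<gamma> / (2 * \<sigma>\<^sup>2))" by simp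
  moreover have "prob {\<omega>\<in>space M. h \<le> \<bar>\<Sum>j<k. r ^ (k - Suc j) * Z j \<omega>\<bar>} \<le> 2 * exp (- h\<^sup>2 / (2 * s\<^sup>2))"
    using normal_abs_tail[OF sum s(1)] h by simp
  ultimately show ?thesis unfolding chain_linear r_def by linarith
qed (use h in simp)

text \<open>Off the bad events \<open>stays_positive\<close> applies. Each of the \<open>n\<close>
  steps costs \<open>2\<close> for the process at its start and \<open>4\<close> for the local
  maximum, hence the factor \<open>6 * real n\<close>.\<close>

lemma transition_upper_bound:
  fixes B c \<gamma> :: real
  assumes a0: "0 < a0" and \<gamma>: "0 < \<gamma>" "\<gamma> < 1" and B: "0 < B" "B \<le> 1 / 4"
    and c: "0 < c" "12 * c \<le> B" "8 * c \<le> B ^ 3"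
    and outer: "\<And>u. u \<in> {t0..t1} \<Longrightarrow> sqrt \<gamma> \<le> \<bar>u\<bar> \<Longrightarrow> 4 * B\<^sup>2 * \<gamma> \<le> mu a0 u"
    and inner: "\<gamma> \<le> a0 \<or> \<gamma> * sqrt \<gamma> \<le> \<epsilon>"
    and t: "t0 \<le> - sqrt \<gamma>" "sqrt \<gamma> \<le> t1" and x0: "B * sqrt \<gamma> < x0"
    and n: "t1 < t0 + real n * \<epsilon>"
  shows "prob {\<omega>\<in>space M. X t1 \<omega> < 0} \<le> 6 * real n * exp (- (c\<^sup>2 / 2) * \<gamma>\<^sup>2 / \<sigma>\<^sup>2)"
proof -
  define h where "h = c * sqrt \<gamma>"
  have h: "0 < h" "h\<^sup>2 = c\<^sup>2 * \<gamma>" using c \<gamma> by (auto simp: h_def power_mult_distrib)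
  have h': "12 * h \<le> B * sqrt \<gamma>" "8 * h \<le> B ^ 3 * sqrt \<gamma>"
    using mult_right_mono[OF c(2), of "sqrt \<gamma>"] mult_right_mono[OF c(3), of "sqrt \<gamma>"] \<gamma>
    by (simp_all add: h_def mult.assoc)
  let ?e = "exp (- (c\<^sup>2 / 2) * \<gamma>\<^sup>2 / \<sigma>\<^sup>2)"
  let ?t = "\<lambda>k. t0 + real k * \<epsilon>"
  define O1 where "O1 k = {\<omega>\<in>space M. h \<le> \<bar>chain (\<lambda>_ y. (1 - \<gamma>) * y) 0
    (\<lambda>i. \<sigma> / sqrt \<epsilon> * (W (?t (Suc i)) \<omega> - W (?t i) \<omega>)) k\<bar>}" for k
  define O2 where "O2 k = {\<omega>\<in>space M. \<exists>u\<in>{?t k..?t k + \<epsilon>}. h * sqrt \<epsilon> / \<sigma> < \<bar>W u \<omega> - W (?t k) \<omega>\<bar>}" for k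
  have [measurable]: "O1 k \<in> events" for k unfolding O1_def chain_linear by measurable
  have [measurable]: "O2 k \<in> events" for k
    unfolding O2_def using W_max(1)[OF \<epsilon>_pos] h \<epsilon>_pos \<sigma>_pos by simp
  have P1: "prob (O1 k) \<le> 2 * ?e" for k
  proof -
    have e: "- h\<^sup>2 * \<gamma> / (2 * \<sigma>\<^sup>2) = - (c\<^sup>2 / 2) * \<gamma>\<^sup>2 / \<sigma>\<^sup>2"
      unfolding h(2) by (simp add: power2_eq_square)
    show ?thesis using ou_tail[OF \<gamma> h(1), of k] unfolding O1_def e .
  qed
  have P2: "prob (O2 k) \<le> 4 * ?e" for k
  proof -
    have "prob (O2 k) \<le> 4 * exp (- (h * sqrt \<epsilon> / \<sigma>)\<^sup>2 / (2 * \<epsilon>))"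
      unfolding O2_def using h \<epsilon>_pos \<sigma>_pos by (intro W_max(2)) auto
    also have "(h * sqrt \<epsilon> / \<sigma>)\<^sup>2 = c\<^sup>2 * \<gamma> * \<epsilon> / \<sigma>\<^sup>2"
      using \<epsilon>_pos by (simp add: power_divide power_mult_distrib h(2)[symmetric])
    also have "- (c\<^sup>2 * \<gamma> * \<epsilon> / \<sigma>\<^sup>2) / (2 * \<epsilon>) = - (c\<^sup>2 / 2 * \<gamma> / \<sigma>\<^sup>2)"
      using \<epsilon>_pos by simp
    also have "\<dots> \<le> - (c\<^sup>2 / 2 * \<gamma>\<^sup>2 / \<sigma>\<^sup>2)"
    proof -
      \<comment> \<open>The local maximum has the better exponent, with \<open>\<gamma>\<close> in
        place of \<open>\<gamma>\<^sup>2\<close>; it is weakened to the common one.\<close>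
      have "\<gamma>\<^sup>2 \<le> \<gamma>" using mult_left_mono[of \<gamma> 1 \<gamma>] \<gamma> by (simp add: power2_eq_square)
      then have "c\<^sup>2 / 2 * \<gamma>\<^sup>2 / \<sigma>\<^sup>2 \<le> c\<^sup>2 / 2 * \<gamma> / \<sigma>\<^sup>2"
        by (intro divide_right_mono mult_left_mono) auto
      then show ?thesis by simp
    qed
    finally show ?thesis by simp
  qed
  let ?bad = "(\<Union>k<n. O1 k) \<union> (\<Union>k<n. O2 k)"
  have "prob {\<omega>\<in>space M. X t1 \<omega> < 0} \<le> prob ?bad"
  proof (rule finite_measure_mono_AE)
    show "AE \<omega> in M. \<omega> \<in> {\<omega>\<in>space M. X t1 \<omega> < 0} \<longrightarrow> \<omega> \<in> ?bad"
      using AE_path AE_space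
    proof eventually_elim
      case (elim \<omega>)
      interpret p: sde_path \<epsilon> a0 \<sigma> t0 t1 x0 "\<lambda>t. X t \<omega>" "\<lambda>t. W t \<omega>" by fact
      have "0 < X t1 \<omega>" if "\<omega> \<notin> ?bad"
      proof (rule p.stays_positive[of \<gamma> h n, OF _ _ _ _ _ n a0 B h' h(1) outer inner t x0])
        show "\<bar>p.ou \<gamma> k\<bar> \<le> h" if "k < n" for k
        proof -
          have "\<omega> \<notin> O1 k" using \<open>\<omega> \<notin> ?bad\<close> that by blast
          then show ?thesis using elim(2) by (simp add: O1_def p.ou_def not_le)
        qed
        show "\<bar>\<sigma> / sqrt \<epsilon> * (W u \<omega> - W (?t k) \<omega>)\<bar> \<le> h"
          if "k < n" "u \<in> {?t k..?t k + \<epsilon>}" for k u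
        proof -
          have "\<omega> \<notin> O2 k" using \<open>\<omega> \<notin> ?bad\<close> that by blast
          then have "\<bar>W u \<omega> - W (?t k) \<omega>\<bar> \<le> h * sqrt \<epsilon> / \<sigma>"
            using that(2) elim(2) unfolding O2_def by (metis (mono_tags, lifting) mem_Collect_eq not_less)
          then have "\<sigma> / sqrt \<epsilon> * \<bar>W u \<omega> - W (?t k) \<omega>\<bar> \<le> \<sigma> / sqrt \<epsilon> * (h * sqrt \<epsilon> / \<sigma>)"
            using \<sigma>_pos \<epsilon>_pos by (intro mult_left_mono) auto
          then show ?thesis using \<sigma>_pos \<epsilon>_pos by (simp add: abs_mult)
        qed
      qed (use \<gamma> h in auto)
      then show ?case by (metis (mono_tags, lifting) mem_Collect_eq less_asym)
    qed
  qed auto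
  also have "\<dots> \<le> prob (\<Union>k<n. O1 k) + prob (\<Union>k<n. O2 k)"
    by (intro measure_Un_le) auto
  also have "prob (\<Union>k<n. O1 k) \<le> (\<Sum>k<n. prob (O1 k))"
    by (intro finite_measure_subadditive_finite) auto
  also have "(\<Sum>k<n. prob (O1 k)) \<le> (\<Sum>k<n. 2 * ?e)" by (intro sum_mono P1)
  also have "prob (\<Union>k<n. O2 k) \<le> (\<Sum>k<n. prob (O2 k))"
    by (intro finite_measure_subadditive_finite) auto
  also have "(\<Sum>k<n. prob (O2 k)) \<le> (\<Sum>k<n. 4 * ?e)" by (intro sum_mono P2)
  finally show ?thesis by simp
qed

text \<open>Rounding the number of blocks down costs at most the factor \<open>exp std_tail\<close>.
  The rate \<open>std_tail / 4\<close> is the block probability \<open>std_tail / 2\<close> times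
  the \<open>1/2\<close> in \<open>y\<close>.\<close>

lemma transition_lower_bound:
  assumes a0: "0 \<le> a0" "a0 \<le> \<sigma>" and t0: "t0 \<le> - sqrt \<sigma>" and t1: "0 < t1"
  shows "1 / 2 - exp std_tail * exp (- (std_tail / 4) * (\<sigma> * sqrt \<sigma> / \<epsilon>))
    \<le> prob {\<omega>\<in>space M. X t1 \<omega> < 0}"
proof -
  define p where "p = std_tail / 2"
  have p: "0 < p" "p \<le> 1"
    using std_tail_pos by (auto simp: p_def std_tail_def intro!: order_trans[OF prob_space.prob_le_1]
        prob_space_normal_density)
  define y where "y = \<sigma> * sqrt \<sigma> / (2 * \<epsilon>)"
  define n where "n = nat \<lfloor>y\<rfloor>"
  have "0 \<le> y" using \<sigma>_pos \<epsilon>_pos by (simp add: y_def)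
  then have n: "real n \<le> y" "y - 1 \<le> real n" by (auto simp: n_def of_nat_nat)
  have "real n * (2 * (\<epsilon> / \<sigma>)) \<le> y * (2 * (\<epsilon> / \<sigma>))"
    using n \<sigma>_pos \<epsilon>_pos by (intro mult_right_mono) auto
  also have "\<dots> = sqrt \<sigma>" using \<sigma>_pos \<epsilon>_pos by (simp add: y_def)
  finally have cr: "1 - (1 - p) ^ n \<le> prob crossed"
    unfolding p_def using a0 t0 t1 by (intro crossed_lower_bound)
  have "(1 - p) ^ n \<le> exp (- p) ^ n"
    using p exp_ge_add_one_self[of "- p"] by (intro power_mono) auto
  also have "\<dots> = exp (- p * real n)" by (simp add: exp_of_nat_mult[symmetric] mult.commute)
  also have "- p * real n \<le> p + - p * y"
    using mult_left_mono[OF n(2), of p] p by (simp add: algebra_simps)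
  then have "exp (- p * real n) \<le> exp p * exp (- p * y)" by (simp add: exp_add[symmetric])
  also have "\<dots> \<le> exp std_tail * exp (- p * y)"
    using std_tail_pos by (intro mult_right_mono) (auto simp: p_def)
  also have "- p * y = - (std_tail / 4) * (\<sigma> * sqrt \<sigma> / \<epsilon>)" by (simp add: p_def y_def)
  finally have "(1 - p) ^ n \<le> exp std_tail * exp (- (std_tail / 4) * (\<sigma> * sqrt \<sigma> / \<epsilon>))" .
  moreover have "0 < exp std_tail * exp (- (std_tail / 4) * (\<sigma> * sqrt \<sigma> / \<epsilon>))" by simp
  ultimately show ?thesis using cr crossed_le by linarith
qed

end

theorem theorem3p2:
  shows "\<forall>\<delta>>0. \<exists>\<epsilon>max>0. \<exists>amax>0. \<exists>\<sigma>max>0. \<exists>C>0. \<exists>\<kappa>>0.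
    \<forall>(M :: 'a measure) W X \<epsilon> a0 t0 t1 x0 \<sigma>.
      brownian_motion M W \<and> 0 < \<epsilon> \<and> \<epsilon> < \<epsilon>max \<and> 0 < a0 \<and> a0 < amax \<and>
      -1 + \<delta> \<le> t0 \<and> t0 \<le> -\<delta> \<and> \<delta> \<le> t1 \<and> t1 \<le> 1 - \<delta> \<and>
      \<delta> \<le> x0 \<and> x0 \<le> 1 / \<delta> \<and> 0 < \<sigma> \<and>
      sde_solution M W \<epsilon> a0 \<sigma> t0 t1 x0 X \<longrightarrow>
      (let \<sigma>c = max a0 (\<epsilon> powr (2/3));
           P = measure M {\<omega> \<in> space M. X t1 \<omega> < 0}
       in (\<sigma> < \<sigma>c \<longrightarrow> P \<le> C / \<epsilon> * exp (- \<kappa> * \<sigma>c\<^sup>2 / \<sigma>\<^sup>2)) \<and>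
          (\<sigma>c < \<sigma> \<and> \<sigma> < \<sigma>max \<longrightarrow>
             P \<ge> 1/2 - C * exp (- \<kappa> * \<sigma> powr (3/2) / (\<epsilon> * \<bar>ln \<sigma>\<bar>))))"
proof (intro allI impI)
  fix \<delta> :: real assume \<delta>: "0 < \<delta>"
  \<comment> \<open>\<open>\<delta>\<^sup>2\<close> keeps the window
    \<open>\<bar>t\<bar> \<le> sqrt \<gamma>\<close> inside \<open>{t0..t1}\<close>, and
    \<open>1/2\<close> keeps \<open>\<gamma>\<close> below one.\<close>
  define amax where "amax = min (1/2) (\<delta>\<^sup>2)"
  \<comment> \<open>Chosen so that \<open>\<epsilon> powr (2/3) < amax\<close>: both candidates for
    \<open>\<gamma>\<close> then obey one bound.\<close>
  define \<epsilon>max where "\<epsilon>max = amax powr (3/2)"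
  \<comment> \<open>\<open>1/3\<close> gives \<open>\<bar>ln \<sigma>\<bar> \<ge> 1\<close>, as
    \<open>exp 1 \<le> 3\<close>; \<open>\<delta>\<^sup>2\<close> gives
    \<open>t0 \<le> - sqrt \<sigma>\<close>.\<close>
  define \<sigma>max where "\<sigma>max = min (1/3) (\<delta>\<^sup>2)"
  \<comment> \<open>Then \<open>4 * B\<^sup>2\<close> is at most the coefficient
    \<open>\<delta>\<^sup>2 / 2\<close> of \<open>mu_lower\<close>, and the barrier starts below
    \<open>x0\<close>.\<close>
  define B where "B = \<delta> / 4"
  define c where "c = B ^ 3 / 12"
  \<comment> \<open>\<open>18\<close> is \<open>6 * 3\<close>, from
    \<open>real n \<le> 3 / \<epsilon>\<close>; the other summand is the rounding factor of the
    lower bound.\<close>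
  define C where "C = 18 + exp std_tail"
  define \<kappa> where "\<kappa> = min (c\<^sup>2 / 2) (std_tail / 4)"
  have amax: "0 < amax" "amax \<le> 1/2" "amax \<le> \<delta>\<^sup>2" using \<delta> by (auto simp: amax_def)
  have pos: "0 < \<epsilon>max" "0 < \<sigma>max" "0 < B" "0 < c" "0 < C" "0 < \<kappa>"
    using \<delta> amax std_tail_pos
    by (auto simp: \<epsilon>max_def \<sigma>max_def B_def c_def C_def \<kappa>_def add_pos_pos)
  show "\<exists>\<epsilon>max>0. \<exists>amax>0. \<exists>\<sigma>max>0. \<exists>C>0. \<exists>\<kappa>>0.
    \<forall>(M :: 'a measure) W X \<epsilon> a0 t0 t1 x0 \<sigma>.
      brownian_motion M W \<and> 0 < \<epsilon> \<and> \<epsilon> < \<epsilon>max \<and> 0 < a0 \<and> a0 < amax \<and>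
      -1 + \<delta> \<le> t0 \<and> t0 \<le> -\<delta> \<and> \<delta> \<le> t1 \<and> t1 \<le> 1 - \<delta> \<and>
      \<delta> \<le> x0 \<and> x0 \<le> 1 / \<delta> \<and> 0 < \<sigma> \<and>
      sde_solution M W \<epsilon> a0 \<sigma> t0 t1 x0 X \<longrightarrow>
      (let \<sigma>c = max a0 (\<epsilon> powr (2/3));
           P = measure M {\<omega> \<in> space M. X t1 \<omega> < 0}
       in (\<sigma> < \<sigma>c \<longrightarrow> P \<le> C / \<epsilon> * exp (- \<kappa> * \<sigma>c\<^sup>2 / \<sigma>\<^sup>2)) \<and>
          (\<sigma>c < \<sigma> \<and> \<sigma> < \<sigma>max \<longrightarrow>
             P \<ge> 1/2 - C * exp (- \<kappa> * \<sigma> powr (3/2) / (\<epsilon> * \<bar>ln \<sigma>\<bar>))))"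
  proof (rule exI[of _ \<epsilon>max], rule conjI[OF pos(1)], rule exI[of _ amax], rule conjI[OF amax(1)],
      rule exI[of _ \<sigma>max], rule conjI[OF pos(2)], rule exI[of _ C], rule conjI[OF pos(5)],
      rule exI[of _ \<kappa>], rule conjI[OF pos(6)], intro allI impI)
    fix M :: "'a measure" and W X and \<epsilon> a0 t0 t1 x0 \<sigma> :: real
    assume A: "brownian_motion M W \<and> 0 < \<epsilon> \<and> \<epsilon> < \<epsilon>max \<and> 0 < a0 \<and> a0 < amax \<and>
      -1 + \<delta> \<le> t0 \<and> t0 \<le> -\<delta> \<and> \<delta> \<le> t1 \<and> t1 \<le> 1 - \<delta> \<and>
      \<delta> \<le> x0 \<and> x0 \<le> 1 / \<delta> \<and> 0 < \<sigma> \<and> sde_solution M W \<epsilon> a0 \<sigma> t0 t1 x0 X"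
    interpret sde M W X \<epsilon> a0 \<sigma> t0 t1 x0
      using A \<delta> by unfold_locales auto
    have t: "-1 + \<delta> \<le> t0" "t0 \<le> - \<delta>" "\<delta> \<le> t1" "t1 \<le> 1 - \<delta>" and "\<delta> \<le> x0"
      and eps: "0 < \<epsilon>" "\<epsilon> < \<epsilon>max" and a0: "0 < a0" "a0 < amax" and \<sigma>: "0 < \<sigma>"
      using A by auto
    have \<delta>2: "\<delta> \<le> 1/2" using t by linarith
    define \<gamma> where "\<gamma> = max a0 (\<epsilon> powr (2/3))"
    have "\<epsilon> powr (2/3) < \<epsilon>max powr (2/3)" using eps by (intro powr_less_mono2) auto
    also have "\<epsilon>max powr (2/3) = amax" using amax by (simp add: \<epsilon>max_def powr_powr)
    finally have \<gamma>: "0 < \<gamma>" "\<gamma> < amax" using a0 by (auto simp: \<gamma>_def)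
    have sqrt_le: "sqrt v \<le> \<delta>" if "v \<le> \<delta>\<^sup>2" for v using that \<delta> by (intro real_le_lsqrt) auto
    have g: "sqrt \<gamma> \<le> \<delta>" using \<gamma> amax by (intro sqrt_le) linarith
    have "\<epsilon>max \<le> 1 powr (3/2)" unfolding \<epsilon>max_def using amax by (intro powr_mono2) auto
    then have "\<epsilon> \<le> 1" using eps by simp
    have upper: "prob {\<omega>\<in>space M. X t1 \<omega> < 0} \<le> C / \<epsilon> * exp (- \<kappa> * \<gamma>\<^sup>2 / \<sigma>\<^sup>2)"
    proof -
      define n where "n = nat \<lfloor>(t1 - t0) / \<epsilon>\<rfloor> + 1"
      have "0 \<le> (t1 - t0) / \<epsilon>" using t \<delta> eps by simp
      then have "real n = real_of_int \<lfloor>(t1 - t0) / \<epsilon>\<rfloor> + 1"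
        unfolding n_def by (simp add: of_nat_nat)
      then have n: "(t1 - t0) / \<epsilon> < real n" "real n \<le> (t1 - t0) / \<epsilon> + 1"
        by linarith+
      have "(t1 - t0) / \<epsilon> \<le> 2 / \<epsilon>" using t \<delta> eps by (intro divide_right_mono) auto
      moreover have "1 \<le> 1 / \<epsilon>" using eps \<open>\<epsilon> \<le> 1\<close> by simp
      ultimately have n3: "real n \<le> 3 / \<epsilon>" using n(2) by simp
      have B: "B \<le> 1/4" using \<delta>2 by (simp add: B_def)
      have "prob {\<omega>\<in>space M. X t1 \<omega> < 0} \<le> 6 * real n * exp (- (c\<^sup>2 / 2) * \<gamma>\<^sup>2 / \<sigma>\<^sup>2)"
      proof (rule transition_upper_bound[OF a0(1) \<gamma>(1) _ pos(3) B pos(4)])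
        have "B ^ 3 \<le> B ^ 1" using B pos(3) by (intro power_decreasing) auto
        then show "12 * c \<le> B" by (simp add: c_def)
        show "8 * c \<le> B ^ 3" using pos(3) by (simp add: c_def)
        show "4 * B\<^sup>2 * \<gamma> \<le> mu a0 u" if u: "u \<in> {t0..t1}" "sqrt \<gamma> \<le> \<bar>u\<bar>" for u
        proof -
          have "\<gamma> \<le> u\<^sup>2" using u(2) \<gamma>(1) by (metis abs_ge_zero real_sqrt_abs real_sqrt_le_iff)
          have "4 * B\<^sup>2 * \<gamma> \<le> \<delta>\<^sup>2 / 2 * \<gamma>" using \<gamma> by (simp add: B_def power_divide)
          also have "\<dots> \<le> \<delta>\<^sup>2 / 2 * u\<^sup>2" using \<open>\<gamma> \<le> u\<^sup>2\<close> by (intro mult_left_mono) auto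
          also have "\<dots> \<le> mu a0 u" using u t a0 \<delta> \<delta>2 by (intro mu_lower) auto
          finally show ?thesis .
        qed
        \<comment> \<open>If the maximum is not \<open>a0\<close>, then
          \<open>\<gamma> * sqrt \<gamma>\<close> equals \<open>\<epsilon>\<close> exactly; this is
          the origin of the exponent \<open>2/3\<close>.\<close>
        show "\<gamma> \<le> a0 \<or> \<gamma> * sqrt \<gamma> \<le> \<epsilon>"
        proof (cases "\<epsilon> powr (2/3) \<le> a0")
          case False
          then have "\<gamma> = \<epsilon> powr (2/3)" by (simp add: \<gamma>_def)
          then have "\<gamma> * sqrt \<gamma> = \<epsilon> powr (2/3) * \<epsilon> powr (1/3)"
            using eps by (simp add: powr_half_sqrt[symmetric] powr_powr)
          also have "\<dots> = \<epsilon>" using eps by (simp add: powr_add[symmetric])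
          finally show ?thesis by simp
        qed (simp add: \<gamma>_def)
        have "sqrt \<gamma> \<le> 1" using g \<delta>2 by linarith
        then have "B * sqrt \<gamma> \<le> B * 1" using pos(3) by (intro mult_left_mono) auto
        moreover have "B < x0" using \<delta> \<open>\<delta> \<le> x0\<close> by (simp add: B_def)
        ultimately show "B * sqrt \<gamma> < x0" by linarith
        show "t1 < t0 + real n * \<epsilon>" using n(1) eps by (simp add: pos_divide_less_eq)
      qed (use \<gamma> amax g t in auto)
      also have "\<dots> \<le> C / \<epsilon> * exp (- \<kappa> * \<gamma>\<^sup>2 / \<sigma>\<^sup>2)"
      proof (rule mult_mono)
        have "18 / \<epsilon> \<le> C / \<epsilon>" using eps by (intro divide_right_mono) (auto simp: C_def)
        then show "6 * real n \<le> C / \<epsilon>" using n3 by simp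
        have "\<kappa> * (\<gamma>\<^sup>2 / \<sigma>\<^sup>2) \<le> c\<^sup>2 / 2 * (\<gamma>\<^sup>2 / \<sigma>\<^sup>2)"
          by (intro mult_right_mono) (auto simp: \<kappa>_def)
        then show "exp (- (c\<^sup>2 / 2) * \<gamma>\<^sup>2 / \<sigma>\<^sup>2) \<le> exp (- \<kappa> * \<gamma>\<^sup>2 / \<sigma>\<^sup>2)" by simp
      qed (use pos eps in auto)
      finally show ?thesis .
    qed
    have lower: "1/2 - C * exp (- \<kappa> * \<sigma> powr (3/2) / (\<epsilon> * \<bar>ln \<sigma>\<bar>)) \<le> prob {\<omega>\<in>space M. X t1 \<omega> < 0}"
      if "\<gamma> < \<sigma>" "\<sigma> < \<sigma>max"
    proof -
      have "\<sigma> \<le> \<delta>\<^sup>2" "\<sigma> < 1/3" using that by (auto simp: \<sigma>max_def)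
      then have "sqrt \<sigma> \<le> \<delta>" by (intro sqrt_le)
      have "exp 1 * \<sigma> \<le> 3 * (1/3)"
        using exp_le \<open>\<sigma> < 1/3\<close> \<sigma> by (intro mult_mono) auto
      then have "\<sigma> \<le> exp (- 1)" by (simp add: exp_minus field_simps)
      then have "ln \<sigma> \<le> ln (exp (- 1))" using \<sigma> by (subst ln_le_cancel_iff) auto
      then have "ln \<sigma> \<le> - 1" by simp
      then have ln1: "1 \<le> \<bar>ln \<sigma>\<bar>" by simp
      let ?y = "\<sigma> * sqrt \<sigma> / \<epsilon>"
      have "\<sigma> powr (3/2) = \<sigma> powr (1 + 1/2)" by simp
      also have "\<dots> = \<sigma> * sqrt \<sigma>" using \<sigma> by (simp only: powr_add powr_half_sqrt powr_one)
      finally have s32: "\<sigma> powr (3/2) = \<sigma> * sqrt \<sigma>" .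
      have y: "0 \<le> ?y" using \<sigma> eps by simp
      \<comment> \<open>Division by \<open>\<bar>ln \<sigma>\<bar> \<ge> 1\<close> only weakens the
        exponent.\<close>
      have "\<kappa> * (?y / \<bar>ln \<sigma>\<bar>) \<le> std_tail / 4 * ?y"
      proof (rule mult_mono)
        show "?y / \<bar>ln \<sigma>\<bar> \<le> ?y" using divide_left_mono[OF ln1 y] ln1 by simp
        show "0 \<le> ?y / \<bar>ln \<sigma>\<bar>" using y by (rule divide_nonneg_nonneg) simp
      qed (use std_tail_pos in \<open>auto simp: \<kappa>_def\<close>)
      then have e: "exp (- (std_tail / 4) * ?y) \<le> exp (- \<kappa> * \<sigma> powr (3/2) / (\<epsilon> * \<bar>ln \<sigma>\<bar>))"
        unfolding s32 by simp
      have "exp std_tail * exp (- (std_tail / 4) * ?y)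
          \<le> C * exp (- \<kappa> * \<sigma> powr (3/2) / (\<epsilon> * \<bar>ln \<sigma>\<bar>))"
        by (rule mult_mono[OF _ e]) (auto simp: C_def)
      moreover have "1/2 - exp std_tail * exp (- (std_tail / 4) * ?y) \<le> prob {\<omega>\<in>space M. X t1 \<omega> < 0}"
        using that \<open>sqrt \<sigma> \<le> \<delta>\<close> t a0 \<delta> by (intro transition_lower_bound) (auto simp: \<gamma>_def)
      ultimately show ?thesis by linarith
    qed
    show "let \<sigma>c = max a0 (\<epsilon> powr (2/3));
           P = measure M {\<omega> \<in> space M. X t1 \<omega> < 0}
       in (\<sigma> < \<sigma>c \<longrightarrow> P \<le> C / \<epsilon> * exp (- \<kappa> * \<sigma>c\<^sup>2 / \<sigma>\<^sup>2)) \<and>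
          (\<sigma>c < \<sigma> \<and> \<sigma> < \<sigma>max \<longrightarrow>
             P \<ge> 1/2 - C * exp (- \<kappa> * \<sigma> powr (3/2) / (\<epsilon> * \<bar>ln \<sigma>\<bar>)))"
      unfolding Let_def \<gamma>_def[symmetric] using upper lower by blast
  qed
qed

end
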